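(* For every $t\in\mathbb{N}$, the class of $P_t$-free graphs is strongly QP-dispersible and $\tfrac12$-uniformly dispersible.
   Context: $P_t$ is the path on $t$ vertices; a graph is $P_t$-free if it has no induced subgraph isomorphic to $P_t$. For a graph $G$, $\mathbf{w}\colon V(G)\to\mathbb{N}$, $\mathbf{w}(S)=\sum_{v\in S}\mathbf{w}(v)$; $\mathbf{w}_I$ equals $\mathbf{w}$ on $I$ and $0$ elsewhere. For $X\subseteq V(G)$, consider the connected components of $G-X$; the pair is $(\gamma,\delta)$-good for $\mathbf{w}$ if $\mathbf{w}(X)\le\gamma\mathbf{w}(V(G))$ and for every component $C$ of $G-X$ that is not a single isolated vertex of $G$, $\mathbf{w}(V(C))\le(1-\delta)\mathbf{w}(V(G))$ and $\mathbf{w}(X)\le\gamma\mathbf{w}(V(G)\setminus V(C))$. A strong $(\gamma,\delta)$-disperser for $(G,\mathbf{w})$ is a family $\mathcal{D}$ of subsets $X\subseteq V(G)$ such that for every independent set $I$ with $\mathbf{w}(I)>0$ some $X\in\mathcal{D}$ is $(\gamma,\delta)$-good for $\mathbf{w}_I$. A hereditary class $\mathcal{C}$ is strongly QP-dispersible if there is a polynomial $q$ such that for every $\gamma\in(0,1/2)$ there are a nonincreasing $\delta\colon\mathbb{N}\to(0,1/2)$ with $\delta(n)^{-1}\le q(\log n,\gamma^{-1})$, computable in polynomial time from $\gamma,n$, and an algorithm that, given an $n$-vertex $G\in\mathcal{C}$ and $\mathbf{w}$, runs in time $2^{q(\log n,\gamma^{-1})}$ and outputs a strong $(\gamma,\delta(n))$-disperser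 of size at most $2^{q(\log n,\gamma^{-1})}$. An extended strip decomposition of $G$: a simple nonempty graph $H$, sets $\eta(e)$ for edges $e=uv$ of $H$ with $\eta(e,u),\eta(e,v)\subseteq\eta(e)$, sets $\eta(v)$ for $v\in V(H)$, sets $\eta(T)$ for triangles $T$ of $H$, partitioning $V(G)$, with $\eta(vu,v)$ complete to $\eta(vw,v)$ for distinct edges $vu,vw$, and every edge of $G$ inside some $\eta(e),\eta(v),\eta(T)$, or between $\eta(e,v)$ and $\eta(e',v)$ for distinct edges $e,e'$ at $v$, or between $\eta(v)$ and $\eta(e,v)$, or between $\eta(T)$ and $\eta(e,u)\cap\eta(e,v)$ for an edge $e=uv$ of triangle $T$. Its atoms: $A_e^\bot=\eta(e)\setminus(\eta(e,u)\cup\eta(e,v))$, $A_e^u=\eta(u)\cup(\eta(e)\setminus\eta(e,v))$, $A_e^v$ symmetric, $A_e^{uv}=\eta(u)\cup\eta(v)\cup\eta(e)\cup\bigcup_{T\ni e}\eta(T)$, $A_v=\eta(v)$, $A_T=\eta(T)$. A $\xi$-uniform disperser for $G$ is a pair $(X,(H,\eta))$, $(H,\eta)$ an extended strip decomposition of $G-X$, with $|X|\le|V(G)|^{-\xi}|V(G)\setminus A|$ and $|A|\le|V(G)|-|V(G)|^{\xi}$ for every atom $A$. A hereditary class is $\xi$-uniformly dispersible if there exist constants $n_0>0,\tau>0$ and a polynomial-time algorithm that, given a connected $G$ in the class with $n\ge n_0$ vertices and $|N[v]|\le\tau n^{\xi}$ for all $v$, outputs a $\xi$-uniform disperser for $G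$.
   Formalization: In "(γ,δ)-good", every single-vertex component of G−X is exempt, not only isolated vertices of G; with the literal exemption the claim fails for t≥3 (G=K_2, w=1, I one endpoint: no X is good). *)

theory Defs
  imports
    Complex_Main
    "HOL-Library.Disjoint_Sets"
    "HOL-Library.Log_Nat"
    "HOL-Computational_Algebra.Polynomial"
begin

section \<open>Finite simple graphs\<close>

type_synonym 'a graph = "'a set \<times> 'a set set"

abbreviation verts :: "'a graph \<Rightarrow> 'a set" where "verts \<equiv> fst"
abbreviation edges :: "'a graph \<Rightarrow> 'a set set" where "edges \<equiv> snd"

definition sgraph :: "'a graph \<Rightarrow> bool" where
  "sgraph G \<longleftrightarrow> finite (verts G) \<and> (\<forall>e\<in>edges G. e \<subseteq> verts G \<and> card e = 2)"

definition induced :: "'a graph \<Rightarrow> 'a set \<Rightarrow> 'a graph" where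
  "induced G S = (verts G \<inter> S, {e \<in> edges G. e \<subseteq> S})"

definition del_verts :: "'a graph \<Rightarrow> 'a set \<Rightarrow> 'a graph" where
  "del_verts G X = induced G (verts G - X)"

definition isomorphic :: "'a graph \<Rightarrow> 'b graph \<Rightarrow> bool" where
  "isomorphic G H \<longleftrightarrow> (\<exists>f. bij_betw f (verts G) (verts H) \<and>
     (\<forall>u\<in>verts G. \<forall>v\<in>verts G. {u, v} \<in> edges G \<longleftrightarrow> {f u, f v} \<in> edges H))"

definition closed_nbhd :: "'a graph \<Rightarrow> 'a \<Rightarrow> 'a set" where
  "closed_nbhd G v = insert v {u. {u, v} \<in> edges G}"

definition independent :: "'a graph \<Rightarrow> 'a set \<Rightarrow> bool" where
  "independent G I \<longleftrightarrow> I \<subseteq> verts G \<and> (\<forall>u\<in>I. \<forall>v\<in>I. {u, v} \<notin> edges G)"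

definition component_of :: "'a graph \<Rightarrow> 'a \<Rightarrow> 'a set" where
  "component_of G v = {u \<in> verts G. (v, u) \<in> {(x, y). {x, y} \<in> edges G}\<^sup>*}"

definition components :: "'a graph \<Rightarrow> 'a set set" where
  "components G = component_of G ` verts G"

definition connected_graph :: "'a graph \<Rightarrow> bool" where
  "connected_graph G \<longleftrightarrow> (\<exists>C. components G = {C})"

definition triangles :: "'a graph \<Rightarrow> 'a set set" where
  "triangles G = {{u, v, w} | u v w. {u, v} \<in> edges G \<and> {v, w} \<in> edges G \<and> {u, w} \<in> edges G
                                   \<and> u \<noteq> v \<and> v \<noteq> w \<and> u \<noteq> w}"

definition path_graph :: "nat \<Rightarrow> nat graph" where
  "path_graph t = ({..<t}, {{i, Suc i} | i. Suc i < t})"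

text \<open>A class of graphs is represented by its members with vertices in \<open>nat\<close>; as classes are closed
  under isomorphism, nothing is lost.\<close>

definition hereditary :: "nat graph set \<Rightarrow> bool" where
  "hereditary \<C> \<longleftrightarrow> (\<forall>G\<in>\<C>. sgraph G
      \<and> (\<forall>S. S \<subseteq> verts G \<longrightarrow> induced G S \<in> \<C>)
      \<and> (\<forall>G'. sgraph G' \<and> isomorphic G G' \<longrightarrow> G' \<in> \<C>))"

definition P_free_class :: "nat \<Rightarrow> nat graph set" where
  "P_free_class t =
     {G. sgraph G \<and> \<not> (\<exists>S. S \<subseteq> verts G \<and> isomorphic (induced G S) (path_graph t))}"


section \<open>Model of computation\<close>

text \<open>
  Structured random access programs.  The store consists of arrays of natural numbers (finitely many
  of which are named in a program), addressed indirectly; the arithmetic is addition and truncated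
  subtraction, and each command costs one time unit.  There is deliberately no multiplication, so
  that in time \<open>T\<close> the bit length of a number grows by at most \<open>O(T)\<close>: up to polynomial factors this
  is Turing machine time on the inputs' bit length, except that an input number (such as a vertex
  weight) is handled in unit time.  The input is in the array \<open>in\<close>; all other cells are
  initially 0.  The output is a write-only tape.
\<close>

datatype aexp =
    Num nat
  | Cell string aexp
  | Plus aexp aexp
  | Minus aexp aexp

datatype com =
    Skip
  | Assign string aexp aexp
  | Write aexp
  | Seq com com
  | Cond aexp com com
  | While aexp com

type_synonym store = "string \<Rightarrow> nat \<Rightarrow> nat"

fun aval :: "aexp \<Rightarrow> store \<Rightarrow> nat" where
  "aval (Num k) s = k"
| "aval (Cell x a) s = s x (aval a s)"
| "aval (Plus a b) s = aval a s + aval b s"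
| "aval (Minus a b) s = aval a s - aval b s"

text \<open>\<open>exec c s t s' out\<close>: from store \<open>s\<close>, the command \<open>c\<close> halts after exactly \<open>t\<close> steps in store
  \<open>s'\<close>, having written \<open>out\<close>.  Tests succeed on nonzero values.\<close>

inductive exec :: "com \<Rightarrow> store \<Rightarrow> nat \<Rightarrow> store \<Rightarrow> nat list \<Rightarrow> bool" where
  Skip: "exec Skip s 1 s []"
| Assign: "exec (Assign x a b) s 1 (s(x := (s x)(aval a s := aval b s))) []"
| Write: "exec (Write a) s 1 s [aval a s]"
| Seq: "\<lbrakk> exec c s t s' out; exec d s' t' s'' out' \<rbrakk>
         \<Longrightarrow> exec (Seq c d) s (t + t') s'' (out @ out')"
| CondTrue: "\<lbrakk> aval a s \<noteq> 0; exec c s t s' out \<rbrakk> \<Longrightarrow> exec (Cond a c d) s (Suc t) s' out"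
| CondFalse: "\<lbrakk> aval a s = 0; exec d s t s' out \<rbrakk> \<Longrightarrow> exec (Cond a c d) s (Suc t) s' out"
| WhileFalse: "aval a s = 0 \<Longrightarrow> exec (While a c) s 1 s []"
| WhileTrue: "\<lbrakk> aval a s \<noteq> 0; exec c s t s' out; exec (While a c) s' t' s'' out' \<rbrakk>
         \<Longrightarrow> exec (While a c) s (Suc (t + t')) s'' (out @ out')"

definition init_store :: "nat list \<Rightarrow> store" where
  "init_store xs = (\<lambda>x i. if x = ''in'' \<and> i < length xs then xs ! i else 0)"

definition outputs_within :: "com \<Rightarrow> nat list \<Rightarrow> nat list \<Rightarrow> real \<Rightarrow> bool" where
  "outputs_within P xs ys T \<longleftrightarrow> (\<exists>s' t. exec P (init_store xs) t s' ys \<and> real t \<le> T)"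

text \<open>Input graphs have vertex set \<open>{..<n}\<close> and are given by \<open>n\<close> and the adjacency matrix.\<close>

definition graph_code :: "nat graph \<Rightarrow> nat list" where
  "graph_code G = (let n = card (verts G) in
     n # concat (map (\<lambda>i. map (\<lambda>j. if {i, j} \<in> edges G then 1 else 0) [0..<n]) [0..<n]))"

definition weighted_graph_code :: "nat graph \<Rightarrow> (nat \<Rightarrow> nat) \<Rightarrow> nat list" where
  "weighted_graph_code G w = graph_code G @ map w [0..<card (verts G)]"

text \<open>A list of lists of numbers is written down with every number increased by one and every inner
  list terminated by 0.\<close>

definition blocks :: "nat list list \<Rightarrow> nat list" where
  "blocks xss = concat (map (\<lambda>xs. map Suc xs @ [0]) xss)"


section \<open>Strong QP-dispersibility\<close>

definition weight :: "('a \<Rightarrow> nat) \<Rightarrow> 'a set \<Rightarrow> real" where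
  "weight w S = real (\<Sum>v\<in>S. w v)"

definition weight_on :: "('a \<Rightarrow> nat) \<Rightarrow> 'a set \<Rightarrow> 'a \<Rightarrow> nat" where
  "weight_on w I = (\<lambda>v. if v \<in> I then w v else 0)"

text \<open>A component of \<open>G - X\<close> is exempt if it consists of a single vertex, that is, if it is an isolated
  vertex of \<open>G - X\<close>.  (Exempting only isolated vertices of \<open>G\<close> itself would leave no good set when
  \<open>G\<close> is a single edge and all the weight is on one end.)\<close>

definition good_set :: "real \<Rightarrow> real \<Rightarrow> 'a graph \<Rightarrow> ('a \<Rightarrow> nat) \<Rightarrow> 'a set \<Rightarrow> bool" where
  "good_set \<gamma> \<delta> G w X \<longleftrightarrow>
     X \<subseteq> verts G \<and>
     weight w X \<le> \<gamma> * weight w (verts G) \<and>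
     (\<forall>C\<in>components (del_verts G X). \<not> (\<exists>v. C = {v}) \<longrightarrow>
        weight w C \<le> (1 - \<delta>) * weight w (verts G) \<and>
        weight w X \<le> \<gamma> * weight w (verts G - C))"

definition strong_disperser ::
  "real \<Rightarrow> real \<Rightarrow> 'a graph \<Rightarrow> ('a \<Rightarrow> nat) \<Rightarrow> 'a set set \<Rightarrow> bool" where
  "strong_disperser \<gamma> \<delta> G w \<D> \<longleftrightarrow>
     \<D> \<subseteq> Pow (verts G) \<and>
     (\<forall>I. independent G I \<and> weight w I > 0 \<longrightarrow> (\<exists>X\<in>\<D>. good_set \<gamma> \<delta> G (weight_on w I) X))"

text \<open>A polynomial in two variables is a polynomial in the first variable whose coefficients are
  polynomials in the second.\<close>

definition poly2 :: "real poly poly \<Rightarrow> real \<Rightarrow> real \<Rightarrow> real" where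
  "poly2 q x y = poly (poly q [:x:]) y"

text \<open>Polynomial-time computability of the real number \<open>\<delta> \<gamma> n\<close> from the real number
  \<open>\<gamma> \<in> (0, 1/2)\<close> and from \<open>n\<close>, in the sense of Ko and Friedman: one program produces approximations
  of \<open>\<delta> \<gamma> n\<close> with error \<open>2\<^sup>-\<^sup>k\<close> from approximations of \<open>\<gamma>\<close> with error \<open>2\<^sup>-\<^sup>m\<close>, where \<open>m\<close> and the
  time are polynomially bounded in \<open>k\<close> and the number \<open>floorlog 2 n\<close> of binary digits of \<open>n\<close>.\<close>

definition poly_time_computable :: "(real \<Rightarrow> nat \<Rightarrow> real) \<Rightarrow> bool" where
  "poly_time_computable \<delta> \<longleftrightarrow> (\<exists>P (p :: nat poly) (r :: nat poly).
     \<forall>\<gamma>\<in>{0<..<1/2}. \<forall>n k a. let l = floorlog 2 n + k; m = poly p l in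
       \<bar>\<gamma> - real a / 2 ^ m\<bar> \<le> 1 / 2 ^ m \<longrightarrow>
       (\<exists>d. outputs_within P [n, k, m, a] [d] (real (poly r l)) \<and>
            \<bar>\<delta> \<gamma> n - real d / 2 ^ k\<bar> \<le> 1 / 2 ^ k))"

text \<open>Note that \<open>log 2 0 = 0\<close>, so for \<open>n = 0\<close> the bounds are those for \<open>n = 1\<close>.\<close>

definition strongly_QP_dispersible :: "nat graph set \<Rightarrow> bool" where
  "strongly_QP_dispersible \<C> \<longleftrightarrow> hereditary \<C> \<and>
     (\<exists>(q :: real poly poly) (\<delta> :: real \<Rightarrow> nat \<Rightarrow> real).
        poly_time_computable \<delta> \<and>
        (\<forall>\<gamma>\<in>{0<..<1/2}.
           antimono (\<delta> \<gamma>) \<and>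
           (\<forall>n. \<delta> \<gamma> n \<in> {0<..<1/2} \<and> inverse (\<delta> \<gamma> n) \<le> poly2 q (log 2 (real n)) (inverse \<gamma>)) \<and>
           (\<exists>P. \<forall>n G (w :: nat \<Rightarrow> nat). G \<in> \<C> \<and> verts G = {..<n} \<longrightarrow>
              (let B = 2 powr poly2 q (log 2 (real n)) (inverse \<gamma>) in
               \<exists>Xs. outputs_within P (weighted_graph_code G w) (blocks Xs) B \<and>
                    strong_disperser \<gamma> (\<delta> \<gamma> n) G w (set (map set Xs)) \<and>
                    real (card (set (map set Xs))) \<le> B))))"


section \<open>Uniform dispersibility\<close>

datatype 'h part = Vtx 'h | Edg "'h set" | Tri "'h set"

definition parts :: "'h graph \<Rightarrow> 'h part set" where
  "parts H = Vtx ` verts H \<union> Edg ` edges H \<union> Tri ` triangles H"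

text \<open>An extended strip decomposition is given by \<open>H\<close>, the sets \<open>\<eta>(v)\<close>, \<open>\<eta>(e)\<close>, \<open>\<eta>(T)\<close> (all in
  \<open>\<eta>\<close>) and the sets \<open>\<eta>(e,v)\<close> (written \<open>\<epsilon> e v\<close>).  As usual, the parts may be empty.\<close>

definition esd_edge ::
  "'h graph \<Rightarrow> ('h part \<Rightarrow> 'a set) \<Rightarrow> ('h set \<Rightarrow> 'h \<Rightarrow> 'a set) \<Rightarrow> 'a \<Rightarrow> 'a \<Rightarrow> bool" where
  "esd_edge H \<eta> \<epsilon> x y \<longleftrightarrow>
     (\<exists>z\<in>parts H. x \<in> \<eta> z \<and> y \<in> \<eta> z) \<or>
     (\<exists>e\<in>edges H. \<exists>f\<in>edges H. \<exists>v\<in>e \<inter> f. e \<noteq> f \<and> x \<in> \<epsilon> e v \<and> y \<in> \<epsilon> f v) \<or>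
     (\<exists>e\<in>edges H. \<exists>v\<in>e. x \<in> \<eta> (Vtx v) \<and> y \<in> \<epsilon> e v) \<or>
     (\<exists>T\<in>triangles H. \<exists>e\<in>edges H. e \<subseteq> T \<and> x \<in> \<eta> (Tri T) \<and> (\<forall>v\<in>e. y \<in> \<epsilon> e v))"

definition esd ::
  "'a graph \<Rightarrow> 'h graph \<Rightarrow> ('h part \<Rightarrow> 'a set) \<Rightarrow> ('h set \<Rightarrow> 'h \<Rightarrow> 'a set) \<Rightarrow> bool" where
  "esd G H \<eta> \<epsilon> \<longleftrightarrow>
     sgraph H \<and> verts H \<noteq> {} \<and>
     (\<forall>e\<in>edges H. \<forall>v\<in>e. \<epsilon> e v \<subseteq> \<eta> (Edg e)) \<and>
     (\<Union>z\<in>parts H. \<eta> z) = verts G \<and> disjoint_family_on \<eta> (parts H) \<and>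
     (\<forall>e\<in>edges H. \<forall>f\<in>edges H. \<forall>v\<in>e \<inter> f. e \<noteq> f \<longrightarrow>
        (\<forall>x\<in>\<epsilon> e v. \<forall>y\<in>\<epsilon> f v. {x, y} \<in> edges G)) \<and>
     (\<forall>x y. {x, y} \<in> edges G \<longrightarrow> esd_edge H \<eta> \<epsilon> x y \<or> esd_edge H \<eta> \<epsilon> y x)"

definition atoms ::
  "'h graph \<Rightarrow> ('h part \<Rightarrow> 'a set) \<Rightarrow> ('h set \<Rightarrow> 'h \<Rightarrow> 'a set) \<Rightarrow> 'a set set" where
  "atoms H \<eta> \<epsilon> =
     {\<eta> (Edg {u, v}) - (\<epsilon> {u, v} u \<union> \<epsilon> {u, v} v) | u v. {u, v} \<in> edges H} \<union>
     {\<eta> (Vtx u) \<union> (\<eta> (Edg {u, v}) - \<epsilon> {u, v} v) | u v. {u, v} \<in> edges H} \<union>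
     {\<eta> (Vtx u) \<union> \<eta> (Vtx v) \<union> \<eta> (Edg {u, v}) \<union> (\<Union>T\<in>{T \<in> triangles H. {u, v} \<subseteq> T}. \<eta> (Tri T))
        | u v. {u, v} \<in> edges H} \<union>
     {\<eta> (Vtx v) | v. v \<in> verts H} \<union>
     {\<eta> (Tri T) | T. T \<in> triangles H}"

definition uniform_disperser ::
  "real \<Rightarrow> 'a graph \<Rightarrow> 'a set \<Rightarrow> 'h graph \<Rightarrow> ('h part \<Rightarrow> 'a set) \<Rightarrow> ('h set \<Rightarrow> 'h \<Rightarrow> 'a set) \<Rightarrow> bool" where
  "uniform_disperser \<xi> G X H \<eta> \<epsilon> \<longleftrightarrow>
     (let n = real (card (verts G)) in
      X \<subseteq> verts G \<and> esd (del_verts G X) H \<eta> \<epsilon> \<and>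
      (\<forall>A\<in>atoms H \<eta> \<epsilon>. real (card X) \<le> n powr (- \<xi>) * real (card (verts G - A)) \<and>
                       real (card A) \<le> n - n powr \<xi>))"

text \<open>\<open>codes_disperser out X H \<eta> \<epsilon>\<close>: \<open>out\<close> lists \<open>X\<close>, the vertices of \<open>H\<close>, the sets \<open>\<eta>(v)\<close> in the
  same order, then for each edge \<open>e = uv\<close> the block \<open>u, v\<close> followed by \<open>\<eta>(e)\<close>, \<open>\<eta>(e,u)\<close>, \<open>\<eta>(e,v)\<close>,
  and for each triangle \<open>T = uvw\<close> the block \<open>u, v, w\<close> followed by \<open>\<eta>(T)\<close>.\<close>

definition codes_disperser ::
  "nat list \<Rightarrow> nat set \<Rightarrow> nat graph \<Rightarrow> (nat part \<Rightarrow> nat set) \<Rightarrow> (nat set \<Rightarrow> nat \<Rightarrow> nat set) \<Rightarrow> bool" where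
  "codes_disperser out X H \<eta> \<epsilon> \<longleftrightarrow>
     (\<exists>xs vs es ts lv le lev lt.
        set xs = X \<and> set vs = verts H \<and>
        {{u, v} | u v. (u, v) \<in> set es} = edges H \<and>
        {{u, v, w} | u v w. (u, v, w) \<in> set ts} = triangles H \<and>
        (\<forall>v\<in>verts H. set (lv v) = \<eta> (Vtx v)) \<and>
        (\<forall>e\<in>edges H. set (le e) = \<eta> (Edg e) \<and> (\<forall>v\<in>e. set (lev e v) = \<epsilon> e v)) \<and>
        (\<forall>T\<in>triangles H. set (lt T) = \<eta> (Tri T)) \<and>
        out = blocks ([xs, vs] @ map lv vs @
          concat (map (\<lambda>(u, v). [[u, v], le {u, v}, lev {u, v} u, lev {u, v} v]) es) @
          concat (map (\<lambda>(u, v, w). [[u, v, w], lt {u, v, w}]) ts)))"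

definition uniformly_dispersible :: "real \<Rightarrow> nat graph set \<Rightarrow> bool" where
  "uniformly_dispersible \<xi> \<C> \<longleftrightarrow> hereditary \<C> \<and>
     (\<exists>(n\<^sub>0 :: nat) (\<tau> :: real) P (p :: nat poly). n\<^sub>0 > 0 \<and> \<tau> > 0 \<and>
        (\<forall>n G. n \<ge> n\<^sub>0 \<and> G \<in> \<C> \<and> verts G = {..<n} \<and> connected_graph G \<and>
           (\<forall>v\<in>verts G. real (card (closed_nbhd G v)) \<le> \<tau> * real n powr \<xi>) \<longrightarrow>
           (\<exists>out X (H :: nat graph) \<eta> \<epsilon>.
              outputs_within P (graph_code G) out (real (poly p n)) \<and>
              codes_disperser out X H \<eta> \<epsilon> \<and> uniform_disperser \<xi> G X H \<eta> \<epsilon>)))"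

end

theory Submission
  imports Defs
begin

text \<open>
  Let \<open>I\<close> be independent, of weight \<open>W\<close>.  A greedy choice yields \<open>O(M log n)\<close> vertices of \<open>I\<close> whose
  neighbourhood contains every vertex with more than \<open>W/M\<close> of the weight of \<open>I\<close> next to it.  This
  neighbourhood avoids \<open>I\<close>, so its removal is free, and only vertices with at most \<open>W/M\<close> of the
  weight of \<open>I\<close> next to them survive in components with an edge.  The path argument of Gyarfas then
  balances the heaviest of these components by removing the neighbourhoods of at most \<open>t\<close>
  such vertices, at a cost of at most \<open>tW/M \<le> \<gamma>W/2\<close>.  Hence the neighbourhoods of all tuples of
  length \<open>t + O(M log n)\<close> form a strong disperser, with \<open>\<delta> = 1/4\<close>, and it does not even depend on the
  weights.  With unit weights and degrees \<open>O(\<surd>n)\<close> the path argument alone gives a uniform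
  disperser: search all \<open>t\<close>-tuples for a neighbourhood that leaves components of at most \<open>n/2\<close>
  vertices, and decompose along an edgeless graph.
\<close>

section \<open>Balanced separators\<close>

text \<open>Neighbourhoods are open throughout. Those of vertices of \<open>I\<close> then avoid
  \<open>I\<close>, and picking a vertex that itself carries much weight costs only the weight next
  to it. A picked vertex may survive the removal, but only as an isolated one. This fits the
  exemption of single vertices, and that exemption is where large weights of \<open>I\<close> go: if
  one vertex of \<open>I\<close> has more than W/M, all its neighbours have more than W/M next to
  them, so their removal isolates it. Every other component ends with weight at most W/2, so at
  least W/2 lies outside it; hence the cost is held below \<gamma>W/2 rather than \<gamma>W. Any
  \<delta> in (0, 1/2) would do; 1/4 is constant and has trivial binary approximations. The number M
  depends only on t and \<gamma>. Since the program may be chosen after \<gamma>, M is a literal in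
  it, and the program never handles a real number.\<close>

definition nbhd :: "'a graph \<Rightarrow> 'a set \<Rightarrow> 'a set" where
  "nbhd G S = {v. \<exists>u\<in>S. {u, v} \<in> edges G}"

lemma nbhd_mono: "S \<subseteq> T \<Longrightarrow> nbhd G S \<subseteq> nbhd G T"
  by (auto simp: nbhd_def)

lemma nbhd_Un: "nbhd G (S \<union> T) = nbhd G S \<union> nbhd G T"
  by (auto simp: nbhd_def)

lemma nbhd_UN: "nbhd G S = (\<Union>u\<in>S. nbhd G {u})"
  by (auto simp: nbhd_def)

lemma sgraph_edgeD:
  assumes "sgraph G" "{u, v} \<in> edges G"
  shows "u \<in> verts G" "v \<in> verts G" "u \<noteq> v"
  using assms unfolding sgraph_def by (auto dest!: bspec)

lemma nbhd_subset: "sgraph G \<Longrightarrow> nbhd G S \<subseteq> verts G"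
  by (auto simp: nbhd_def dest: sgraph_edgeD)

text \<open>Connectedness in terms of cuts: in this form it passes to unions, and it yields border
  vertices, without handling paths.\<close>

definition linked :: "'a graph \<Rightarrow> 'a set \<Rightarrow> bool" where
  "linked G D \<longleftrightarrow> (\<forall>A. A \<subseteq> D \<and> A \<noteq> {} \<and> A \<noteq> D \<longrightarrow> (\<exists>x\<in>A. \<exists>y\<in>D - A. {x, y} \<in> edges G))"

lemma linkedD:
  assumes "linked G D" "A \<subseteq> D" "A \<noteq> {}" "A \<noteq> D"
  obtains x y where "x \<in> A" "y \<in> D" "y \<notin> A" "{x, y} \<in> edges G"
  using assms unfolding linked_def by blast

text \<open>A set that splits the union splits a member: if it contains a point of \<open>D\<close>
  and misses a point of \<open>E\<close>, a common point of \<open>D\<close> and \<open>E\<close>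
  puts the split into one of the two.\<close>

lemma linked_Union:
  assumes "\<And>D. D \<in> \<F> \<Longrightarrow> linked G D" "\<And>D E. D \<in> \<F> \<Longrightarrow> E \<in> \<F> \<Longrightarrow> D \<inter> E \<noteq> {}"
  shows "linked G (\<Union>\<F>)"
  unfolding linked_def
proof (intro allI impI)
  fix A assume A: "A \<subseteq> \<Union>\<F> \<and> A \<noteq> {} \<and> A \<noteq> \<Union>\<F>"
  then obtain a b D E where ab: "a \<in> A" "a \<in> D" "D \<in> \<F>" "b \<notin> A" "b \<in> E" "E \<in> \<F>"
    by blast
  obtain z where z: "z \<in> D" "z \<in> E"
    using assms(2)[OF ab(3,6)] by blast
  have "\<exists>F\<in>\<F>. A \<inter> F \<noteq> {} \<and> A \<inter> F \<noteq> F"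
    using ab z by blast
  then obtain F where F: "F \<in> \<F>" "A \<inter> F \<noteq> {}" "A \<inter> F \<noteq> F" by blast
  obtain x y where "x \<in> A \<inter> F" "y \<in> F" "y \<notin> A \<inter> F" "{x, y} \<in> edges G"
    by (rule linkedD[OF assms(1)[OF F(1)] _ F(2,3)]) auto
  then show "\<exists>x\<in>A. \<exists>y\<in>\<Union>\<F> - A. {x, y} \<in> edges G"
    using F(1) by blast
qed

lemma linked_insert:
  assumes "linked G D" "x \<in> D" "{x, y} \<in> edges G"
  shows "linked G (insert y D)"
  unfolding linked_def
proof (intro allI impI)
  fix A assume A: "A \<subseteq> insert y D \<and> A \<noteq> {} \<and> A \<noteq> insert y D"
  have yx: "{y, x} \<in> edges G" using assms(3) by (simp add: insert_commute)
  consider "A \<inter> D = {}" | "D \<subseteq> A" | "A \<inter> D \<noteq> {}" "A \<inter> D \<noteq> D" by blast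
  then show "\<exists>x\<in>A. \<exists>y\<in>insert y D - A. {x, y} \<in> edges G"
  proof cases
    case 1
    then have "y \<in> A" "x \<notin> A" using A assms(2) by auto
    then show ?thesis using yx assms(2) by blast
  next
    case 2
    then have "y \<notin> A" "x \<in> A" using A assms(2) by auto
    then show ?thesis using assms(3) by blast
  next
    case 3
    obtain x' y' where "x' \<in> A \<inter> D" "y' \<in> D" "y' \<notin> A \<inter> D" "{x', y'} \<in> edges G"
      by (rule linkedD[OF assms(1) _ 3]) auto
    then show ?thesis by blast
  qed
qed

lemma edges_del_verts: "edges (del_verts G X) = {e \<in> edges G. e \<subseteq> verts G - X}"
  by (simp add: del_verts_def induced_def)

lemma verts_del_verts: "verts (del_verts G X) = verts G - X"
  by (auto simp: del_verts_def induced_def)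

lemma component_of_refl: "v \<in> verts G \<Longrightarrow> v \<in> component_of G v"
  by (simp add: component_of_def)

lemma linked_component:
  assumes "sgraph G" "C \<in> components (del_verts G X)"
  shows "linked G C" and "C \<subseteq> verts G - X" and "C \<noteq> {}"
proof -
  define H where "H = del_verts G X"
  let ?R = "{(x, y). {x, y} \<in> edges H}"
  obtain v where v: "v \<in> verts H" "C = component_of H v"
    using assms(2) unfolding components_def H_def by blast
  show "C \<subseteq> verts G - X"
    using v unfolding component_of_def H_def by (auto simp: verts_del_verts)
  show "C \<noteq> {}"
    using v component_of_refl[of v H] by blast
  have symR: "sym ?R" by (auto simp: sym_def insert_commute)
  have eH: "{x, y} \<in> edges G \<and> x \<in> verts H \<and> y \<in> verts H" if "{x, y} \<in> edges H" for x y
    using that by (auto simp: H_def edges_del_verts verts_del_verts)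
  show "linked G C"
    unfolding linked_def
  proof (intro allI impI)
    fix A assume A: "A \<subseteq> C \<and> A \<noteq> {} \<and> A \<noteq> C"
    then obtain a b where ab: "a \<in> A" "b \<in> C" "b \<notin> A" by blast
    have a: "(v, a) \<in> ?R\<^sup>*" and b: "(v, b) \<in> ?R\<^sup>*"
      using ab A v by (auto simp: component_of_def)
    have "(a, v) \<in> ?R\<^sup>*"
      using a symR by (meson symE sym_rtrancl)
    then have "(a, b) \<in> ?R\<^sup>*" using b by (rule rtrancl_trans)
    \<comment> \<open>A walk from \<open>a\<close> to \<open>b\<close> starts in \<open>A\<close>
      and must leave it, and it does so inside the component.\<close>
    moreover have "x \<in> A \<or> (\<exists>x\<in>A. \<exists>y\<in>C - A. {x, y} \<in> edges G)" if "(a, x) \<in> ?R\<^sup>*" for x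
      using that
    proof (induction rule: rtrancl_induct)
      case base
      then show ?case using ab by simp
    next
      case (step y z)
      show ?case
      proof (cases "y \<in> A \<and> z \<notin> A")
        case True
        have "(v, y) \<in> ?R\<^sup>*" using True A v by (auto simp: component_of_def)
        then have "(v, z) \<in> ?R\<^sup>*" using step(2) by (rule rtrancl_into_rtrancl)
        then have "z \<in> C" using step(2) eH v by (auto simp: component_of_def)
        then show ?thesis using True step(2) eH by blast
      next
        case False
        then show ?thesis using step by blast
      qed
    qed
    ultimately show "\<exists>x\<in>A. \<exists>y\<in>C - A. {x, y} \<in> edges G"
      using ab by blast
  qed
qed

text \<open>Components are maximal linked sets: the part of \<open>D\<close> inside the component
  has no edge to the rest of \<open>D\<close>.\<close>

lemma linked_subset_component:
  assumes "linked G D" "D \<subseteq> verts G - X" "v \<in> D"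
  shows "D \<subseteq> component_of (del_verts G X) v"
proof -
  let ?A = "D \<inter> component_of (del_verts G X) v"
  have v: "v \<in> ?A"
    using assms by (auto simp: component_of_def verts_del_verts)
  have "?A = D"
  proof (rule ccontr)
    assume "?A \<noteq> D"
    then obtain x y where xy: "x \<in> ?A" "y \<in> D" "y \<notin> ?A" "{x, y} \<in> edges G"
      using linkedD[OF assms(1), of ?A] v by blast
    have "{x, y} \<in> edges (del_verts G X)"
      using xy assms(2) by (auto simp: edges_del_verts)
    then have "y \<in> component_of (del_verts G X) v"
      using xy assms(2)
      by (auto simp: component_of_def verts_del_verts intro: rtrancl_into_rtrancl)
    then show False using xy by blast
  qed
  then show ?thesis by blast
qed

section \<open>Induced paths and the argument of Gyarfas\<close>

definition induced_path :: "'a graph \<Rightarrow> nat \<Rightarrow> (nat \<Rightarrow> 'a) \<Rightarrow> bool" where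
  "induced_path G k p \<longleftrightarrow> inj_on p {..<k} \<and> p ` {..<k} \<subseteq> verts G \<and>
     (\<forall>i<k. \<forall>j<k. {p i, p j} \<in> edges G \<longleftrightarrow> j = Suc i \<or> i = Suc j)"

lemma induced_path_isomorphic:
  assumes "induced_path G k p"
  shows "isomorphic (induced G (p ` {..<k})) (path_graph k)"
  unfolding isomorphic_def
proof (intro exI conjI ballI)
  let ?f = "inv_into {..<k} p"
  have inj: "inj_on p {..<k}" and sub: "p ` {..<k} \<subseteq> verts G"
    using assms by (auto simp: induced_path_def)
  have V: "verts (induced G (p ` {..<k})) = p ` {..<k}"
    using sub by (auto simp: induced_def)
  show "bij_betw ?f (verts (induced G (p ` {..<k}))) (verts (path_graph k))"
    unfolding V using inj by (simp add: path_graph_def bij_betw_inv_into inj_on_imp_bij_betw)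
  fix u v
  assume "u \<in> verts (induced G (p ` {..<k}))" "v \<in> verts (induced G (p ` {..<k}))"
  then obtain i j where ij: "i < k" "j < k" "u = p i" "v = p j" unfolding V by auto
  have f: "?f u = i" "?f v = j" using ij inj by auto
  have "{i, j} \<in> edges (path_graph k) \<longleftrightarrow> j = Suc i \<or> i = Suc j"
    using ij by (auto simp: path_graph_def doubleton_eq_iff)
  moreover have "{u, v} \<in> edges (induced G (p ` {..<k})) \<longleftrightarrow> {u, v} \<in> edges G"
    using ij by (auto simp: induced_def)
  ultimately show "{u, v} \<in> edges (induced G (p ` {..<k})) \<longleftrightarrow> {?f u, ?f v} \<in> edges (path_graph k)"
    using assms ij f by (auto simp: induced_path_def)
qed

lemma induced_path_extend:
  assumes "induced_path G (Suc k) p" "y \<in> verts G" "y \<notin> p ` {..<Suc k}"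
    "{y, p k} \<in> edges G" "\<And>i. i < k \<Longrightarrow> {y, p i} \<notin> edges G" "{y} \<notin> edges G"
  shows "induced_path G (Suc (Suc k)) (p(Suc k := y))"
proof -
  let ?q = "p(Suc k := y)"
  have img: "?q ` {..<Suc k} = p ` {..<Suc k}" by auto
  have "inj_on ?q {..<Suc (Suc k)}"
    using assms(1,3) by (auto simp: induced_path_def inj_on_def less_Suc_eq)
  moreover have "?q ` {..<Suc (Suc k)} \<subseteq> verts G"
    using assms(1,2) by (auto simp: induced_path_def less_Suc_eq)
  moreover have "{?q i, ?q j} \<in> edges G \<longleftrightarrow> j = Suc i \<or> i = Suc j"
    if ij: "i < Suc (Suc k)" "j < Suc (Suc k)" for i j
  proof -
    have *: "{y, p i} \<in> edges G \<longleftrightarrow> i = k" if "i < Suc k" for i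
      using assms(4,5) that by (auto simp: less_Suc_eq)
    consider "i < Suc k" "j < Suc k" | "i = Suc k" "j < Suc k" | "i < Suc k" "j = Suc k"
      | "i = Suc k" "j = Suc k"
      using ij by linarith
    then show ?thesis
    proof cases
      case 1
      then show ?thesis using assms(1) by (auto simp: induced_path_def)
    next
      case 2
      then show ?thesis using *[of j] by auto
    next
      case 3
      then show ?thesis using *[of i] by (auto simp: insert_commute)
    next
      case 4
      then show ?thesis using assms(6) by simp
    qed
  qed
  ultimately show ?thesis unfolding induced_path_def by blast
qed

text \<open>The argument of Gyarfas: if every small \<open>Q\<close> leaves a linked set with more than half of the
  weight, then the union \<open>B Q\<close> of these sets is linked too, and an induced path can be extended
  forever by a vertex on the border of the shrinking sets \<open>B Q\<close>.\<close>

lemma balanced_separator: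
  fixes w :: "'a \<Rightarrow> real"
  assumes G: "sgraph G" and C: "C \<subseteq> verts G" "linked G C" "u \<in> C" "C \<noteq> {u}"
    and w: "\<And>v. w v \<ge> 0" "sum w C \<le> W"
    and free: "\<And>p. \<not> induced_path G t p" and t: "t > 0"
  obtains Q where "Q \<subseteq> C" "Q \<noteq> {}" "card Q \<le> t"
    "\<And>D. D \<subseteq> C - nbhd G Q \<Longrightarrow> linked G D \<Longrightarrow> sum w D \<le> W / 2"
proof (rule ccontr)
  assume no_thesis: "\<not> thesis"
  note obtained = that
  have no: "\<exists>D. D \<subseteq> C - nbhd G Q \<and> linked G D \<and> sum w D > W / 2"
    if "Q \<subseteq> C" "Q \<noteq> {}" "card Q \<le> t" for Q
    using obtained[OF that] no_thesis by (meson not_le)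
  define \<B> where "\<B> Q = {D. D \<subseteq> C - nbhd G Q \<and> linked G D \<and> sum w D > W / 2}" for Q
  define B where "B Q = \<Union>(\<B> Q)" for Q
  have finC: "finite C" using G C(1) finite_subset by (auto simp: sgraph_def)
  have B_sub: "B Q \<subseteq> C - nbhd G Q" for Q
    unfolding B_def \<B>_def by blast
  have B_anti: "B Q' \<subseteq> B Q" if "Q \<subseteq> Q'" for Q Q'
    using nbhd_mono[OF that, of G] unfolding B_def \<B>_def by blast
  have W0: "0 \<le> W" using w sum_nonneg[of C w] by simp
  \<comment> \<open>Two disjoint sets heavier than W/2 do not fit into \<open>C\<close>; this is
    what makes their union linked.\<close>
  have meet: "D \<inter> E \<noteq> {}" if "D \<in> \<B> Q" "E \<in> \<B> Q" for D E Q
  proof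
    assume disj: "D \<inter> E = {}"
    have sub: "D \<union> E \<subseteq> C" using that by (auto simp: \<B>_def)
    then have fin: "finite D" "finite E" using finC finite_subset by blast+
    have "W < sum w D + sum w E" using that by (auto simp: \<B>_def)
    also have "\<dots> = sum w (D \<union> E)" using fin disj by (simp add: sum.union_disjoint)
    also have "\<dots> \<le> sum w C" using sub finC w by (intro sum_mono2) auto
    finally show False using w(2) by simp
  qed
  have B_linked: "linked G (B Q)" for Q
    unfolding B_def using meet by (intro linked_Union) (auto simp: \<B>_def)
  have B_ne: "B Q \<noteq> {}" if "Q \<subseteq> C" "Q \<noteq> {}" "card Q \<le> t" for Q
  proof -
    from no[OF that] obtain D where D: "D \<in> \<B> Q" by (auto simp: \<B>_def)
    then have "D \<noteq> {}" using W0 by (auto simp: \<B>_def)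
    then show ?thesis using D by (auto simp: B_def)
  qed
  \<comment> \<open>A surviving neighbour of \<open>B Q\<close> belongs to it, since adding a vertex
    does not lower the weight.\<close>
  have B_max: "y \<in> B Q" if xy: "x \<in> B Q" "y \<in> C - nbhd G Q" "{x, y} \<in> edges G" for x y Q
  proof -
    obtain D where D: "D \<in> \<B> Q" "x \<in> D" using xy by (auto simp: B_def)
    have fin: "finite (insert y D)"
      using D finC finite_subset by (fastforce simp: \<B>_def)
    have "sum w D \<le> sum w (insert y D)"
      using fin w by (intro sum_mono2) auto
    then have "insert y D \<in> \<B> Q"
      using D xy linked_insert[of G D x y] by (auto simp: \<B>_def)
    then show ?thesis by (auto simp: B_def)
  qed
  \<comment> \<open>\<open>Q\<close> collects a starting vertex and all path vertices but the last,
    so no vertex of \<open>B Q\<close> is adjacent to an earlier path vertex, while the last one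
    still touches \<open>B Q\<close>. At \<open>k = t - 1\<close> the path has \<open>t\<close>
    vertices.\<close>
  have state: "\<exists>p Q. induced_path G (Suc k) p \<and> Q \<subseteq> C \<and> Q \<noteq> {} \<and> card Q \<le> Suc k \<and>
      p ` {..k} \<subseteq> C - B Q \<and> (\<forall>i<k. p i \<in> Q) \<and> (\<exists>x\<in>B Q. {x, p k} \<in> edges G)"
    if "k < t" for k
    using that
  proof (induction k)
    case 0
    \<comment> \<open>With \<open>Q = {u}\<close> a neighbour of \<open>u\<close> is already
      removed, so \<open>B {u}\<close> is a proper part of \<open>C\<close> and has a border on
      which the path can start.\<close>
    have Q: "{u} \<subseteq> C" "{u} \<noteq> {}" "card {u} \<le> t" using C t by auto
    have "B {u} \<noteq> C"
    proof
      assume eq: "B {u} = C"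
      obtain v where v: "v \<in> C" "{u, v} \<in> edges G"
        using linkedD[OF C(2), of "{u}"] C(3,4) by auto
      then have "v \<in> nbhd G {u}" by (auto simp: nbhd_def)
      then show False using v eq B_sub[of "{u}"] by blast
    qed
    then obtain x v where xv: "x \<in> B {u}" "v \<in> C" "v \<notin> B {u}" "{x, v} \<in> edges G"
      using linkedD[OF C(2), of "B {u}"] B_sub[of "{u}"] B_ne[OF Q] by blast
    have "induced_path G (Suc 0) (\<lambda>_. v)"
      using xv(2) C(1) sgraph_edgeD(3)[OF G, of v v] by (auto simp: induced_path_def inj_on_def)
    then show ?case
      using xv Q by (intro exI[of _ "\<lambda>_. v"] exI[of _ "{u}"]) auto
  next
    case (Suc k)
    then obtain p Q x where p: "induced_path G (Suc k) p" and Q: "Q \<subseteq> C" "Q \<noteq> {}" "card Q \<le> Suc k"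
      and pC: "p ` {..k} \<subseteq> C - B Q" and pQ: "\<forall>i<k. p i \<in> Q"
      and x: "x \<in> B Q" "{x, p k} \<in> edges G"
      using Suc_lessD by blast
    define Q' where "Q' = insert (p k) Q"
    have Q': "Q' \<subseteq> C" "Q' \<noteq> {}" "card Q' \<le> Suc (Suc k)"
      using Q pC finC finite_subset[of Q C] by (auto simp: Q'_def card_insert_if)
    have sub: "B Q' \<subseteq> B Q" by (rule B_anti) (auto simp: Q'_def)
    have "x \<in> nbhd G Q'" using x(2) by (auto simp: Q'_def nbhd_def insert_commute)
    then have "x \<notin> B Q'" using B_sub[of Q'] by blast
    then have "B Q' \<noteq> B Q" using x(1) by blast
    moreover have "B Q' \<noteq> {}" using B_ne[of Q'] Q' Suc.prems by simp
    ultimately obtain z y where zy: "z \<in> B Q'" "y \<in> B Q" "y \<notin> B Q'" "{z, y} \<in> edges G"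
      using linkedD[OF B_linked[of Q] sub] by blast
    have yC: "y \<in> C" "y \<notin> nbhd G Q" using zy(2) B_sub[of Q] by auto
    \<comment> \<open>By \<open>B_max\<close> only the newly removed neighbours of
      \<open>p k\<close> can have cut \<open>y\<close> off; hence \<open>y\<close> is adjacent to
      \<open>p k\<close> and to no earlier path vertex.\<close>
    have "y \<in> nbhd G Q'" using B_max[OF zy(1) _ zy(4)] zy(3) yC by blast
    then have adj: "{y, p k} \<in> edges G"
      using yC by (auto simp: Q'_def nbhd_def insert_commute)
    have nadj: "{y, p i} \<notin> edges G" if "i < k" for i
      using yC pQ that by (auto simp: nbhd_def insert_commute)
    have ynew: "y \<notin> p ` {..<Suc k}"
      using zy(2) pC by (auto simp: lessThan_Suc_atMost)
    have "{y} \<notin> edges G" using sgraph_edgeD(3)[OF G, of y y] by auto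
    then have ext: "induced_path G (Suc (Suc k)) (p(Suc k := y))"
      using induced_path_extend[OF p _ ynew adj] nadj yC C(1) by blast
    show ?case
    proof (intro exI conjI)
      show "induced_path G (Suc (Suc k)) (p(Suc k := y))" by (rule ext)
      show "Q' \<subseteq> C" "Q' \<noteq> {}" "card Q' \<le> Suc (Suc k)" by (fact Q')+
      show "(p(Suc k := y)) ` {..Suc k} \<subseteq> C - B Q'"
        using pC sub yC zy(3) by (auto simp: atMost_Suc le_Suc_eq)
      show "\<forall>i<Suc k. (p(Suc k := y)) i \<in> Q'"
        using pQ by (auto simp: Q'_def less_Suc_eq)
      show "\<exists>x\<in>B Q'. {x, (p(Suc k := y)) (Suc k)} \<in> edges G"
        using zy by auto
    qed
  qed
  show False
    using state[of "t - 1"] free t by auto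
qed


section \<open>Greedy hitting sets and union bounds\<close>

lemma one_minus_inverse_power_le:
  assumes "M > 0"
  shows "(1 - 1 / real M) ^ (M * l) \<le> (1/2) ^ l"
proof -
  have "(1 - 1 / real M) ^ M \<le> exp (- (1 / real M)) ^ M"
    using assms exp_ge_add_one_self[of "- (1 / real M)"] by (intro power_mono) auto
  also have "\<dots> = inverse (exp 1)"
    using assms by (simp add: exp_minus power_inverse flip: exp_of_nat_mult)
  also have "\<dots> \<le> 1/2"
    using exp_ge_add_one_self[of 1] le_imp_inverse_le[of 2 "exp 1"] by simp
  finally have "((1 - 1 / real M) ^ M) ^ l \<le> (1/2) ^ l"
    using assms by (intro power_mono) auto
  then show ?thesis by (simp add: power_mult)
qed

text \<open>Averaging: a random \<open>x\<close> in \<open>I\<close>, chosen with probability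
  proportional to \<open>w\<close>, is related to each \<open>v\<close> in \<open>F\<close> with
  probability at least 1/M. So some \<open>x\<close> hits a fraction 1/M of whatever is still
  unhit.\<close>

lemma greedy_hitting_list:
  fixes w :: "'a \<Rightarrow> real"
  assumes I: "finite I" "\<And>x. w x \<ge> 0" "sum w I > 0" and F: "finite F" and M: "M > 0"
    and heavy: "\<And>v. v \<in> F \<Longrightarrow> sum w {x\<in>I. R x v} \<ge> sum w I / real M"
  shows "\<exists>xs. length xs = k \<and> set xs \<subseteq> I \<and>
    real (card {v\<in>F. \<forall>x\<in>set xs. \<not> R x v}) \<le> (1 - 1 / real M) ^ k * real (card F)"
proof (induction k)
  case 0
  show ?case by simp
next
  case (Suc k)
  then obtain xs where xs: "length xs = k" "set xs \<subseteq> I"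
    "real (card {v\<in>F. \<forall>x\<in>set xs. \<not> R x v}) \<le> (1 - 1 / real M) ^ k * real (card F)"
    by blast
  define U where "U = {v\<in>F. \<forall>x\<in>set xs. \<not> R x v}"
  have finU: "finite U" and UF: "U \<subseteq> F" using F by (auto simp: U_def)
  have "\<exists>x\<in>I. real (card U) / real M \<le> real (card {v\<in>U. R x v})"
  proof (rule ccontr)
    assume "\<not> ?thesis"
    then have less: "real (card {v\<in>U. R x v}) < real (card U) / real M" if "x \<in> I" for x
      using that by (meson not_le)
    \<comment> \<open>A point of positive weight makes the comparison of the two sums
      strict.\<close>
    have "\<exists>x\<in>I. w x > 0"
      using I(3) by (meson sum_nonpos not_le)
    then have "(\<Sum>x\<in>I. w x * real (card {v\<in>U. R x v})) < (\<Sum>x\<in>I. w x * (real (card U) / real M))"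
    proof (intro sum_strict_mono_ex1 ballI)
      fix x assume "x \<in> I"
      then show "w x * real (card {v\<in>U. R x v}) \<le> w x * (real (card U) / real M)"
        using less[of x] I(2)[of x] by (intro mult_left_mono) auto
    next
      obtain x where "x \<in> I" "w x > 0" using \<open>\<exists>x\<in>I. w x > 0\<close> by blast
      then show "\<exists>x\<in>I. w x * real (card {v\<in>U. R x v}) < w x * (real (card U) / real M)"
        using less[of x] by (intro bexI[of _ x] mult_strict_left_mono) auto
    qed (rule I(1))
    also have "\<dots> = (\<Sum>v\<in>U. sum w I / real M)"
      by (simp add: mult.commute flip: sum_distrib_right sum_divide_distrib)
    also have "\<dots> \<le> (\<Sum>v\<in>U. sum w {x\<in>I. R x v})"
      using heavy UF by (intro sum_mono) auto
    also have "\<dots> = (\<Sum>v\<in>U. \<Sum>x\<in>I. if R x v then w x else 0)"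
      using I by (simp add: sum.inter_filter)
    also have "\<dots> = (\<Sum>x\<in>I. \<Sum>v\<in>U. if R x v then w x else 0)"
      by (rule sum.swap)
    also have "\<dots> = (\<Sum>x\<in>I. w x * real (card {v\<in>U. R x v}))"
      using finU by (simp add: sum.inter_filter[symmetric] mult.commute)
    finally show False by simp
  qed
  then obtain x where x: "x \<in> I" "real (card U) / real M \<le> real (card {v\<in>U. R x v})" by blast
  have eq: "{v\<in>F. \<forall>y\<in>set (x # xs). \<not> R y v} = U - {v\<in>U. R x v}" by (auto simp: U_def)
  have "real (card (U - {v\<in>U. R x v})) = real (card U) - real (card {v\<in>U. R x v})"
    using finU by (subst card_Diff_subset) (auto simp: of_nat_diff card_mono)
  also have "\<dots> \<le> (1 - 1 / real M) * real (card U)"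
    using x by (simp add: algebra_simps)
  also have "\<dots> \<le> (1 - 1 / real M) * ((1 - 1 / real M) ^ k * real (card F))"
    using xs(3) M by (intro mult_left_mono) (auto simp: U_def)
  finally have "real (card {v\<in>F. \<forall>y\<in>set (x # xs). \<not> R y v}) \<le> (1 - 1 / real M) ^ Suc k * real (card F)"
    unfolding eq by (simp add: mult.assoc)
  then show ?case using xs x by (intro exI[of _ "x # xs"]) auto
qed

text \<open>Repeating an entry pads every small set to the one length \<open>L\<close> that is
  enumerated; this needs an entry to repeat.\<close>

lemma exists_list_of_length:
  assumes "finite S" "S \<noteq> {}" "card S \<le> L"
  shows "\<exists>xs. length xs = L \<and> set xs = S"
proof -
  obtain ys where ys: "set ys = S" "distinct ys"
    using finite_distinct_list[OF assms(1)] by blast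
  have len: "length ys \<le> L" using ys assms(3) distinct_card by fastforce
  have "set (ys @ replicate (L - length ys) (hd ys)) = S"
    using ys assms(2) by auto
  then show ?thesis using len by (intro exI[of _ "ys @ replicate (L - length ys) (hd ys)"]) auto
qed

lemma sum_UN_le:
  fixes u :: "'a \<Rightarrow> real"
  assumes "finite Q" "\<And>q. finite (A q)" "\<And>v. u v \<ge> 0"
  shows "sum u (\<Union>q\<in>Q. A q) \<le> (\<Sum>q\<in>Q. sum u (A q))"
  using assms(1)
proof (induction Q rule: finite_induct)
  case (insert q Q)
  have "sum u (A q \<union> (\<Union>q\<in>Q. A q)) \<le> sum u (A q) + sum u (\<Union>q\<in>Q. A q)"
    using assms insert.hyps by (simp add: sum_Un sum_nonneg)
  then show ?case using insert by simp
qed simp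

text \<open>Used with the weight of \<open>I\<close> and, with \<open>u\<close> constantly 1, for
  counting neighbours.\<close>

lemma sum_nbhd_le:
  fixes u :: "'a \<Rightarrow> real"
  assumes G: "sgraph G" and u: "\<And>v. u v \<ge> 0" and Q: "finite Q"
    and B: "\<And>q. q \<in> Q \<Longrightarrow> sum u (nbhd G {q}) \<le> B"
  shows "sum u (nbhd G Q) \<le> real (card Q) * B"
proof -
  have fin: "finite (nbhd G {q})" for q
    using finite_subset[OF nbhd_subset[OF G]] G by (simp add: sgraph_def)
  have "sum u (nbhd G Q) \<le> (\<Sum>q\<in>Q. sum u (nbhd G {q}))"
    unfolding nbhd_UN[of G Q] by (intro sum_UN_le Q fin u)
  also have "\<dots> \<le> (\<Sum>q\<in>Q. B)" by (intro sum_mono B)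
  finally show ?thesis by simp
qed

text \<open>The list joins \<open>M * l\<close> entries from the greedy choice to at most
  \<open>t\<close> from the path argument. If no component with an edge is too heavy after the
  greedy choice, the second group is empty and padding fills the gap.\<close>

lemma good_nbhd_of_list:
  assumes G: "sgraph G" and free: "\<And>p. \<not> induced_path G t p" and t: "t > 0"
    and I: "independent G I" "weight w I > 0"
    and \<gamma>: "\<gamma> > 0" and M: "M > 0" "2 * real t \<le> \<gamma> * real M"
    and l: "card (verts G) < 2 ^ l"
  shows "\<exists>xs. length xs = t + M * l \<and> set xs \<subseteq> verts G \<and>
    good_set \<gamma> (1/4) G (weight_on w I) (nbhd G (set xs))"
proof -
  define u where "u = (\<lambda>v. real (weight_on w I v))"
  have weight_u: "weight (weight_on w I) S = sum u S" for S by (simp add: weight_def u_def)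
  have u0: "u v \<ge> 0" for v by (simp add: u_def)
  have fin: "finite (verts G)" using G by (simp add: sgraph_def)
  have IV: "I \<subseteq> verts G" using I by (simp add: independent_def)
  have finI: "finite I" using IV fin finite_subset by blast
  define W where "W = sum u (verts G)"
  have uI: "sum u (S \<inter> I) = sum u S" if "finite S" for S
    using that by (intro sum.mono_neutral_left) (auto simp: u_def weight_on_def)
  have W_I: "sum u I = W"
    using uI[OF fin] IV by (simp add: W_def Int_absorb1)
  have "sum u I = weight w I"
    by (simp add: u_def weight_def weight_on_def)
  then have Wpos: "W > 0" using I(2) W_I by simp
  have sum_le_W: "sum u S \<le> W" if "S \<subseteq> verts G" for S
    unfolding W_def using that fin u0 by (intro sum_mono2) auto
  define F where "F = {v \<in> verts G. sum u (nbhd G {v}) > W / real M}"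
  have finF: "finite F" and cardF: "card F < 2 ^ l"
    using fin l card_mono[of "verts G" F] by (auto simp: F_def)
  have fin_nb: "finite (nbhd G S)" for S
    using nbhd_subset[OF G] fin finite_subset by blast
  have heavy: "sum u {x\<in>I. {x, v} \<in> edges G} \<ge> sum u I / real M" if "v \<in> F" for v
  proof -
    have "{x\<in>I. {x, v} \<in> edges G} = nbhd G {v} \<inter> I" by (auto simp: nbhd_def insert_commute)
    then show ?thesis using that uI[OF fin_nb, of "{v}"] W_I by (simp add: F_def)
  qed
  obtain js where js: "length js = M * l" "set js \<subseteq> I"
    "real (card {v\<in>F. \<forall>x\<in>set js. {x, v} \<notin> edges G}) \<le> (1 - 1 / real M) ^ (M * l) * real (card F)"
    using greedy_hitting_list[OF finI, of u F M, where R = "\<lambda>x v. {x, v} \<in> edges G" and k = "M * l"]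
      heavy Wpos W_I u0 finF M(1) by auto
  \<comment> \<open>\<open>M\<close> rounds halve the unhit set, so \<open>M * l\<close> rounds
    leave fewer than |F| / 2^l < 1 vertices.\<close>
  have "real (card {v\<in>F. \<forall>x\<in>set js. {x, v} \<notin> edges G}) \<le> (1/2) ^ l * real (card F)"
    using js(3) mult_right_mono[OF one_minus_inverse_power_le[OF M(1), of l], of "real (card F)"]
    by simp
  also have "\<dots> < 1"
    using cardF by (simp add: power_one_over field_simps)
  finally have "{v\<in>F. \<forall>x\<in>set js. {x, v} \<notin> edges G} = {}" using finF by simp
  then have F_sub: "F \<subseteq> nbhd G (set js)" by (auto simp: nbhd_def)
  \<comment> \<open>This makes \<open>js\<close> nonempty, so that padding is possible.\<close>
  have l0: "l > 0"
  proof (rule ccontr)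
    assume "\<not> l > 0"
    then have "verts G = {}" using l fin by simp
    then show False using IV I(2) by (simp add: weight_def)
  qed
  have J_ne: "set js \<noteq> {}" using js(1) l0 M by auto
  have NJ0: "sum u (nbhd G (set js)) = 0"
  proof -
    have "nbhd G (set js) \<inter> I = {}"
      using js(2) I(1) by (auto simp: nbhd_def independent_def)
    then show ?thesis using uI[OF fin_nb, of "set js"] by simp
  qed
  \<comment> \<open>Singletons are left out because one vertex of \<open>I\<close> may weigh more
    than W/2; if it is isolated, no neighbourhood removes it.\<close>
  have "\<exists>Q. Q \<subseteq> verts G \<and> card Q \<le> t \<and> sum u (nbhd G Q) \<le> \<gamma> / 2 * W \<and>
    (\<forall>E. linked G E \<and> E \<subseteq> verts G - nbhd G (set js \<union> Q) \<and> \<not> (\<exists>v. E = {v}) \<longrightarrow> sum u E \<le> W / 2)"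
  proof (cases "\<exists>D. linked G D \<and> D \<subseteq> verts G - nbhd G (set js) \<and> \<not> (\<exists>v. D = {v}) \<and> sum u D > W / 2")
    case False
    have "sum u E \<le> W / 2"
      if "linked G E" "E \<subseteq> verts G - nbhd G (set js)" "\<not> (\<exists>v. E = {v})" for E
    proof (rule ccontr)
      assume "\<not> sum u E \<le> W / 2"
      then have "sum u E > W / 2" by simp
      with that have "\<exists>D. linked G D \<and> D \<subseteq> verts G - nbhd G (set js) \<and> \<not> (\<exists>v. D = {v}) \<and> sum u D > W / 2"
        by (intro exI[of _ E] conjI)
      with False show False by (rule notE)
    qed
    moreover have "nbhd G {} = {}" by (simp add: nbhd_def)
    ultimately show ?thesis
      using Wpos \<gamma> by (intro exI[of _ "{}"] conjI allI impI) auto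
  next
    case True
    then obtain D where D: "linked G D" "D \<subseteq> verts G - nbhd G (set js)" "\<not> (\<exists>v. D = {v})"
      "sum u D > W / 2" by (elim exE conjE) (rule that)
    have "D \<noteq> {}" using D(4) Wpos by auto
    then obtain v where v: "v \<in> D" by blast
    \<comment> \<open>\<open>D\<close> is merely linked. The path argument is applied to the whole
      component around it, so that any linked set meeting \<open>D\<close> lies in
      \<open>C\<close>.\<close>
    define C where "C = component_of (del_verts G (nbhd G (set js))) v"
    have "C \<in> components (del_verts G (nbhd G (set js)))"
      using v D(2) by (auto simp: C_def components_def verts_del_verts)
    note C = linked_component[OF G this]
    have DC: "D \<subseteq> C" unfolding C_def by (rule linked_subset_component[OF D(1,2) v])
    have C_V: "C \<subseteq> verts G" and vC: "v \<in> C" and C_ne: "C \<noteq> {v}"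
      using C(2) v DC D(3) by auto
    obtain Q where Q: "Q \<subseteq> C" "Q \<noteq> {}" "card Q \<le> t"
      and small: "\<And>D. D \<subseteq> C - nbhd G Q \<Longrightarrow> linked G D \<Longrightarrow> sum u D \<le> W / 2"
      using balanced_separator[OF G C_V C(1) vC C_ne u0 sum_le_W[OF C_V] free t] by blast
    have finQ: "finite Q" using Q C_V fin by (meson finite_subset)
    have "sum u (nbhd G {q}) \<le> W / real M" if "q \<in> Q" for q
    proof -
      have "q \<in> verts G" "q \<notin> F" using that Q(1) C(2) F_sub by auto
      then show ?thesis by (simp add: F_def)
    qed
    then have "sum u (nbhd G Q) \<le> real (card Q) * (W / real M)"
      by (rule sum_nbhd_le[OF G u0 finQ])
    also have "\<dots> \<le> real t * (W / real M)"
      using Q(3) Wpos by (intro mult_right_mono) auto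
    also have "\<dots> \<le> \<gamma> / 2 * W"
      using M Wpos mult_right_mono[OF M(2), of W] by (simp add: field_simps)
    finally have NQ: "sum u (nbhd G Q) \<le> \<gamma> / 2 * W" .
    \<comment> \<open>\<open>E\<close> is not assumed to lie in \<open>C\<close>. If it is heavier
      than W/2 it meets \<open>D\<close>, so \<open>E \<union> C\<close> is linked and maximality of
      the component puts \<open>E\<close> into \<open>C\<close>.\<close>
    have "sum u E \<le> W / 2" if E: "linked G E" "E \<subseteq> verts G - nbhd G (set js \<union> Q)" for E
    proof (rule ccontr)
      assume big: "\<not> sum u E \<le> W / 2"
      have E_V: "E \<subseteq> verts G" using E by blast
      have "E \<inter> D \<noteq> {}"
      proof
        assume disj: "E \<inter> D = {}"
        have "sum u E + sum u D = sum u (E \<union> D)"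
          using disj E_V D(2) fin by (intro sum.union_disjoint[symmetric]) (auto intro: finite_subset)
        also have "\<dots> \<le> W" using E_V D(2) by (intro sum_le_W) auto
        finally show False using big D(4) by simp
      qed
      then have "linked G (\<Union>{E, C})"
        using E(1) C(1) DC C(3) vC by (intro linked_Union) auto
      then have "E \<union> C \<subseteq> C"
        unfolding C_def
        using linked_subset_component[of G "E \<union> C" "nbhd G (set js)" v] E(2) C(2) vC
        by (auto simp: nbhd_Un C_def)
      then show False using small[OF _ E(1)] E(2) big by (auto simp: nbhd_Un)
    qed
    then show ?thesis using Q C_V NQ by (intro exI[of _ Q]) auto
  qed
  then obtain Q where Q: "Q \<subseteq> verts G" "card Q \<le> t" "sum u (nbhd G Q) \<le> \<gamma> / 2 * W"
    and small: "\<And>E. linked G E \<Longrightarrow> E \<subseteq> verts G - nbhd G (set js \<union> Q) \<Longrightarrow> \<not> (\<exists>v. E = {v}) \<Longrightarrow>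
      sum u E \<le> W / 2"
    by blast
  have finQ: "finite Q" using Q fin finite_subset by blast
  have "card (set js \<union> Q) \<le> t + M * l"
    using card_Un_le[of "set js" Q] card_length[of js] js(1) Q(2) by linarith
  then obtain xs where xs: "length xs = t + M * l" "set xs = set js \<union> Q"
    using exists_list_of_length[of "set js \<union> Q" "t + M * l"] finQ J_ne by auto
  define X where "X = nbhd G (set xs)"
  have "sum u X \<le> sum u (nbhd G (set js)) + sum u (nbhd G Q)"
    unfolding X_def xs(2) nbhd_Un using fin_nb u0 by (simp add: sum_Un sum_nonneg)
  then have uX: "sum u X \<le> \<gamma> / 2 * W" using NJ0 Q(3) by simp
  have "good_set \<gamma> (1/4) G (weight_on w I) X"
    unfolding good_set_def weight_u
  proof (intro conjI ballI impI)
    show "X \<subseteq> verts G" unfolding X_def by (rule nbhd_subset[OF G])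
    show "sum u X \<le> \<gamma> * sum u (verts G)"
      using uX mult_pos_pos[OF \<gamma> Wpos] unfolding W_def by linarith
    fix C assume C: "C \<in> components (del_verts G X)" "\<not> (\<exists>v. C = {v})"
    note C' = linked_component[OF G C(1)]
    have uC: "sum u C \<le> W / 2"
      using small[OF C'(1) _ C(2)] C'(2) by (simp add: X_def xs(2))
    then show "sum u C \<le> (1 - 1/4) * sum u (verts G)"
      using Wpos unfolding W_def by simp
    have "sum u (verts G - C) = W - sum u C"
      using C'(2) fin unfolding W_def by (intro sum_diff) auto
    then have "W / 2 \<le> sum u (verts G - C)" using uC by simp
    then have "\<gamma> * (W / 2) \<le> \<gamma> * sum u (verts G - C)" using \<gamma> by (intro mult_left_mono) auto
    then show "sum u X \<le> \<gamma> * sum u (verts G - C)" using uX by simp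
  qed
  then show ?thesis using xs js(2) IV Q(1) by (intro exI[of _ xs]) (auto simp: X_def)
qed

section \<open>Connected graphs with unit weights\<close>

lemma linked_verts_if_connected:
  assumes "sgraph G" "connected_graph G"
  shows "linked G (verts G)"
proof -
  have "del_verts G {} = G"
    using assms(1) unfolding del_verts_def induced_def sgraph_def by (cases G) auto
  moreover obtain C where C: "components G = {C}"
    using assms(2) by (auto simp: connected_graph_def)
  moreover have "verts G = C"
  proof -
    have "component_of G v = C" if "v \<in> verts G" for v
      using C that by (auto simp: components_def)
    then have "v \<in> C" if "v \<in> verts G" for v
      using component_of_refl[OF that] that by simp
    moreover have "C \<subseteq> verts G" using C by (auto simp: components_def component_of_def)
    ultimately show ?thesis by blast
  qed
  ultimately show ?thesis using linked_component(1)[OF assms(1), of C "{}"] by simp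
qed

text \<open>With unit weights the weight bound becomes a bound on the number of vertices. Two
  vertices are required so that the starting vertex has a neighbour.\<close>

lemma balanced_separator_list:
  assumes G: "sgraph G" and conn: "connected_graph G" and n: "card (verts G) \<ge> 2"
    and free: "\<And>p. \<not> induced_path G t p" and t: "t > 0"
  shows "\<exists>xs. length xs = t \<and> set xs \<subseteq> verts G \<and>
    (\<forall>D. linked G D \<and> D \<subseteq> verts G - nbhd G (set xs) \<longrightarrow> 2 * card D \<le> card (verts G))"
proof -
  have "verts G \<noteq> {}" using n by auto
  then obtain u where u: "u \<in> verts G" by blast
  have ne: "verts G \<noteq> {u}" using n by auto
  obtain Q where Q: "Q \<subseteq> verts G" "Q \<noteq> {}" "card Q \<le> t"
    and small: "\<And>D. D \<subseteq> verts G - nbhd G Q \<Longrightarrow> linked G D \<Longrightarrow>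
      (\<Sum>v\<in>D. 1::real) \<le> real (card (verts G)) / 2"
    using balanced_separator[OF G subset_refl linked_verts_if_connected[OF G conn] u ne, of "\<lambda>_. 1"
        "real (card (verts G))" t] free t by auto
  have "finite Q" using Q G finite_subset by (auto simp: sgraph_def)
  then obtain xs where xs: "length xs = t" "set xs = Q"
    using exists_list_of_length Q(2,3) by blast
  have "2 * card D \<le> card (verts G)" if "linked G D" "D \<subseteq> verts G - nbhd G Q" for D
    using small[OF that(2,1)] by simp
  then show ?thesis using xs Q(1) by (intro exI[of _ xs]) auto
qed

section \<open>The class of P_t-free graphs\<close>

lemma isomorphicE:
  assumes "isomorphic G H"
  obtains f where "bij_betw f (verts G) (verts H)"
    "\<And>u v. u \<in> verts G \<Longrightarrow> v \<in> verts G \<Longrightarrow> {u, v} \<in> edges G \<longleftrightarrow> {f u, f v} \<in> edges H"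
  using assms unfolding isomorphic_def by blast

lemma isomorphic_trans:
  assumes "isomorphic G H" "isomorphic H K"
  shows "isomorphic G K"
proof -
  obtain f where f: "bij_betw f (verts G) (verts H)"
    "\<And>u v. u \<in> verts G \<Longrightarrow> v \<in> verts G \<Longrightarrow> {u, v} \<in> edges G \<longleftrightarrow> {f u, f v} \<in> edges H"
    using assms(1) by (rule isomorphicE) blast
  obtain g where g: "bij_betw g (verts H) (verts K)"
    "\<And>u v. u \<in> verts H \<Longrightarrow> v \<in> verts H \<Longrightarrow> {u, v} \<in> edges H \<longleftrightarrow> {g u, g v} \<in> edges K"
    using assms(2) by (rule isomorphicE) blast
  show ?thesis
    unfolding isomorphic_def
    using bij_betw_trans[OF f(1) g(1)] f(2) g(2) bij_betw_apply[OF f(1)]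
    by (intro exI[of _ "g \<circ> f"]) auto
qed

lemma isomorphic_induced:
  assumes "isomorphic G H" "S \<subseteq> verts H"
  shows "\<exists>T\<subseteq>verts G. isomorphic (induced G T) (induced H S)"
proof -
  obtain f where f: "bij_betw f (verts G) (verts H)"
    "\<And>u v. u \<in> verts G \<Longrightarrow> v \<in> verts G \<Longrightarrow> {u, v} \<in> edges G \<longleftrightarrow> {f u, f v} \<in> edges H"
    using assms(1) by (rule isomorphicE) blast
  define T where "T = {v \<in> verts G. f v \<in> S}"
  have T: "f ` T = S" "T \<subseteq> verts G"
    using f(1) assms(2) by (auto simp: T_def bij_betw_def)
  then have "bij_betw f T S"
    using f(1) by (auto simp: bij_betw_def intro: inj_on_subset)
  then have "isomorphic (induced G T) (induced H S)"
    unfolding isomorphic_def using T f(2) assms(2)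
    by (intro exI[of _ f]) (auto simp: induced_def Int_absorb1 subset_iff)
  then show ?thesis using T by blast
qed

lemma hereditary_P_free_class: "hereditary (P_free_class t)"
proof -
  have "induced G S \<in> P_free_class t" if G: "G \<in> P_free_class t" and S: "S \<subseteq> verts G" for G S
  proof -
    have "sgraph (induced G S)"
      using G by (auto simp: P_free_class_def sgraph_def induced_def)
    moreover have "induced (induced G S) T = induced G T" if "T \<subseteq> verts (induced G S)" for T
      using that by (auto simp: induced_def)
    ultimately show ?thesis
      using G S by (fastforce simp: P_free_class_def induced_def)
  qed
  moreover have "G' \<in> P_free_class t"
    if G: "G \<in> P_free_class t" and G': "sgraph G'" "isomorphic G G'" for G G'
  proof -
    have "\<not> isomorphic (induced G' S) (path_graph t)" if "S \<subseteq> verts G'" for S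
    proof
      assume "isomorphic (induced G' S) (path_graph t)"
      with isomorphic_induced[OF G'(2) that]
      obtain T where "T \<subseteq> verts G" "isomorphic (induced G T) (path_graph t)"
        using isomorphic_trans by blast
      then show False using G by (auto simp: P_free_class_def)
    qed
    then show ?thesis using G'(1) by (auto simp: P_free_class_def)
  qed
  moreover have "sgraph G" if "G \<in> P_free_class t" for G
    using that by (simp add: P_free_class_def)
  ultimately show ?thesis unfolding hereditary_def by blast
qed

lemma P_free_classD:
  assumes "G \<in> P_free_class t"
  shows "sgraph G" and "\<not> induced_path G t p" and "t > 0"
proof -
  show "sgraph G" using assms by (simp add: P_free_class_def)
  show *: "\<not> induced_path G t p" for p
    using assms induced_path_isomorphic[of G t p] by (auto simp: P_free_class_def induced_path_def)
  \<comment> \<open>The path on 0 vertices is induced in every graph, so the class for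
    \<open>t = 0\<close> is empty.\<close>
  show "t > 0" using *[of undefined] by (cases t) (auto simp: induced_path_def)
qed

section \<open>Weakest preconditions with time bounds\<close>

fun writes :: "com \<Rightarrow> string set" where
  "writes Skip = {}"
| "writes (Assign x a b) = {x}"
| "writes (Write a) = {}"
| "writes (Seq c d) = writes c \<union> writes d"
| "writes (Cond a c d) = writes c \<union> writes d"
| "writes (While a c) = writes c"

lemma exec_frame: "exec c s t s' out \<Longrightarrow> x \<notin> writes c \<Longrightarrow> s' x = s x"
  by (induction rule: exec.induct) auto

text \<open>A step writes at most one number. The time bound thus also bounds the number of sets
  that are written.\<close>

lemma exec_length_out: "exec c s t s' out \<Longrightarrow> length out \<le> t"
  by (induction rule: exec.induct) auto

text \<open>\<open>Z\<close> is the set of arrays that may differ, so that \<open>writes c\<close>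
  can be used for it directly.\<close>

definition agree :: "string set \<Rightarrow> store \<Rightarrow> store \<Rightarrow> bool" where
  "agree Z s s' \<longleftrightarrow> (\<forall>z. z \<notin> Z \<longrightarrow> s' z = s z)"

lemma agreeD: "agree Z s s' \<Longrightarrow> z \<notin> Z \<Longrightarrow> s' z = s z"
  by (simp add: agree_def)

lemma agree_refl: "agree Z s s"
  by (simp add: agree_def)

lemma agree_trans: "agree Z s s' \<Longrightarrow> agree Z s' s'' \<Longrightarrow> agree Z s s''"
  by (simp add: agree_def)

lemma agree_mono: "agree Z s s' \<Longrightarrow> Z \<subseteq> Z' \<Longrightarrow> agree Z' s s'"
  by (auto simp: agree_def)

text \<open>An existential triple suffices, as \<open>outputs_within\<close> asks for one halting
  run within the time bound.\<close>

definition wp :: "com \<Rightarrow> nat \<Rightarrow> store \<Rightarrow> (store \<Rightarrow> nat list \<Rightarrow> bool) \<Rightarrow> bool" where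
  "wp c T s Q \<longleftrightarrow> (\<exists>t s' out. exec c s t s' out \<and> t \<le> T \<and> Q s' out)"

text \<open>The frame is supplied here and in \<open>wp_Seq\<close>, so a specification states only
  what a command changes.\<close>

lemma wp_conseq:
  assumes "wp c T s Q" "T \<le> T'" "\<And>s' out. Q s' out \<Longrightarrow> agree (writes c) s s' \<Longrightarrow> Q' s' out"
  shows "wp c T' s Q'"
proof -
  obtain t s' out where e: "exec c s t s' out" "t \<le> T" "Q s' out"
    using assms(1) by (auto simp: wp_def)
  have "agree (writes c) s s'" using exec_frame[OF e(1)] by (simp add: agree_def)
  then show ?thesis using e assms(2,3) unfolding wp_def by fastforce
qed

lemma wp_Seq:
  assumes "wp c T s R"
    "\<And>s' out. R s' out \<Longrightarrow> agree (writes c) s s' \<Longrightarrow> wp d U s' (\<lambda>s'' out'. Q s'' (out @ out'))"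
    "T + U \<le> V"
  shows "wp (Seq c d) V s Q"
proof -
  obtain t s' out where e: "exec c s t s' out" "t \<le> T" "R s' out"
    using assms(1) by (auto simp: wp_def)
  have "agree (writes c) s s'" using exec_frame[OF e(1)] by (simp add: agree_def)
  from assms(2)[OF e(3) this]
  obtain t' s'' out' where e': "exec d s' t' s'' out'" "t' \<le> U" "Q s'' (out @ out')"
    by (auto simp: wp_def)
  show ?thesis
    unfolding wp_def using exec.Seq[OF e(1) e'(1)] e e' assms(3) by fastforce
qed

lemma wp_Cond:
  assumes "aval a s \<noteq> 0 \<Longrightarrow> wp c T s Q" "aval a s = 0 \<Longrightarrow> wp d T s Q" "Suc T \<le> T'"
  shows "wp (Cond a c d) T' s Q"
proof (cases "aval a s = 0")
  case True
  then obtain t s' out where "exec d s t s' out" "t \<le> T" "Q s' out"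
    using assms(2) by (auto simp: wp_def)
  then show ?thesis
    using exec.CondFalse[OF True] assms(3) unfolding wp_def by (meson Suc_le_mono order_trans)
next
  case False
  then obtain t s' out where "exec c s t s' out" "t \<le> T" "Q s' out"
    using assms(1) by (auto simp: wp_def)
  then show ?thesis
    using exec.CondTrue[OF False] assms(3) unfolding wp_def by (meson Suc_le_mono order_trans)
qed

section \<open>Symbolic execution of loop-free code\<close>

fun straight :: "com \<Rightarrow> bool" where
  "straight (Seq c d) \<longleftrightarrow> straight c \<and> straight d"
| "straight (Cond a c d) \<longleftrightarrow> straight c \<and> straight d"
| "straight (While a c) \<longleftrightarrow> False"
| "straight _ \<longleftrightarrow> True"

fun cost :: "com \<Rightarrow> nat" where
  "cost (Seq c d) = cost c + cost d"
| "cost (Cond a c d) = Suc (max (cost c) (cost d))"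
| "cost _ = 1"

fun store_after :: "com \<Rightarrow> store \<Rightarrow> store" where
  "store_after (Assign x a b) s = s(x := (s x)(aval a s := aval b s))"
| "store_after (Seq c d) s = store_after d (store_after c s)"
| "store_after (Cond a c d) s = (if aval a s \<noteq> 0 then store_after c s else store_after d s)"
| "store_after _ s = s"

fun out_of :: "com \<Rightarrow> store \<Rightarrow> nat list" where
  "out_of (Write a) s = [aval a s]"
| "out_of (Seq c d) s = out_of c s @ out_of d (store_after c s)"
| "out_of (Cond a c d) s = (if aval a s \<noteq> 0 then out_of c s else out_of d s)"
| "out_of _ s = []"

lemma exec_straight:
  "straight c \<Longrightarrow> \<exists>t\<le>cost c. exec c s t (store_after c s) (out_of c s)"
proof (induction c arbitrary: s)
  case (Seq c d)
  then show ?case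
    using exec.Seq by (metis add_mono cost.simps(1) out_of.simps(2) store_after.simps(2) straight.simps(1))
next
  case (Cond a c d)
  then obtain t t' where "t \<le> cost c" "exec c s t (store_after c s) (out_of c s)"
    "t' \<le> cost d" "exec d s t' (store_after d s) (out_of d s)"
    by (meson straight.simps(2))
  then show ?case
    using exec.CondTrue[of a s c t "store_after c s" "out_of c s" d]
      exec.CondFalse[of a s d t' "store_after d s" "out_of d s" c]
    by (cases "aval a s = 0") (force intro: exI[of _ "Suc t'"], force intro: exI[of _ "Suc t"])
qed (auto intro: exec.intros[unfolded One_nat_def])

lemma wp_straight:
  assumes "straight c" "cost c \<le> T" "Q (store_after c s) (out_of c s)"
  shows "wp c T s Q"
  using exec_straight[OF assms(1), of s] assms(2,3) unfolding wp_def by (meson order_trans)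

text \<open>The number \<open>N\<close> of rounds is known in advance. The invariant is indexed by
  the rounds done and speaks of everything written since the loop began.\<close>

lemma wp_While:
  assumes "Inv 0 s []"
    "\<And>k s' out. Inv k s' out \<Longrightarrow> k \<le> N \<Longrightarrow> aval a s' \<noteq> 0 \<longleftrightarrow> k < N"
    "\<And>k s' out. Inv k s' out \<Longrightarrow> k < N \<Longrightarrow> agree (writes c) s s' \<Longrightarrow>
       wp c T s' (\<lambda>s'' out'. Inv (Suc k) s'' (out @ out'))"
  shows "wp (While a c) (N * (T + 1) + 1) s (Inv N)"
proof -
  \<comment> \<open>For the induction on the remaining rounds, the claim is generalised to a start
    after \<open>k\<close> rounds with \<open>out\<close> already written.\<close>
  have "wp (While a c) ((N - k) * (T + 1) + 1) s' (\<lambda>s'' out'. Inv N s'' (out @ out'))"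
    if "Inv k s' out" "k \<le> N" "agree (writes c) s s'" for k s' out
    using that
  proof (induction "N - k" arbitrary: k s' out)
    case 0
    then have "k = N" by simp
    then show ?case
      using assms(2)[OF 0(2,3)] 0 exec.WhileFalse[of a s' c] unfolding wp_def
      by (intro exI[of _ 1] exI[of _ s'] exI[of _ "[]"]) auto
  next
    case (Suc m)
    then have k: "k < N" by simp
    obtain t s1 out1 where e: "exec c s' t s1 out1" "t \<le> T" "Inv (Suc k) s1 (out @ out1)"
      using assms(3)[OF Suc.prems(1) k Suc.prems(3)] by (auto simp: wp_def)
    have "agree (writes c) s' s1" using exec_frame[OF e(1)] by (simp add: agree_def)
    then have ag: "agree (writes c) s s1" using Suc.prems(3) agree_trans by blast
    have "wp (While a c) ((N - Suc k) * (T + 1) + 1) s1 (\<lambda>s'' out'. Inv N s'' ((out @ out1) @ out'))"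
      using Suc.hyps(1)[OF _ e(3) _ ag] Suc.hyps(2) k by simp
    then obtain t' s2 out2 where e': "exec (While a c) s1 t' s2 out2"
      "t' \<le> (N - Suc k) * (T + 1) + 1" "Inv N s2 ((out @ out1) @ out2)"
      by (auto simp: wp_def)
    have "exec (While a c) s' (Suc (t + t')) s2 (out1 @ out2)"
      using assms(2)[OF Suc.prems(1,2)] k exec.WhileTrue[OF _ e(1) e'(1)] by blast
    moreover have "N - k = Suc (N - Suc k)" using k by simp
    then have "Suc (t + t') \<le> (N - k) * (T + 1) + 1" using e(2) e'(2) by simp
    ultimately show ?case using e'(3) unfolding wp_def
      by (intro exI[of _ "Suc (t + t')"] exI[of _ s2] exI[of _ "out1 @ out2"]) auto
  qed
  from this[OF assms(1)] show ?thesis by (simp add: agree_refl)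
qed

section \<open>Counting loops\<close>

abbreviation V :: "string \<Rightarrow> aexp" where "V x \<equiv> Cell x (Num 0)"
abbreviation Set :: "string \<Rightarrow> aexp \<Rightarrow> com" where "Set x \<equiv> Assign x (Num 0)"

text \<open>The bound \<open>y\<close> is read again in every round; truncated subtraction is
  nonzero exactly while the counter is below it.\<close>

definition For :: "string \<Rightarrow> string \<Rightarrow> com \<Rightarrow> com" where
  "For x y c = Seq (Set x (Num 0)) (While (Minus (V y) (V x)) (Seq c (Set x (Plus (V x) (Num 1)))))"

lemma writes_For [simp]: "writes (For x y c) = insert x (writes c)"
  by (auto simp: For_def)

text \<open>The invariant must not depend on the counter array, which changes after the body; the
  body gets the counter value as a separate fact. Each round pays 2 for the test and the increment,
  and the final 2 pays for the initialisation and the failing test.\<close>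

lemma wp_For:
  assumes xy: "x \<noteq> y" "x \<notin> writes c" "y \<notin> writes c" and N: "s y 0 = N"
    and indep: "\<And>i s' f out. Inv i s' out \<Longrightarrow> Inv i (s'(x := f)) out"
    and init: "Inv 0 s []"
    and step: "\<And>i s' out. Inv i s' out \<Longrightarrow> i < N \<Longrightarrow> s' x 0 = i \<Longrightarrow> agree (insert x (writes c)) s s' \<Longrightarrow>
      wp c T s' (\<lambda>s'' out'. Inv (Suc i) s'' (out @ out'))"
    and T': "N * (T + 2) + 2 \<le> T'"
  shows "wp (For x y c) T' s (Inv N)"
  unfolding For_def
proof (rule wp_Seq)
  let ?Z = "insert x (writes c)"
  let ?s = "s(x := (s x)(0 := 0))"
  show "wp (Set x (Num 0)) 1 s (\<lambda>s' out. s' = ?s \<and> out = [])"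
    by (rule wp_straight) auto
  fix s' and out :: "nat list" assume "s' = ?s \<and> out = []"
  then have s': "s' = ?s" and out: "out = []" by auto
  have "wp (While (Minus (V y) (V x)) (Seq c (Set x (Plus (V x) (Num 1))))) (N * (T + 1 + 1) + 1) ?s
     (\<lambda>s' out. Inv N s' out \<and> s' x 0 = N \<and> s' y 0 = N \<and> agree ?Z s s')"
  proof (rule wp_While[where Inv = "\<lambda>i s' out. Inv i s' out \<and> s' x 0 = i \<and> s' y 0 = N \<and> agree ?Z s s'"])
    show "Inv 0 ?s [] \<and> ?s x 0 = 0 \<and> ?s y 0 = N \<and> agree ?Z s ?s"
      using indep[OF init] N xy by (simp add: agree_def)
  next
    fix k s' out
    assume "Inv k s' out \<and> s' x 0 = k \<and> s' y 0 = N \<and> agree ?Z s s'" "k \<le> N"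
    then show "aval (Minus (V y) (V x)) s' \<noteq> 0 \<longleftrightarrow> k < N" by auto
  next
    fix k s' out
    assume I: "Inv k s' out \<and> s' x 0 = k \<and> s' y 0 = N \<and> agree ?Z s s'" and k: "k < N"
    show "wp (Seq c (Set x (Plus (V x) (Num 1)))) (T + 1) s' (\<lambda>s'' out'. Inv (Suc k) s'' (out @ out') \<and>
        s'' x 0 = Suc k \<and> s'' y 0 = N \<and> agree ?Z s s'')"
    proof (rule wp_Seq)
      show "wp c T s' (\<lambda>s'' out'. Inv (Suc k) s'' (out @ out'))"
        using step I k by blast
      fix s1 out1
      assume "Inv (Suc k) s1 (out @ out1)" and ag: "agree (writes c) s' s1"
      moreover have "s1 x 0 = k" "s1 y 0 = N"
        using agreeD[OF ag] xy I by auto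
      moreover have "agree ?Z s s1"
        using ag I agree_mono[OF ag, of ?Z] agree_trans by blast
      ultimately show "wp (Set x (Plus (V x) (Num 1))) 1 s1 (\<lambda>s'' out'. Inv (Suc k) s'' (out @ out1 @ out') \<and>
          s'' x 0 = Suc k \<and> s'' y 0 = N \<and> agree ?Z s s'')"
        using xy indep by (intro wp_straight) (auto simp: agree_def)
    qed simp
  qed
  then show "wp (While (Minus (V y) (V x)) (Seq c (Set x (Plus (V x) (Num 1))))) (N * (T + 2) + 1) s'
      (\<lambda>s'' out'. Inv N s'' (out @ out'))"
    unfolding s' out by (rule wp_conseq) auto
qed (use T' in simp)

lemma outputs_withinI:
  assumes "wp P T (init_store xs) (\<lambda>s out. out = ys)" "real T \<le> B"
  shows "outputs_within P xs ys B"
  using assms unfolding wp_def outputs_within_def by (meson of_nat_le_iff order_trans)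

lemma length_out_if_outputs_within: "outputs_within P xs ys B \<Longrightarrow> real (length ys) \<le> B"
  unfolding outputs_within_def by (meson exec_length_out of_nat_le_iff order_trans)

section \<open>Enumeration of tuples\<close>

text \<open>The tuples of length \<open>L\<close> over \<open>{..<n}\<close> are the contents of the array \<open>d\<close>, read as the digits
  of a counter in base \<open>n\<close>, least significant first.  The carry \<open>c\<close> out of the last digit doubles
  as the flag that ends the enumeration.\<close>

definition increment :: com where
  "increment = Seq (Set ''c'' (Num 1)) (For ''i'' ''L''
     (Seq (Assign ''d'' (V ''i'') (Plus (Cell ''d'' (V ''i'')) (V ''c'')))
       (Cond (Minus (V ''n'') (Cell ''d'' (V ''i''))) (Set ''c'' (Num 0))
         (Seq (Assign ''d'' (V ''i'') (Num 0)) (Set ''c'' (Num 1))))))"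

lemma writes_increment [simp]: "writes increment = {''c'', ''i'', ''d''}"
  by (auto simp: increment_def)

text \<open>A carry reaches the digit of place value \<open>m\<close> exactly if all lower digits of
  \<open>k\<close> overflow, that is, if \<open>m\<close> divides \<open>Suc k\<close>.\<close>

lemma digit_Suc:
  fixes k n m :: nat
  assumes "n > 0"
  defines "c \<equiv> (if m dvd Suc k then 1 else 0)"
  shows "k div m mod n + c < n \<Longrightarrow> Suc k div m mod n = k div m mod n + c \<and> \<not> m * n dvd Suc k"
    and "\<not> k div m mod n + c < n \<Longrightarrow> Suc k div m mod n = 0 \<and> m * n dvd Suc k"
proof -
  have d: "Suc k div m = k div m + c"
    by (auto simp: div_Suc c_def dvd_eq_mod_eq_0)
  have dvd: "m * n dvd Suc k \<longleftrightarrow> m dvd Suc k \<and> Suc k div m mod n = 0"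
    by (metis div_mult_mod_eq dvd_div_iff_mult dvd_imp_mod_0 dvd_mult_left mod_0_imp_dvd
        dvd_def mult.commute mult_is_0 nat.simps(3))
  show "Suc k div m mod n = k div m mod n + c \<and> \<not> m * n dvd Suc k" if "k div m mod n + c < n"
  proof -
    have e: "Suc k div m mod n = k div m mod n + c"
      unfolding d using that by (metis mod_add_left_eq mod_less)
    then show ?thesis using dvd by (auto simp: c_def)
  qed
  show "Suc k div m mod n = 0 \<and> m * n dvd Suc k" if "\<not> k div m mod n + c < n"
  proof -
    have "k div m mod n < n" using assms(1) by simp
    then have "k div m mod n + c = n" "c = 1" using that by (auto simp: c_def split: if_splits)
    moreover have "Suc k div m mod n = 0"
      unfolding d using calculation by (metis mod_add_left_eq mod_self)
    ultimately show ?thesis using dvd by (auto simp: c_def split: if_splits)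
  qed
qed

lemma wp_increment:
  assumes n: "s ''n'' 0 = n" "n > 0" and L: "s ''L'' 0 = L"
    and d: "\<And>i. i < L \<Longrightarrow> s ''d'' i = k div n ^ i mod n"
  shows "wp increment (L * 6 + 3) s (\<lambda>s' out. out = [] \<and>
    (\<forall>i<L. s' ''d'' i = Suc k div n ^ i mod n) \<and>
    s' ''c'' 0 = (if n ^ L dvd Suc k then 1 else 0))"
  unfolding increment_def
proof (rule wp_Seq)
  show "wp (Set ''c'' (Num 1)) 1 s (\<lambda>s' out. out = [] \<and> s' ''c'' 0 = 1)"
    by (rule wp_straight) auto
  fix s1 and out1 :: "nat list"
  assume s1: "out1 = [] \<and> s1 ''c'' 0 = 1" and ag: "agree (writes (Set ''c'' (Num 1))) s s1"
  have s1': "s1 ''n'' 0 = n" "s1 ''L'' 0 = L" "\<And>i. i < L \<Longrightarrow> s1 ''d'' i = k div n ^ i mod n"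
    using agreeD[OF ag] n L d by auto
  \<comment> \<open>The digits below \<open>i\<close> already belong to \<open>Suc k\<close>, the
    others still to \<open>k\<close>, and \<open>c\<close> is the carry between them.\<close>
  let ?Inv = "\<lambda>i s' (out :: nat list). out = [] \<and> (\<forall>j<i. s' ''d'' j = Suc k div n ^ j mod n) \<and>
    (\<forall>j. i \<le> j \<and> j < L \<longrightarrow> s' ''d'' j = k div n ^ j mod n) \<and>
    s' ''c'' 0 = (if n ^ i dvd Suc k then 1 else 0)"
  have "wp (For ''i'' ''L''
     (Seq (Assign ''d'' (V ''i'') (Plus (Cell ''d'' (V ''i'')) (V ''c'')))
       (Cond (Minus (V ''n'') (Cell ''d'' (V ''i''))) (Set ''c'' (Num 0))
         (Seq (Assign ''d'' (V ''i'') (Num 0)) (Set ''c'' (Num 1)))))) (L * 6 + 2) s1 (?Inv L)"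
  proof (rule wp_For[where T = 4 and N = L and Inv = ?Inv])
    fix i s' out
    assume I: "?Inv i s' out" and i: "i < L" "s' ''i'' 0 = i"
      and ag': "agree (insert ''i'' (writes (Seq (Assign ''d'' (V ''i'') (Plus (Cell ''d'' (V ''i'')) (V ''c'')))
       (Cond (Minus (V ''n'') (Cell ''d'' (V ''i''))) (Set ''c'' (Num 0))
         (Seq (Assign ''d'' (V ''i'') (Num 0)) (Set ''c'' (Num 1))))))) s1 s'"
    have n': "s' ''n'' 0 = n" using agreeD[OF ag', of "''n''"] s1' by simp
    note dig = digit_Suc[OF n(2), of k "n ^ i"]
    show "wp (Seq (Assign ''d'' (V ''i'') (Plus (Cell ''d'' (V ''i'')) (V ''c'')))
       (Cond (Minus (V ''n'') (Cell ''d'' (V ''i''))) (Set ''c'' (Num 0))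
         (Seq (Assign ''d'' (V ''i'') (Num 0)) (Set ''c'' (Num 1))))) 4 s'
         (\<lambda>s'' out'. ?Inv (Suc i) s'' (out @ out'))"
      using I i n' dig by (intro wp_straight) (auto simp: less_Suc_eq mult.commute)
  qed (use s1 s1' in auto)
  then show "wp (For ''i'' ''L''
     (Seq (Assign ''d'' (V ''i'') (Plus (Cell ''d'' (V ''i'')) (V ''c'')))
       (Cond (Minus (V ''n'') (Cell ''d'' (V ''i''))) (Set ''c'' (Num 0))
         (Seq (Assign ''d'' (V ''i'') (Num 0)) (Set ''c'' (Num 1)))))) (L * 6 + 2) s1
     (\<lambda>s' out'. out1 @ out' = [] \<and> (\<forall>i<L. s' ''d'' i = Suc k div n ^ i mod n) \<and>
       s' ''c'' 0 = (if n ^ L dvd Suc k then 1 else 0))"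
    using s1 by (auto elim!: wp_conseq)
qed simp

text \<open>The all-zero tuple and the flag \<open>c = 0\<close> are what the initial store
  provides, so no initialisation is done.\<close>

definition enumerate :: "com \<Rightarrow> com" where
  "enumerate c = While (Minus (Num 1) (V ''c'')) (Seq c increment)"

lemma writes_enumerate [simp]: "writes (enumerate c) = writes c \<union> {''c'', ''i'', ''d''}"
  by (simp add: enumerate_def)

text \<open>The invariant ignores \<open>i\<close> along with the counter arrays, so the body is
  free to use \<open>i\<close> for its own loops.\<close>

lemma wp_enumerate:
  assumes n: "s ''n'' 0 = n" "n > 0" and L: "s ''L'' 0 = L"
    and c0: "s ''c'' 0 = 0" and d0: "\<And>i. i < L \<Longrightarrow> s ''d'' i = 0"
    and w: "writes c \<inter> {''n'', ''L'', ''c'', ''d''} = {}"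
    and indep: "\<And>k s' s'' out. Inv k s' out \<Longrightarrow> agree {''c'', ''i'', ''d''} s' s'' \<Longrightarrow> Inv k s'' out"
    and init: "Inv 0 s []"
    and step: "\<And>k s' out. Inv k s' out \<Longrightarrow> k < n ^ L \<Longrightarrow>
      (\<forall>i<L. s' ''d'' i = k div n ^ i mod n) \<Longrightarrow>
      agree (writes c \<union> {''c'', ''i'', ''d''}) s s' \<Longrightarrow>
      wp c T s' (\<lambda>s'' out'. Inv (Suc k) s'' (out @ out'))"
  shows "wp (enumerate c) (n ^ L * (T + L * 6 + 4) + 1) s (Inv (n ^ L))"
proof -
  let ?Z = "writes c \<union> {''c'', ''i'', ''d''}"
  let ?I = "\<lambda>k s' out. Inv k s' out \<and> (\<forall>i<L. s' ''d'' i = k div n ^ i mod n) \<and>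
    s' ''c'' 0 = (if k = n ^ L then 1 else 0)"
  have pos: "n ^ L > 0" using n by simp
  have "wp (enumerate c) (n ^ L * (T + (L * 6 + 3) + 1) + 1) s (?I (n ^ L))"
    unfolding enumerate_def
  proof (rule wp_While[where Inv = ?I])
    show "?I 0 s []" using init c0 d0 pos by auto
  next
    fix k s' out
    assume "?I k s' out" "k \<le> n ^ L"
    then show "aval (Minus (Num 1) (V ''c'')) s' \<noteq> 0 \<longleftrightarrow> k < n ^ L" by auto
  next
    fix k s' out
    assume I: "?I k s' out" and k: "k < n ^ L" and ag: "agree (writes (Seq c increment)) s s'"
    have ag': "agree ?Z s s'" using ag by (auto simp: agree_def)
    show "wp (Seq c increment) (T + (L * 6 + 3)) s' (\<lambda>s'' out'. ?I (Suc k) s'' (out @ out'))"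
    proof (rule wp_Seq)
      show "wp c T s' (\<lambda>s'' out'. Inv (Suc k) s'' (out @ out'))"
        using step I k ag' by blast
      fix s1 out1
      assume I1: "Inv (Suc k) s1 (out @ out1)" and ag1: "agree (writes c) s' s1"
      have eq: "s1 z = s' z" if "z \<in> {''n'', ''L'', ''c'', ''d''}" for z
        using agreeD[OF ag1] that w by blast
      have nL: "s' ''n'' 0 = n" "s' ''L'' 0 = L"
        using agreeD[OF ag', of "''n''"] agreeD[OF ag', of "''L''"] w n L by auto
      have "wp increment (L * 6 + 3) s1 (\<lambda>s' out. out = [] \<and>
        (\<forall>i<L. s' ''d'' i = Suc k div n ^ i mod n) \<and>
        s' ''c'' 0 = (if n ^ L dvd Suc k then 1 else 0))"
        by (rule wp_increment) (use eq nL n I in auto)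
      then show "wp increment (L * 6 + 3) s1 (\<lambda>s'' out'. ?I (Suc k) s'' (out @ out1 @ out'))"
      proof (rule wp_conseq)
        fix s2 and out2 :: "nat list"
        assume s2: "out2 = [] \<and> (\<forall>i<L. s2 ''d'' i = Suc k div n ^ i mod n) \<and>
          s2 ''c'' 0 = (if n ^ L dvd Suc k then 1 else 0)" and ag2: "agree (writes increment) s1 s2"
        \<comment> \<open>The carry leaves the last digit only after the last tuple.\<close>
        have "n ^ L dvd Suc k \<longleftrightarrow> Suc k = n ^ L"
          using k by (auto dest!: dvd_imp_le)
        then show "?I (Suc k) s2 (out @ out1 @ out2)"
          using s2 indep[OF I1, of s2] ag2 by auto
      qed simp
    qed simp
  qed
  then show ?thesis by (rule wp_conseq) (auto simp: algebra_simps)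
qed

lemma exists_code_of_digits:
  fixes f :: "nat \<Rightarrow> nat"
  assumes "\<And>i. i < L \<Longrightarrow> f i < n"
  shows "\<exists>k<n ^ L. \<forall>i<L. k div n ^ i mod n = f i"
  using assms
proof (induction L arbitrary: f)
  case 0
  then show ?case by auto
next
  case (Suc L)
  obtain k where k: "k < n ^ L" "\<And>i. i < L \<Longrightarrow> k div n ^ i mod n = f (Suc i)"
    using Suc.IH[of "\<lambda>i. f (Suc i)"] Suc.prems by auto
  have f0: "f 0 < n" using Suc.prems by simp
  have "f 0 + n * k < n * Suc k" using f0 by simp
  also have "\<dots> \<le> n * n ^ L" using k(1) by (intro mult_le_mono2) simp
  finally have "f 0 + n * k < n ^ Suc L" by simp
  moreover have "(f 0 + n * k) div n ^ i mod n = f i" if "i < Suc L" for i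
  proof (cases i)
    case 0
    then show ?thesis using f0 by simp
  next
    case (Suc j)
    have "(f 0 + n * k) div n ^ i = k div n ^ j"
      using f0 by (simp add: Suc div_mult2_eq)
    then show ?thesis using k(2) that Suc by simp
  qed
  ultimately show ?case by blast
qed

section \<open>Marking neighbourhoods and labelling components\<close>

text \<open>As there is no multiplication, the array \<open>r\<close> holds the positions at which the rows of the
  adjacency matrix start in the input.\<close>

definition graph_env :: "nat graph \<Rightarrow> nat \<Rightarrow> store \<Rightarrow> bool" where
  "graph_env G n s \<longleftrightarrow> s ''n'' 0 = n \<and>
     (\<forall>u<n. \<forall>v<n. s ''in'' (s ''r'' u + v) = of_bool ({u, v} \<in> edges G))"

lemma graph_env_agree:
  assumes "graph_env G n s" "agree Z s s'" "Z \<inter> {''n'', ''in'', ''r''} = {}"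
  shows "graph_env G n s'"
proof -
  have "s' z = s z" if "z \<in> {''n'', ''in'', ''r''}" for z
    using agreeD[OF assms(2)] assms(3) that by blast
  then show ?thesis using assms(1) by (simp add: graph_env_def)
qed

text \<open>The rows start at 1 because cell 0 of the input holds \<open>n\<close>.\<close>

definition load_graph :: com where
  "load_graph = Seq (Set ''n'' (Cell ''in'' (Num 0))) (Seq (Assign ''r'' (Num 0) (Num 1))
     (For ''i'' ''n'' (Assign ''r'' (Plus (V ''i'') (Num 1)) (Plus (Cell ''r'' (V ''i'')) (V ''n'')))))"

lemma writes_load_graph [simp]: "writes load_graph = {''n'', ''r'', ''i''}"
  by (auto simp: load_graph_def)

lemma nth_concat_map_upt:
  assumes "\<And>i. i < m \<Longrightarrow> length (f i) = n" "u < m" "v < n"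
  shows "concat (map f [0..<m]) ! (u * n + v) = f u ! v"
  using assms
proof (induction m)
  case (Suc m)
  have len: "length (concat (map f [0..<m])) = m * n"
  proof -
    have "map (length \<circ> f) [0..<m] = map (\<lambda>_. n) [0..<m]" using Suc.prems(1) by simp
    then have "sum_list (map (length \<circ> f) [0..<m]) = sum_list (map (\<lambda>_. n) [0..<m])" by (simp only:)
    then show ?thesis by (simp add: length_concat sum_list_triv)
  qed
  show ?case
  proof (cases "u = m")
    case True
    then show ?thesis using len Suc.prems by (simp add: nth_append)
  next
    case False
    then have u: "u < m" using Suc.prems by simp
    then have "u * n + v < m * n"
      using Suc.prems(3) mult_le_mono1[of "Suc u" m n] by simp
    then show ?thesis using len Suc u by (simp add: nth_append)
  qed
qed simp

text \<open>\<open>ws\<close> stands for the vertex weights behind the matrix; it is empty for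
  unweighted input.\<close>

lemma wp_load_graph:
  assumes "verts G = {..<n}" "s = init_store (graph_code G @ ws)"
  shows "wp load_graph (n * 3 + 4) s (\<lambda>s' out. out = [] \<and> graph_env G n s')"
proof -
  let ?row = "\<lambda>i. map (\<lambda>j. if {i, j} \<in> edges G then 1 else 0 :: nat) [0..<n]"
  have code: "graph_code G = n # concat (map ?row [0..<n])"
    using assms(1) by (simp add: graph_code_def)
  have in0: "s ''in'' 0 = n"
    using assms(2) code by (simp add: init_store_def)
  have len: "length (concat (map ?row [0..<n])) = n * n"
    by (simp add: length_concat comp_def sum_list_triv)
  then have in_uv: "s ''in'' (Suc (u * n) + v) = of_bool ({u, v} \<in> edges G)" if "u < n" "v < n" for u v
  proof -
    have lt: "u * n + v < length (concat (map ?row [0..<n]))"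
      using that mult_le_mono1[of "Suc u" n n] len by simp
    then show ?thesis
      using nth_concat_map_upt[of n ?row n u v] that assms(2) code
      by (simp add: init_store_def nth_append)
  qed
  let ?s1 = "s(''n'' := (s ''n'')(0 := n), ''r'' := (s ''r'')(0 := 1))"
  show ?thesis
    unfolding load_graph_def
  proof (rule wp_Seq)
    show "wp (Set ''n'' (Cell ''in'' (Num 0))) 1 s (\<lambda>s' out. out = [] \<and> s' = s(''n'' := (s ''n'')(0 := n)))"
      by (rule wp_straight) (auto simp: in0)
    fix s1 and out1 :: "nat list"
    assume s1: "out1 = [] \<and> s1 = s(''n'' := (s ''n'')(0 := n))"
    show "wp (Seq (Assign ''r'' (Num 0) (Num 1)) (For ''i'' ''n''
        (Assign ''r'' (Plus (V ''i'') (Num 1)) (Plus (Cell ''r'' (V ''i'')) (V ''n''))))) (n * 3 + 3) s1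
        (\<lambda>s'' out'. out1 @ out' = [] \<and> graph_env G n s'')"
    proof (rule wp_Seq)
      show "wp (Assign ''r'' (Num 0) (Num 1)) 1 s1 (\<lambda>s' out. out = [] \<and> s' = ?s1)"
        by (rule wp_straight) (use s1 in auto)
      fix s2 and out2 :: "nat list"
      assume s2: "out2 = [] \<and> s2 = ?s1"
      let ?Inv = "\<lambda>i s' (out :: nat list). out = [] \<and> (\<forall>j\<le>i. s' ''r'' j = Suc (j * n))"
      have "wp (For ''i'' ''n''
        (Assign ''r'' (Plus (V ''i'') (Num 1)) (Plus (Cell ''r'' (V ''i'')) (V ''n'')))) (n * 3 + 2) s2 (?Inv n)"
      proof (rule wp_For[where T = 1 and N = n and Inv = ?Inv])
        fix i s' and out :: "nat list"
        assume I: "?Inv i s' out" "s' ''i'' 0 = i" and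
          ag: "agree (insert ''i'' (writes (Assign ''r'' (Plus (V ''i'') (Num 1)) (Plus (Cell ''r'' (V ''i'')) (V ''n''))))) s2 s'"
        have "s' ''n'' 0 = n" using agreeD[OF ag, of "''n''"] s2 by simp
        then show "wp (Assign ''r'' (Plus (V ''i'') (Num 1)) (Plus (Cell ''r'' (V ''i'')) (V ''n''))) 1 s'
          (\<lambda>s'' out'. ?Inv (Suc i) s'' (out @ out'))"
          using I by (intro wp_straight) (auto simp: le_Suc_eq)
      qed (use s2 in auto)
      then show "wp (For ''i'' ''n''
        (Assign ''r'' (Plus (V ''i'') (Num 1)) (Plus (Cell ''r'' (V ''i'')) (V ''n'')))) (n * 3 + 2) s2
        (\<lambda>s'' out'. out1 @ out2 @ out' = [] \<and> graph_env G n s'')"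
      proof (rule wp_conseq)
        fix s3 and out3 :: "nat list"
        assume I: "?Inv n s3 out3" and ag: "agree (writes (For ''i'' ''n''
          (Assign ''r'' (Plus (V ''i'') (Num 1)) (Plus (Cell ''r'' (V ''i'')) (V ''n''))))) s2 s3"
        have "s3 ''n'' = s2 ''n''" "s3 ''in'' = s2 ''in''"
          using agreeD[OF ag, of "''n''"] agreeD[OF ag, of "''in''"] by auto
        then have "s3 ''n'' 0 = n" "s3 ''in'' = s ''in''"
          using s2 by auto
        then show "out1 @ out2 @ out3 = [] \<and> graph_env G n s3"
          using I s1 s2 in_uv by (auto simp: graph_env_def)
      qed simp
    qed simp
  qed simp
qed

abbreviation adj_test :: "aexp \<Rightarrow> aexp \<Rightarrow> aexp" where
  "adj_test a b \<equiv> Cell ''in'' (Plus (Cell ''r'' a) b)"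

lemma aval_adj_test:
  "graph_env G n s \<Longrightarrow> aval a s < n \<Longrightarrow> aval b s < n \<Longrightarrow>
   aval (adj_test a b) s = of_bool ({aval a s, aval b s} \<in> edges G)"
  by (simp add: graph_env_def)

definition mark :: com where
  "mark = Seq (For ''v'' ''n'' (Assign ''x'' (V ''v'') (Num 0)))
     (For ''i'' ''L'' (For ''v'' ''n''
       (Cond (adj_test (Cell ''d'' (V ''i'')) (V ''v'')) (Assign ''x'' (V ''v'') (Num 1)) Skip)))"

lemma writes_mark [simp]: "writes mark = {''v'', ''i'', ''x''}"
  by (auto simp: mark_def)

lemma wp_mark:
  assumes G: "graph_env G n s" and L: "s ''L'' 0 = L" and d: "\<And>i. i < L \<Longrightarrow> s ''d'' i < n"
  shows "wp mark (n * 3 + L * (n * 4 + 4) + 4) s (\<lambda>s' out. out = [] \<and>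
    (\<forall>v<n. s' ''x'' v = of_bool (v \<in> nbhd G (s ''d'' ` {..<L}))))"
  unfolding mark_def
proof (rule wp_Seq)
  have n: "s ''n'' 0 = n" using G by (simp add: graph_env_def)
  show "wp (For ''v'' ''n'' (Assign ''x'' (V ''v'') (Num 0))) (n * 3 + 2) s
    (\<lambda>s' (out :: nat list). out = [] \<and> (\<forall>v<n. s' ''x'' v = 0))"
    by (rule wp_For[where T = 1 and N = n and Inv = "\<lambda>i s' (out :: nat list). out = [] \<and> (\<forall>v<i. s' ''x'' v = 0)"])
      (auto simp: n less_Suc_eq intro!: wp_straight)
  fix s1 and out1 :: "nat list"
  assume s1: "out1 = [] \<and> (\<forall>v<n. s1 ''x'' v = 0)"
    and ag1: "agree (writes (For ''v'' ''n'' (Assign ''x'' (V ''v'') (Num 0)))) s s1"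
  let ?b = "Cond (adj_test (Cell ''d'' (V ''i'')) (V ''v'')) (Assign ''x'' (V ''v'') (Num 1)) Skip"
  let ?I = "\<lambda>i s' (out :: nat list). out = [] \<and> (\<forall>v<n. s' ''x'' v = of_bool (\<exists>j<i. {s ''d'' j, v} \<in> edges G))"
  \<comment> \<open>The vertices below \<open>w\<close> have been compared with entry
    \<open>i\<close> of the tuple too, the others only with the entries before it.\<close>
  let ?J = "\<lambda>i w s' (out :: nat list). out = [] \<and>
    (\<forall>v<n. s' ''x'' v = of_bool (\<exists>j<(if v < w then Suc i else i). {s ''d'' j, v} \<in> edges G))"
  have "wp (For ''i'' ''L'' (For ''v'' ''n'' ?b)) (L * (n * 4 + 4) + 2) s1 (?I L)"
  proof (rule wp_For[where T = "n * 4 + 2" and N = L and Inv = ?I])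
    show "s1 ''L'' 0 = L" using agreeD[OF ag1, of "''L''"] L by simp
    fix i s2 and out2 :: "nat list"
    assume I: "?I i s2 out2" and i: "i < L" "s2 ''i'' 0 = i"
      and ag2: "agree (insert ''i'' (writes (For ''v'' ''n'' ?b))) s1 s2"
    have ag02: "agree {''i'', ''v'', ''x''} s s2"
      using ag1 ag2 by (auto simp: agree_def)
    show "wp (For ''v'' ''n'' ?b) (n * 4 + 2) s2 (\<lambda>s'' out'. ?I (Suc i) s'' (out2 @ out'))"
    proof (rule wp_conseq)
      show "wp (For ''v'' ''n'' ?b) (n * 4 + 2) s2 (?J i n)"
      proof (rule wp_For[where T = 2 and N = n and Inv = "?J i"])
        show "s2 ''n'' 0 = n" using agreeD[OF ag02, of "''n''"] n by simp
        fix w s3 and out3 :: "nat list"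
        assume J: "?J i w s3 out3" and w: "w < n" "s3 ''v'' 0 = w"
          and ag3: "agree (insert ''v'' (writes ?b)) s2 s3"
        have ag03: "agree {''i'', ''v'', ''x''} s s3"
          using ag02 ag3 by (auto simp: agree_def)
        have i3: "s3 ''i'' 0 = i" using agreeD[OF ag3, of "''i''"] i by simp
        have d3: "s3 ''d'' = s ''d''" using agreeD[OF ag03, of "''d''"] by simp
        have G3: "graph_env G n s3" by (rule graph_env_agree[OF G ag03]) auto
        have test: "aval (adj_test (Cell ''d'' (V ''i'')) (V ''v'')) s3 = of_bool ({s ''d'' i, w} \<in> edges G)"
          using aval_adj_test[OF G3, of "Cell ''d'' (V ''i'')" "V ''v''"] i3 d3 d i w by simp
        show "wp ?b 2 s3 (\<lambda>s'' out'. ?J i (Suc w) s'' (out3 @ out'))"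
          using J w i3 d3 test by (intro wp_straight) (auto simp: less_Suc_eq)
      qed (use I in auto)
    qed (use I in auto)
  qed (use s1 in \<open>auto simp: algebra_simps\<close>)
  then show "wp (For ''i'' ''L'' (For ''v'' ''n'' ?b)) (L * (n * 4 + 4) + 2) s1
    (\<lambda>s'' out'. out1 @ out' = [] \<and> (\<forall>v<n. s'' ''x'' v = of_bool (v \<in> nbhd G (s ''d'' ` {..<L}))))"
    using s1 by (auto elim!: wp_conseq simp: nbhd_def)
qed simp

text \<open>The shift by one and the closing 0 produce one inner list in the format of
  \<open>blocks\<close>.\<close>

definition emit :: "aexp \<Rightarrow> com" where
  "emit b = Seq (For ''v'' ''n'' (Cond b (Write (Plus (V ''v'') (Num 1))) Skip)) (Write (Num 0))"

lemma writes_emit [simp]: "writes (emit b) = {''v''}"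
  by (simp add: emit_def)

lemma wp_emit:
  assumes n: "s ''n'' 0 = n"
    and test: "\<And>v s'. v < n \<Longrightarrow> agree {''v''} s s' \<Longrightarrow> s' ''v'' 0 = v \<Longrightarrow> aval b s' \<noteq> 0 \<longleftrightarrow> p v"
  shows "wp (emit b) (n * 4 + 3) s (\<lambda>s' out. out = blocks [filter p [0..<n]])"
  unfolding emit_def
proof (rule wp_Seq)
  let ?c = "Cond b (Write (Plus (V ''v'') (Num 1))) Skip"
  show "wp (For ''v'' ''n'' ?c) (n * 4 + 2) s (\<lambda>s' out. out = map Suc (filter p [0..<n]))"
  proof (rule wp_For[where T = 2 and N = n and Inv = "\<lambda>i s' out. out = map Suc (filter p [0..<i])"])
    fix i s' out
    assume "out = map Suc (filter p [0..<i])" "i < n" "s' ''v'' 0 = i"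
      "agree (insert ''v'' (writes ?c)) s s'"
    then show "wp ?c 2 s' (\<lambda>s'' out'. out @ out' = map Suc (filter p [0..<Suc i]))"
      using test[of i s'] by (intro wp_straight) auto
  qed (use n in auto)
  fix s' out assume "out = map Suc (filter p [0..<n])"
  then show "wp (Write (Num 0)) 1 s' (\<lambda>s'' out'. out @ out' = blocks [filter p [0..<n]])"
    by (intro wp_straight) (auto simp: blocks_def)
qed simp

text \<open>Components are found as in the quick-find algorithm: for each edge outside the marked set \<open>x\<close>
  all vertices with the label of one end get the label of the other.  Equal labels stay equal, so one
  pass over the edges suffices.\<close>

definition relabel :: com where
  "relabel = Seq (Seq (Set ''a'' (Cell ''l'' (V ''u''))) (Set ''b'' (Cell ''l'' (V ''w''))))
     (For ''v'' ''n'' (Cond (Minus (Num 1) (Plus (Minus (Cell ''l'' (V ''v'')) (V ''a''))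
                                              (Minus (V ''a'') (Cell ''l'' (V ''v'')))))
       (Assign ''l'' (V ''v'') (V ''b'')) Skip))"

lemma writes_relabel [simp]: "writes relabel = {''a'', ''b'', ''v'', ''l''}"
  by (auto simp: relabel_def)

text \<open>Both labels are copied before the loop, since it overwrites the label of
  \<open>u\<close> itself. Equality is tested by adding the two truncated differences.\<close>

lemma wp_relabel:
  assumes n: "s ''n'' 0 = n" and uw: "s ''u'' 0 = u" "s ''w'' 0 = w"
  shows "wp relabel (n * 4 + 4) s (\<lambda>s' out. out = [] \<and>
    (\<forall>v<n. s' ''l'' v = (if s ''l'' v = s ''l'' u then s ''l'' w else s ''l'' v)))"
  unfolding relabel_def
proof (rule wp_Seq)
  let ?c = "Seq (Set ''a'' (Cell ''l'' (V ''u''))) (Set ''b'' (Cell ''l'' (V ''w'')))"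
  show "wp ?c 2 s (\<lambda>s' (out :: nat list). out = [] \<and> s' ''a'' 0 = s ''l'' u \<and> s' ''b'' 0 = s ''l'' w)"
    by (rule wp_straight) (use uw in auto)
  fix s1 and out1 :: "nat list"
  assume s1: "out1 = [] \<and> s1 ''a'' 0 = s ''l'' u \<and> s1 ''b'' 0 = s ''l'' w"
    and ag1: "agree (writes ?c) s s1"
  have l1: "s1 ''l'' = s ''l''" "s1 ''n'' 0 = n"
    using agreeD[OF ag1, of "''l''"] agreeD[OF ag1, of "''n''"] n by auto
  let ?b = "Cond (Minus (Num 1) (Plus (Minus (Cell ''l'' (V ''v'')) (V ''a''))
                                              (Minus (V ''a'') (Cell ''l'' (V ''v'')))))
       (Assign ''l'' (V ''v'') (V ''b'')) Skip"
  let ?I = "\<lambda>i s' (out :: nat list). out = [] \<and>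
    (\<forall>v<n. s' ''l'' v = (if v < i \<and> s ''l'' v = s ''l'' u then s ''l'' w else s ''l'' v))"
  have "wp (For ''v'' ''n'' ?b) (n * 4 + 2) s1 (?I n)"
  proof (rule wp_For[where T = 2 and N = n and Inv = ?I])
    fix i s2 and out2 :: "nat list"
    assume I: "?I i s2 out2" and i: "i < n" "s2 ''v'' 0 = i" and ag2: "agree (insert ''v'' (writes ?b)) s1 s2"
    have "s2 ''a'' 0 = s ''l'' u" "s2 ''b'' 0 = s ''l'' w"
      using agreeD[OF ag2, of "''a''"] agreeD[OF ag2, of "''b''"] s1 by auto
    then show "wp ?b 2 s2 (\<lambda>s'' out'. ?I (Suc i) s'' (out2 @ out'))"
      using I i by (intro wp_straight) (auto simp: less_Suc_eq)
  qed (use l1 in auto)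
  then show "wp (For ''v'' ''n'' ?b) (n * 4 + 2) s1 (\<lambda>s'' out'. out1 @ out' = [] \<and>
    (\<forall>v<n. s'' ''l'' v = (if s ''l'' v = s ''l'' u then s ''l'' w else s ''l'' v)))"
    using s1 by (auto elim!: wp_conseq)
qed simp

text \<open>A label is a vertex of the component it labels, which keeps each class within one
  component and yields the size bound. \<open>A\<close> is the set of pairs processed so far; once
  it contains all pairs, no surviving edge joins two classes, as the decomposition requires.\<close>

definition labelling :: "nat graph \<Rightarrow> nat set \<Rightarrow> nat \<Rightarrow> (nat \<times> nat) set \<Rightarrow> (nat \<Rightarrow> nat) \<Rightarrow> bool" where
  "labelling G X n A f \<longleftrightarrow>
     (\<forall>u<n. u \<notin> X \<longrightarrow> f u \<in> component_of (del_verts G X) u) \<and>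
     (\<forall>(u, w)\<in>A. u < n \<and> w < n \<and> u \<notin> X \<and> w \<notin> X \<and> {u, w} \<in> edges G \<longrightarrow> f u = f w)"

lemma component_of_sym: "u \<in> component_of G v \<Longrightarrow> v \<in> verts G \<Longrightarrow> v \<in> component_of G u"
proof -
  assume "u \<in> component_of G v" "v \<in> verts G"
  moreover have "sym {(x, y). {x, y} \<in> edges G}" by (auto simp: sym_def insert_commute)
  ultimately show ?thesis unfolding component_of_def by (auto dest: symD[OF sym_rtrancl])
qed

lemma component_of_trans:
  "u \<in> component_of G v \<Longrightarrow> w \<in> component_of G u \<Longrightarrow> w \<in> component_of G v"
  unfolding component_of_def by (auto intro: rtrancl_trans)

text \<open>A relabelled vertex shares its old label with \<open>u\<close>, and \<open>u\<close>
  reaches the label of \<open>w\<close> across the edge. Equal labels stay equal because the new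
  label is a function of the old one.\<close>

lemma labelling_relabel:
  assumes f: "labelling G X n A f" and V: "verts G = {..<n}"
    and uw: "u < n" "w < n" "u \<notin> X" "w \<notin> X" "{u, w} \<in> edges G"
    and g: "\<And>v. v < n \<Longrightarrow> g v = (if f v = f u then f w else f v)"
  shows "labelling G X n (insert (u, w) A) g"
proof -
  let ?H = "del_verts G X"
  have VH: "v \<in> verts ?H" if "v < n" "v \<notin> X" for v
    using that V by (simp add: verts_del_verts)
  have reach: "f v \<in> component_of ?H v" if "v < n" "v \<notin> X" for v
    using f that by (simp add: labelling_def)
  have "w \<in> component_of ?H u"
    using uw V by (auto simp: component_of_def verts_del_verts edges_del_verts)
  then have fw: "f w \<in> component_of ?H u"
    using component_of_trans[OF _ reach[OF uw(2,4)]] by blast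
  have "g v \<in> component_of ?H v" if v: "v < n" "v \<notin> X" for v
  proof (cases "f v = f u")
    case True
    have fu: "f u \<in> component_of ?H u" using reach[OF uw(1,3)] .
    then have "u \<in> component_of ?H (f u)" by (rule component_of_sym[OF _ VH[OF uw(1,3)]])
    moreover have "f u \<in> component_of ?H v" using reach[OF v] True by simp
    ultimately have "f w \<in> component_of ?H v" by (rule component_of_trans[OF component_of_trans[rotated] fw])
    then show ?thesis using g v True by simp
  next
    case False
    then show ?thesis using g reach v by simp
  qed
  moreover have "g u = g w" using g uw by simp
  moreover have "g x = g y" if "(x, y) \<in> A" "x < n" "y < n" "x \<notin> X" "y \<notin> X" "{x, y} \<in> edges G" for x y
  proof -
    have "f x = f y" using f that by (auto simp: labelling_def)
    then show ?thesis using g that by simp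
  qed
  ultimately show ?thesis unfolding labelling_def by blast
qed

lemma labelling_skip:
  assumes "labelling G X n A f" "\<not> (u \<notin> X \<and> w \<notin> X \<and> {u, w} \<in> edges G)"
  shows "labelling G X n (insert (u, w) A) f"
  using assms unfolding labelling_def by blast

definition label_components :: com where
  "label_components = Seq (For ''v'' ''n'' (Assign ''l'' (V ''v'') (V ''v'')))
     (For ''u'' ''n'' (For ''w'' ''n''
       (Cond (Minus (adj_test (V ''u'') (V ''w'')) (Plus (Cell ''x'' (V ''u'')) (Cell ''x'' (V ''w''))))
         relabel Skip)))"

lemma writes_label_components [simp]:
  "writes label_components = {''v'', ''l'', ''u'', ''w'', ''a'', ''b''}"
  by (auto simp: label_components_def)

lemma wp_label_components:
  assumes G: "graph_env G n s" and V: "verts G = {..<n}"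
    and X: "\<And>v. v < n \<Longrightarrow> s ''x'' v = of_bool (v \<in> X)"
  shows "wp label_components (n * 3 + n * (n * (n * 4 + 7) + 4) + 4) s
    (\<lambda>s' out. out = [] \<and> labelling G X n ({..<n} \<times> {..<n}) (s' ''l''))"
  unfolding label_components_def
proof (rule wp_Seq)
  have n: "s ''n'' 0 = n" using G by (simp add: graph_env_def)
  let ?init = "For ''v'' ''n'' (Assign ''l'' (V ''v'') (V ''v''))"
  show "wp ?init (n * 3 + 2) s (\<lambda>s' (out :: nat list). out = [] \<and> (\<forall>v<n. s' ''l'' v = v))"
    by (rule wp_For[where T = 1 and N = n and Inv = "\<lambda>i s' (out :: nat list). out = [] \<and> (\<forall>v<i. s' ''l'' v = v)"])
      (auto simp: n less_Suc_eq intro!: wp_straight)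
  fix s1 and out1 :: "nat list"
  assume s1: "out1 = [] \<and> (\<forall>v<n. s1 ''l'' v = v)" and ag1: "agree (writes ?init) s s1"
  have lab0: "labelling G X n {} (s1 ''l'')"
    using s1 V by (auto simp: labelling_def component_of_refl verts_del_verts)
  let ?b = "Cond (Minus (adj_test (V ''u'') (V ''w'')) (Plus (Cell ''x'' (V ''u'')) (Cell ''x'' (V ''w''))))
         relabel Skip"
  let ?Z = "{''v'', ''l'', ''u'', ''w'', ''a'', ''b''}"
  let ?I = "\<lambda>i s' (out :: nat list). out = [] \<and> labelling G X n ({..<i} \<times> {..<n}) (s' ''l'')"
  let ?J = "\<lambda>i w s' (out :: nat list). out = [] \<and>
    labelling G X n ({..<i} \<times> {..<n} \<union> {i} \<times> {..<w}) (s' ''l'')"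
  have "wp (For ''u'' ''n'' (For ''w'' ''n'' ?b)) (n * (n * (n * 4 + 7) + 4) + 2) s1 (?I n)"
  proof (rule wp_For[where T = "n * (n * 4 + 7) + 2" and N = n and Inv = ?I])
    show "s1 ''n'' 0 = n" using agreeD[OF ag1, of "''n''"] n by simp
    fix i s2 and out2 :: "nat list"
    assume I: "?I i s2 out2" and i: "i < n" "s2 ''u'' 0 = i"
      and ag2: "agree (insert ''u'' (writes (For ''w'' ''n'' ?b))) s1 s2"
    have ag02: "agree ?Z s s2" using ag1 ag2 by (auto simp: agree_def)
    have row: "{..<Suc i} \<times> {..<n} = {..<i} \<times> {..<n} \<union> {i} \<times> {..<n}" by auto
    show "wp (For ''w'' ''n'' ?b) (n * (n * 4 + 7) + 2) s2 (\<lambda>s'' out'. ?I (Suc i) s'' (out2 @ out'))"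
    proof (rule wp_conseq)
      show "wp (For ''w'' ''n'' ?b) (n * (n * 4 + 7) + 2) s2 (?J i n)"
      proof (rule wp_For[where T = "n * 4 + 5" and N = n and Inv = "?J i"])
        show "s2 ''n'' 0 = n" using agreeD[OF ag02, of "''n''"] n by simp
        fix j s3 and out3 :: "nat list"
        assume J: "?J i j s3 out3" and j: "j < n" "s3 ''w'' 0 = j"
          and ag3: "agree (insert ''w'' (writes ?b)) s2 s3"
        have ag03: "agree ?Z s s3" using ag02 ag3 by (auto simp: agree_def)
        have u3: "s3 ''u'' 0 = i" using agreeD[OF ag3, of "''u''"] i by simp
        have n3: "s3 ''n'' 0 = n" using agreeD[OF ag03, of "''n''"] n by simp
        have G3: "graph_env G n s3" by (rule graph_env_agree[OF G ag03]) auto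
        have x3: "s3 ''x'' v = of_bool (v \<in> X)" if "v < n" for v
          using agreeD[OF ag03, of "''x''"] X[OF that] by simp
        let ?t = "Minus (adj_test (V ''u'') (V ''w'')) (Plus (Cell ''x'' (V ''u'')) (Cell ''x'' (V ''w'')))"
        \<comment> \<open>All entries are 0 or 1, so truncated subtraction of the two marks leaves 1
          only for an edge with both ends unmarked.\<close>
        have test: "aval ?t s3 \<noteq> 0 \<longleftrightarrow> i \<notin> X \<and> j \<notin> X \<and> {i, j} \<in> edges G"
          using aval_adj_test[OF G3, of "V ''u''" "V ''w''"] u3 j i x3[OF i(1)] x3[OF j(1)] by auto
        have set_eq: "{..<i} \<times> {..<n} \<union> {i} \<times> {..<Suc j} = insert (i, j) ({..<i} \<times> {..<n} \<union> {i} \<times> {..<j})"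
          by auto
        show "wp ?b (n * 4 + 5) s3 (\<lambda>s'' out'. ?J i (Suc j) s'' (out3 @ out'))"
        proof (rule wp_Cond)
          assume "aval ?t s3 \<noteq> 0"
          then have e: "i \<notin> X" "j \<notin> X" "{i, j} \<in> edges G" using test by auto
          show "wp relabel (n * 4 + 4) s3 (\<lambda>s'' out'. ?J i (Suc j) s'' (out3 @ out'))"
          proof (rule wp_conseq[OF wp_relabel[of s3 n i j, OF n3 u3 j(2)]])
            fix s4 and out4 :: "nat list"
            assume "out4 = [] \<and>
              (\<forall>v<n. s4 ''l'' v = (if s3 ''l'' v = s3 ''l'' i then s3 ''l'' j else s3 ''l'' v))"
            then show "?J i (Suc j) s4 (out3 @ out4)"
              unfolding set_eq using J labelling_relabel[OF _ V i(1) j(1) e, of _ "s3 ''l''" "s4 ''l''"]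
              by simp
          qed simp
        next
          assume "aval ?t s3 = 0"
          then have "\<not> (i \<notin> X \<and> j \<notin> X \<and> {i, j} \<in> edges G)" using test by blast
          then show "wp Skip (n * 4 + 4) s3 (\<lambda>s'' out'. ?J i (Suc j) s'' (out3 @ out'))"
            unfolding set_eq using J labelling_skip by (intro wp_straight) auto
        qed simp
      qed (use I in auto)
    qed (auto simp: I row)
  qed (use s1 lab0 in \<open>auto simp: algebra_simps\<close>)
  then show "wp (For ''u'' ''n'' (For ''w'' ''n'' ?b)) (n * (n * (n * 4 + 7) + 4) + 2) s1
    (\<lambda>s'' out'. out1 @ out' = [] \<and> labelling G X n ({..<n} \<times> {..<n}) (s'' ''l''))"
    using s1 by (auto elim!: wp_conseq)
qed simp

abbreviation in_class :: aexp where
  "in_class \<equiv> Minus (Num 1) (Plus (Cell ''x'' (V ''v''))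
     (Plus (Minus (Cell ''l'' (V ''v'')) (V ''u'')) (Minus (V ''u'') (Cell ''l'' (V ''v'')))))"

lemma aval_in_class:
  "aval in_class s \<noteq> 0 \<longleftrightarrow> s ''x'' (s ''v'' 0) = 0 \<and> s ''l'' (s ''v'' 0) = s ''u'' 0"
  by auto

text \<open>Labels are themselves vertices, so letting \<open>u\<close> run through the vertices
  meets every class.\<close>

definition check_balance :: com where
  "check_balance = Seq (Set ''o'' (Num 1)) (For ''u'' ''n''
     (Seq (Set ''a'' (Num 0))
       (Seq (For ''v'' ''n'' (Cond in_class (Set ''a'' (Plus (V ''a'') (Num 1))) Skip))
         (Cond (Minus (Plus (V ''a'') (V ''a'')) (V ''n'')) (Set ''o'' (Num 0)) Skip))))"

lemma writes_check_balance [simp]: "writes check_balance = {''o'', ''u'', ''a'', ''v''}"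
  by (auto simp: check_balance_def)

lemma wp_check_balance:
  assumes n: "s ''n'' 0 = n"
  defines "K \<equiv> \<lambda>u. {v. v < n \<and> s ''x'' v = 0 \<and> s ''l'' v = u}"
  shows "wp check_balance (n * (n * 4 + 7) + 3) s (\<lambda>s' out. out = [] \<and>
    s' ''o'' 0 = of_bool (\<forall>u<n. 2 * card (K u) \<le> n))"
  unfolding check_balance_def
proof (rule wp_Seq)
  show "wp (Set ''o'' (Num 1)) 1 s (\<lambda>s' (out :: nat list). out = [] \<and> s' ''o'' 0 = 1)"
    by (rule wp_straight) auto
  fix s1 and out1 :: "nat list"
  assume s1: "out1 = [] \<and> s1 ''o'' 0 = 1" and ag1: "agree (writes (Set ''o'' (Num 1))) s s1"
  let ?count = "For ''v'' ''n'' (Cond in_class (Set ''a'' (Plus (V ''a'') (Num 1))) Skip)"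
  let ?cmp = "Cond (Minus (Plus (V ''a'') (V ''a'')) (V ''n'')) (Set ''o'' (Num 0)) Skip"
  let ?b = "Seq (Set ''a'' (Num 0)) (Seq ?count ?cmp)"
  let ?Z = "{''o'', ''u'', ''a'', ''v''}"
  let ?I = "\<lambda>i s' (out :: nat list). out = [] \<and> s' ''o'' 0 = of_bool (\<forall>u<i. 2 * card (K u) \<le> n)"
  let ?K = "\<lambda>u j. {v. v < j \<and> s ''x'' v = 0 \<and> s ''l'' v = u}"
  have "wp (For ''u'' ''n'' ?b) (n * (n * 4 + 7) + 2) s1 (?I n)"
  proof (rule wp_For[where T = "n * 4 + 5" and N = n and Inv = ?I])
    show "s1 ''n'' 0 = n" using agreeD[OF ag1, of "''n''"] n by simp
    fix i s2 and out2 :: "nat list"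
    assume I: "?I i s2 out2" and i: "i < n" "s2 ''u'' 0 = i" and ag2: "agree (insert ''u'' (writes ?b)) s1 s2"
    have ag02: "agree ?Z s s2" using ag1 ag2 by (auto simp: agree_def)
    show "wp ?b (n * 4 + 5) s2 (\<lambda>s'' out'. ?I (Suc i) s'' (out2 @ out'))"
    proof (rule wp_Seq)
      show "wp (Set ''a'' (Num 0)) 1 s2 (\<lambda>s' (out :: nat list). out = [] \<and> s' ''a'' 0 = 0)"
        by (rule wp_straight) auto
      fix s3 and out3 :: "nat list"
      assume s3: "out3 = [] \<and> s3 ''a'' 0 = 0" and ag3: "agree (writes (Set ''a'' (Num 0))) s2 s3"
      have ag03: "agree ?Z s s3" using ag02 ag3 by (auto simp: agree_def)
      show "wp (Seq ?count ?cmp) (n * 4 + 4) s3 (\<lambda>s'' out'. ?I (Suc i) s'' (out2 @ out3 @ out'))"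
      proof (rule wp_Seq)
        show "wp ?count (n * 4 + 2) s3 (\<lambda>s' (out :: nat list). out = [] \<and> s' ''a'' 0 = card (?K i n))"
        proof (rule wp_For[where T = 2 and N = n
              and Inv = "\<lambda>j s' (out :: nat list). out = [] \<and> s' ''a'' 0 = card (?K i j)"])
          show "s3 ''n'' 0 = n" using agreeD[OF ag03, of "''n''"] n by simp
          fix j s4 and out4 :: "nat list"
          assume J: "out4 = [] \<and> s4 ''a'' 0 = card (?K i j)" and j: "j < n" "s4 ''v'' 0 = j"
            and ag4: "agree (insert ''v'' (writes (Cond in_class (Set ''a'' (Plus (V ''a'') (Num 1))) Skip))) s3 s4"
          have ag24: "agree {''a'', ''v''} s2 s4" using ag3 ag4 by (auto simp: agree_def)
          have ag04: "agree ?Z s s4" using ag03 ag4 by (auto simp: agree_def)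
          have u4: "s4 ''u'' 0 = i" using agreeD[OF ag24, of "''u''"] i by simp
          have eq: "s4 ''x'' = s ''x''" "s4 ''l'' = s ''l''"
            using agreeD[OF ag04, of "''x''"] agreeD[OF ag04, of "''l''"] by auto
          have "?K i (Suc j) = (if s ''x'' j = 0 \<and> s ''l'' j = i then insert j (?K i j) else ?K i j)"
            by (auto simp: less_Suc_eq)
          then have card: "card (?K i (Suc j)) = card (?K i j) + of_bool (s ''x'' j = 0 \<and> s ''l'' j = i)"
            by (auto simp: card_insert_if)
          show "wp (Cond in_class (Set ''a'' (Plus (V ''a'') (Num 1))) Skip) 2 s4
            (\<lambda>s' out'. out4 @ out' = [] \<and> s' ''a'' 0 = card (?K i (Suc j)))"
            using aval_in_class[of s4] J j u4 eq card by (intro wp_straight) (auto simp del: aval.simps(4))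
        qed (use s3 in auto)
        fix s4 and out4 :: "nat list"
        assume s4: "out4 = [] \<and> s4 ''a'' 0 = card (?K i n)" and ag4: "agree (writes ?count) s3 s4"
        have ag24: "agree {''a'', ''v''} s2 s4" using ag3 ag4 by (auto simp: agree_def)
        have ag04: "agree ?Z s s4" using ag03 ag4 by (auto simp: agree_def)
        have "s4 ''o'' 0 = s2 ''o'' 0" "s4 ''n'' 0 = n"
          using agreeD[OF ag24, of "''o''"] agreeD[OF ag04, of "''n''"] n by auto
        then show "wp ?cmp 2 s4 (\<lambda>s'' out'. ?I (Suc i) s'' (out2 @ out3 @ out4 @ out'))"
          using I s3 s4 by (intro wp_straight) (auto simp: less_Suc_eq K_def)
      qed simp
    qed simp
  qed (use s1 in auto)
  then show "wp (For ''u'' ''n'' ?b) (n * (n * 4 + 7) + 2) s1 (\<lambda>s'' out'. out1 @ out' = [] \<and>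
    s'' ''o'' 0 = of_bool (\<forall>u<n. 2 * card (K u) \<le> n))"
    using s1 by (auto elim!: wp_conseq)
qed simp

section \<open>Tuples as digit sequences, and the length of outputs\<close>

definition tuple_set :: "nat \<Rightarrow> nat \<Rightarrow> nat \<Rightarrow> nat set" where
  "tuple_set n L k = (\<lambda>i. k div n ^ i mod n) ` {..<L}"

lemma tuple_set_surj:
  assumes "length xs = L" "set xs \<subseteq> {..<n}"
  shows "\<exists>k<n ^ L. tuple_set n L k = set xs"
proof -
  obtain k where k: "k < n ^ L" "\<And>i. i < L \<Longrightarrow> k div n ^ i mod n = xs ! i"
    using exists_code_of_digits[of L "\<lambda>i. xs ! i" n] assms nth_mem by (metis lessThan_iff subsetD)
  have "tuple_set n L k = (\<lambda>i. xs ! i) ` {..<L}"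
    unfolding tuple_set_def using k(2) by auto
  also have "\<dots> = set xs" using assms(1) by (auto simp: set_conv_nth)
  finally show ?thesis using k(1) by blast
qed

lemma blocks_append: "blocks (xs @ ys) = blocks xs @ blocks ys"
  by (simp add: blocks_def)

text \<open>Each inner list contributes its closing 0, whence the size of a family is bounded by the
  length of its code.\<close>

lemma length_le_length_blocks: "length xss \<le> length (blocks xss)"
  by (induction xss) (auto simp: blocks_def)

section \<open>Strong QP-dispersibility\<close>

text \<open>\<open>p\<close> doubles until it exceeds \<open>n\<close>, which takes
  \<open>floorlog 2 n\<close> rounds; adding \<open>M\<close> in each round forms the product
  without multiplication.\<close>

definition set_tuple_length :: "nat \<Rightarrow> nat \<Rightarrow> com" where
  "set_tuple_length t M = Seq (Seq (Set ''p'' (Num 1)) (Set ''L'' (Num t)))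
     (While (Minus (Plus (V ''n'') (Num 1)) (V ''p''))
       (Seq (Set ''p'' (Plus (V ''p'') (V ''p''))) (Set ''L'' (Plus (V ''L'') (Num M)))))"

lemma writes_set_tuple_length [simp]: "writes (set_tuple_length t M) = {''p'', ''L''}"
  by (auto simp: set_tuple_length_def)

lemma wp_set_tuple_length:
  assumes n: "s ''n'' 0 = n"
  shows "wp (set_tuple_length t M) (floorlog 2 n * 3 + 3) s
    (\<lambda>s' out. out = [] \<and> s' ''L'' 0 = t + M * floorlog 2 n)"
  unfolding set_tuple_length_def
proof (rule wp_Seq)
  let ?c = "Seq (Set ''p'' (Num 1)) (Set ''L'' (Num t))"
  show "wp ?c 2 s (\<lambda>s' (out :: nat list). out = [] \<and> s' ''p'' 0 = 1 \<and> s' ''L'' 0 = t)"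
    by (rule wp_straight) auto
  fix s1 and out1 :: "nat list"
  assume s1: "out1 = [] \<and> s1 ''p'' 0 = 1 \<and> s1 ''L'' 0 = t" and ag1: "agree (writes ?c) s s1"
  have n1: "s1 ''n'' 0 = n" using agreeD[OF ag1, of "''n''"] n by simp
  let ?b = "Seq (Set ''p'' (Plus (V ''p'') (V ''p''))) (Set ''L'' (Plus (V ''L'') (Num M)))"
  let ?I = "\<lambda>j (s' :: store) (out :: nat list). out = [] \<and> s' ''p'' 0 = 2 ^ j \<and> s' ''L'' 0 = t + M * j \<and> s' ''n'' 0 = n"
  have "wp (While (Minus (Plus (V ''n'') (Num 1)) (V ''p'')) ?b) (floorlog 2 n * (2 + 1) + 1) s1 (?I (floorlog 2 n))"
  proof (rule wp_While[where Inv = ?I])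
    fix j s' and out :: "nat list"
    assume I: "?I j s' out"
    have "floorlog 2 n \<le> j \<longleftrightarrow> n < 2 ^ j" by (simp add: floorlog_le_iff)
    then show "aval (Minus (Plus (V ''n'') (Num 1)) (V ''p'')) s' \<noteq> 0 \<longleftrightarrow> j < floorlog 2 n"
      using I by (auto simp: not_le)
  next
    fix j s' and out :: "nat list"
    assume "?I j s' out"
    then show "wp ?b 2 s' (\<lambda>s'' out'. ?I (Suc j) s'' (out @ out'))"
      by (intro wp_straight) auto
  qed (use s1 n1 in auto)
  then show "wp (While (Minus (Plus (V ''n'') (Num 1)) (V ''p'')) ?b) (floorlog 2 n * 3 + 1) s1
    (\<lambda>s'' out'. out1 @ out' = [] \<and> s'' ''L'' 0 = t + M * floorlog 2 n)"
    using s1 by (auto elim!: wp_conseq)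
qed simp

text \<open>Counting in base \<open>n\<close> presupposes \<open>n > 0\<close>. On the empty graph
  no set has positive weight, and the empty family is a disperser.\<close>

definition disperser_program :: "nat \<Rightarrow> nat \<Rightarrow> com" where
  "disperser_program t M = Seq load_graph (Seq (set_tuple_length t M)
     (Cond (V ''n'') (enumerate (Seq mark (emit (Cell ''x'' (V ''v''))))) Skip))"

definition nbhd_family :: "nat graph \<Rightarrow> nat \<Rightarrow> nat \<Rightarrow> nat list list" where
  "nbhd_family G n L = map (\<lambda>k. filter (\<lambda>v. v \<in> nbhd G (tuple_set n L k)) [0..<n]) [0..<n ^ L]"

text \<open>Each tuple costs its marking and writing, plus \<open>L * 6 + 4\<close> for the
  increment and the loop test. The summands outside the product are for loading the graph, computing
  \<open>L\<close> and the guard.\<close>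

definition disperser_time :: "nat \<Rightarrow> nat \<Rightarrow> nat \<Rightarrow> nat" where
  "disperser_time n l L = n ^ L * (n * 7 + L * (n * 4 + 4) + 7 + L * 6 + 4) + n * 3 + l * 3 + 9"

lemma wp_disperser_program:
  fixes t M n :: nat
  assumes V: "verts G = {..<n}"
  defines "L \<equiv> t + M * floorlog 2 n"
  shows "wp (disperser_program t M) (disperser_time n (floorlog 2 n) L) (init_store (graph_code G @ ws))
    (\<lambda>s' out. out = blocks (if n = 0 then [] else nbhd_family G n L))"
  unfolding disperser_program_def
proof (rule wp_Seq)
  let ?s = "init_store (graph_code G @ ws)"
  show "wp load_graph (n * 3 + 4) ?s (\<lambda>s' out. out = [] \<and> graph_env G n s')"
    by (rule wp_load_graph[OF V refl])
  fix s1 and out1 :: "nat list"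
  assume s1: "out1 = [] \<and> graph_env G n s1" and ag1: "agree (writes load_graph) ?s s1"
  have n1: "s1 ''n'' 0 = n" using s1 by (simp add: graph_env_def)
  let ?b = "Seq mark (emit (Cell ''x'' (V ''v'')))"
  let ?U = "n ^ L * (n * 7 + L * (n * 4 + 4) + 7 + L * 6 + 4) + 1"
  show "wp (Seq (set_tuple_length t M) (Cond (V ''n'') (enumerate ?b) Skip)) (floorlog 2 n * 3 + 3 + Suc ?U) s1
    (\<lambda>s'' out'. out1 @ out' = blocks (if n = 0 then [] else nbhd_family G n L))"
  proof (rule wp_Seq)
    show "wp (set_tuple_length t M) (floorlog 2 n * 3 + 3) s1 (\<lambda>s' out. out = [] \<and> s' ''L'' 0 = L)"
      unfolding L_def by (rule wp_set_tuple_length[of s1 n, OF n1])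
    fix s2 and out2 :: "nat list"
    assume s2: "out2 = [] \<and> s2 ''L'' 0 = L" and ag2: "agree (writes (set_tuple_length t M)) s1 s2"
    have G2: "graph_env G n s2" using s1 by (auto intro: graph_env_agree[OF _ ag2])
    have n2: "s2 ''n'' 0 = n" using G2 by (simp add: graph_env_def)
    have zero: "s2 ''c'' = (\<lambda>_. 0)" "s2 ''d'' = (\<lambda>_. 0)"
      using agreeD[OF ag1, of "''c''"] agreeD[OF ag2, of "''c''"]
        agreeD[OF ag1, of "''d''"] agreeD[OF ag2, of "''d''"] by (auto simp: init_store_def)
    show "wp (Cond (V ''n'') (enumerate ?b) Skip) (Suc ?U) s2
      (\<lambda>s'' out'. out1 @ out2 @ out' = blocks (if n = 0 then [] else nbhd_family G n L))"
    proof (rule wp_Cond)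
      assume "aval (V ''n'') s2 \<noteq> 0"
      then have npos: "n > 0" using n2 by simp
      let ?f = "\<lambda>k. filter (\<lambda>v. v \<in> nbhd G (tuple_set n L k)) [0..<n]"
      let ?I = "\<lambda>k (s' :: store) out. out = blocks (map ?f [0..<k])"
      let ?T = "n * 7 + L * (n * 4 + 4) + 7"
      have "wp (enumerate ?b) (n ^ L * (?T + L * 6 + 4) + 1) s2 (?I (n ^ L))"
      proof (rule wp_enumerate[where Inv = ?I])
        fix k s3 out3
        assume I: "?I k s3 out3" and k: "k < n ^ L"
          and dig: "\<forall>i<L. s3 ''d'' i = k div n ^ i mod n"
          and ag3: "agree (writes ?b \<union> {''c'', ''i'', ''d''}) s2 s3"
        have G3: "graph_env G n s3" by (rule graph_env_agree[OF G2 ag3]) auto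
        have L3: "s3 ''L'' 0 = L" using agreeD[OF ag3, of "''L''"] s2 by simp
        have tuple: "s3 ''d'' ` {..<L} = tuple_set n L k" using dig by (auto simp: tuple_set_def)
        show "wp ?b ?T s3 (\<lambda>s'' out'. ?I (Suc k) s'' (out3 @ out'))"
        proof (rule wp_Seq)
          show "wp mark (n * 3 + L * (n * 4 + 4) + 4) s3 (\<lambda>s' out. out = [] \<and>
            (\<forall>v<n. s' ''x'' v = of_bool (v \<in> nbhd G (tuple_set n L k))))"
            using wp_mark[OF G3 L3] dig npos unfolding tuple by simp
          fix s4 and out4 :: "nat list"
          assume s4: "out4 = [] \<and> (\<forall>v<n. s4 ''x'' v = of_bool (v \<in> nbhd G (tuple_set n L k)))"
            and ag4: "agree (writes mark) s3 s4"
          have n4: "s4 ''n'' 0 = n" using agreeD[OF ag4, of "''n''"] G3 by (simp add: graph_env_def)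
          have "wp (emit (Cell ''x'' (V ''v''))) (n * 4 + 3) s4 (\<lambda>s' out. out = blocks [?f k])"
          proof (rule wp_emit[of s4 n, OF n4])
            fix v s'
            assume v: "v < n" "s' ''v'' 0 = v" and ag: "agree {''v''} s4 s'"
            have "s' ''x'' = s4 ''x''" using agreeD[OF ag, of "''x''"] by simp
            then show "aval (Cell ''x'' (V ''v'')) s' \<noteq> 0 \<longleftrightarrow> v \<in> nbhd G (tuple_set n L k)"
              using v s4 by simp
          qed
          then show "wp (emit (Cell ''x'' (V ''v''))) (n * 4 + 3) s4
            (\<lambda>s'' out'. ?I (Suc k) s'' (out3 @ out4 @ out'))"
            using I s4 by (auto elim!: wp_conseq simp: blocks_append)
        qed simp
      qed (use npos n2 s2 zero in \<open>auto simp: blocks_def\<close>)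
      then show "wp (enumerate ?b) ?U s2
        (\<lambda>s'' out'. out1 @ out2 @ out' = blocks (if n = 0 then [] else nbhd_family G n L))"
        using s1 s2 npos by (auto elim!: wp_conseq simp: nbhd_family_def)
    next
      assume "aval (V ''n'') s2 = 0"
      then show "wp Skip ?U s2
        (\<lambda>s'' out'. out1 @ out2 @ out' = blocks (if n = 0 then [] else nbhd_family G n L))"
        using s1 s2 n2 by (intro wp_straight) (auto simp: blocks_def)
    qed simp
  qed simp
qed (simp add: disperser_time_def)

text \<open>Apart from n^L \<le> 2^(lL), all factors are crudely bounded by 20 (n + 1) (L + 1). The
  6 in the exponent absorbs the 20.\<close>

lemma disperser_time_le:
  assumes "n < 2 ^ l" "l \<le> n"
  shows "disperser_time n l L \<le> 2 ^ (6 + l + L + l * L)"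
proof -
  have n1: "n + 1 \<le> 2 ^ l" using assms(1) by simp
  have L1: "L + 1 \<le> 2 ^ L" using less_exp[of L] by (simp add: Suc_le_eq)
  have "n ^ L \<le> (2 ^ l) ^ L" using assms(1) by (intro power_mono) auto
  then have nL: "n ^ L \<le> 2 ^ (l * L)" by (simp add: power_mult)
  have "n * 7 + L * (n * 4 + 4) + 7 + L * 6 + 4 \<le> 11 * ((n + 1) * (L + 1))"
    by (simp add: algebra_simps)
  then have "n ^ L * (n * 7 + L * (n * 4 + 4) + 7 + L * 6 + 4) \<le> 2 ^ (l * L) * (11 * ((n + 1) * (L + 1)))"
    by (intro mult_mono nL) auto
  moreover have "n * 3 + l * 3 + 9 \<le> 9 * (n + 1)" using assms(2) by simp
  then have "n * 3 + l * 3 + 9 \<le> 2 ^ (l * L) * (9 * ((n + 1) * (L + 1)))"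
    using mult_mono[of 1 "2 ^ (l * L) :: nat" "9 * (n + 1)" "9 * ((n + 1) * (L + 1))"] by simp
  ultimately have "disperser_time n l L \<le> 2 ^ (l * L) * (20 * ((n + 1) * (L + 1)))"
    unfolding disperser_time_def by (simp add: algebra_simps)
  also have "\<dots> \<le> 2 ^ (l * L) * (2 ^ 6 * (2 ^ l * 2 ^ L))"
    using n1 L1 by (intro mult_mono) auto
  finally show ?thesis by (simp add: power_add mult_ac)
qed

text \<open>With \<open>l \<le> x + 1\<close> and \<open>L \<le> t + (2ty + 2)(x + 1)\<close> this bounds the exponent \<open>6 + l + L + l * L\<close>
  of the time bound above, where \<open>x = log 2 n\<close> and \<open>y = 1/\<gamma>\<close>.\<close>

definition exponent_poly :: "nat \<Rightarrow> real poly poly" where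
  "exponent_poly t = (let x = [:0, 1:]; y = [:[:0, 1:]:] in
     [:[:6:]:] + (x + 1) + (x + 1 + 1) * ([:[:real t:]:] + ([:[:2 * real t:]:] * y + [:[:2:]:]) * (x + 1)))"

lemma poly2_exponent_poly:
  "poly2 (exponent_poly t) x y = 6 + (x + 1) + (x + 2) * (real t + (2 * real t * y + 2) * (x + 1))"
  by (simp add: poly2_def exponent_poly_def Let_def algebra_simps)

text \<open>The same polynomial has to bound 1/\<delta> = 4 as well.\<close>

lemma poly2_exponent_poly_ge_6: "x \<ge> 0 \<Longrightarrow> y \<ge> 0 \<Longrightarrow> poly2 (exponent_poly t) x y \<ge> 6"
  unfolding poly2_exponent_poly by simp

lemma log_nat_nonneg: "log 2 (real n) \<ge> 0"
  by (cases "n = 0") (auto simp: log_def)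

lemma floorlog_le_log: "real (floorlog 2 n) \<le> log 2 (real n) + 1"
proof (cases "n = 0")
  case False
  then have "log 2 (real n) \<ge> 0" by simp
  then show ?thesis using False by (simp add: floorlog_def)
qed (simp add: floorlog_def log_def)

lemma disperser_time_le_powr:
  fixes y :: real
  assumes y: "y \<ge> 0" and M: "real M \<le> 2 * real t * y + 2"
  shows "real (disperser_time n (floorlog 2 n) (t + M * floorlog 2 n)) \<le>
    2 powr poly2 (exponent_poly t) (log 2 (real n)) y"
proof -
  let ?l = "floorlog 2 n" and ?x = "log 2 (real n)"
  let ?L = "t + M * ?l"
  have lt: "n < 2 ^ ?l" by (rule floorlog_leD) auto
  have "n < 2 ^ n" by (rule less_exp)
  then have le: "?l \<le> n" by (simp add: floorlog_le_iff)
  have l: "real ?l \<le> ?x + 1" by (rule floorlog_le_log)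
  have x: "?x \<ge> 0" by (rule log_nat_nonneg)
  have "real M * real ?l \<le> (2 * real t * y + 2) * (?x + 1)"
    using M l y by (intro mult_mono) auto
  then have L: "real ?L \<le> real t + (2 * real t * y + 2) * (?x + 1)" by simp
  \<comment> \<open>The exponent is regrouped as 6 + l + (l + 1) L, and l + 1 \<le> x + 2.\<close>
  have prod: "(real ?l + 1) * real ?L \<le> (?x + 2) * (real t + (2 * real t * y + 2) * (?x + 1))"
    by (rule mult_mono) (use l L x in auto)
  have "real (6 + ?l + ?L + ?l * ?L) = 6 + real ?l + (real ?l + 1) * real ?L"
    by (simp add: algebra_simps)
  also have "\<dots> \<le> 6 + (?x + 1) + (?x + 2) * (real t + (2 * real t * y + 2) * (?x + 1))"
    using l prod by linarith
  finally have e: "real (6 + ?l + ?L + ?l * ?L) \<le> poly2 (exponent_poly t) ?x y"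
    unfolding poly2_exponent_poly .
  have "real (disperser_time n ?l ?L) \<le> real (2 ^ (6 + ?l + ?L + ?l * ?L))"
    using disperser_time_le[OF lt le, of ?L] by (simp only: of_nat_le_iff)
  also have "\<dots> = 2 powr real (6 + ?l + ?L + ?l * ?L)"
    by (simp only: of_nat_power of_nat_numeral powr_realpow zero_less_numeral)
  also have "\<dots> \<le> 2 powr poly2 (exponent_poly t) ?x y"
    using e by simp
  finally show ?thesis .
qed

lemma strong_disperser_nbhd_family:
  assumes G: "G \<in> P_free_class t" and V: "verts G = {..<n}" and n: "n > 0"
    and \<gamma>: "\<gamma> > 0" and M: "M > 0" "2 * real t \<le> \<gamma> * real M"
  shows "strong_disperser \<gamma> (1/4) G w (set (map set (nbhd_family G n (t + M * floorlog 2 n))))"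
proof -
  let ?L = "t + M * floorlog 2 n"
  note G' = P_free_classD[OF G]
  have fam: "set (map set (nbhd_family G n ?L)) = (\<lambda>k. nbhd G (tuple_set n ?L k)) ` {..<n ^ ?L}"
    using nbhd_subset[OF G'(1)] V by (auto simp: nbhd_family_def image_image subset_iff
        intro!: image_cong)
  show ?thesis
    unfolding strong_disperser_def
  proof (intro conjI allI impI)
    show "set (map set (nbhd_family G n ?L)) \<subseteq> Pow (verts G)"
      unfolding fam using nbhd_subset[OF G'(1)] by blast
    fix I assume I: "independent G I \<and> weight w I > 0"
    have "n < 2 ^ floorlog 2 n" by (rule floorlog_leD) auto
    then have "card (verts G) < 2 ^ floorlog 2 n" using V by simp
    then obtain xs where xs: "length xs = ?L" "set xs \<subseteq> verts G"
      "good_set \<gamma> (1/4) G (weight_on w I) (nbhd G (set xs))"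
      using good_nbhd_of_list[OF G' _ _ \<gamma> M, of I w] I by blast
    obtain k where k: "k < n ^ ?L" "tuple_set n ?L k = set xs"
      using tuple_set_surj[OF xs(1), of n] xs(2) V by auto
    then show "\<exists>X\<in>set (map set (nbhd_family G n ?L)). good_set \<gamma> (1/4) G (weight_on w I) X"
      unfolding fam using xs(3) by (intro bexI[of _ "nbhd G (tuple_set n ?L k)"] imageI) auto
  qed
qed

section \<open>Computing the constant 1/4\<close>

definition quarter_program :: com where
  "quarter_program = Cond (Minus (Cell ''in'' (Num 1)) (Num 1))
     (Seq (Seq (Set ''d'' (Num 1)) (Set ''n'' (Minus (Cell ''in'' (Num 1)) (Num 2))))
       (Seq (For ''i'' ''n'' (Set ''d'' (Plus (V ''d'') (V ''d'')))) (Write (V ''d''))))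
     (Write (Num 0))"

text \<open>For k \<ge> 2 the output divided by 2^k is exactly 1/4; for k < 2 the output 0 is within
  the error, as 1/4 \<le> 2^(-k).\<close>

lemma wp_quarter_program:
  "wp quarter_program (3 * k + 6) (init_store [n, k, m, a])
     (\<lambda>s' out. out = [if k < 2 then 0 else 2 ^ (k - 2)])"
  unfolding quarter_program_def
proof (rule wp_Cond)
  let ?s = "init_store [n, k, m, a]"
  have k: "?s ''in'' 1 = k" by (simp add: init_store_def)
  assume "aval (Minus (Cell ''in'' (Num 1)) (Num 1)) ?s \<noteq> 0"
  then have k2: "k \<ge> 2" using k by simp
  let ?c = "Seq (Set ''d'' (Num 1)) (Set ''n'' (Minus (Cell ''in'' (Num 1)) (Num 2)))"
  let ?d = "Set ''d'' (Plus (V ''d'') (V ''d''))"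
  show "wp (Seq ?c (Seq (For ''i'' ''n'' ?d) (Write (V ''d'')))) (3 * k + 5) ?s
     (\<lambda>s' out. out = [if k < 2 then 0 else 2 ^ (k - 2)])"
  proof (rule wp_Seq)
    show "wp ?c 2 ?s (\<lambda>s' (out :: nat list). out = [] \<and> s' ''d'' 0 = 1 \<and> s' ''n'' 0 = k - 2)"
      using k by (intro wp_straight) auto
    fix s1 :: store and out1 :: "nat list"
    assume s1: "out1 = [] \<and> s1 ''d'' 0 = 1 \<and> s1 ''n'' 0 = k - 2"
    show "wp (Seq (For ''i'' ''n'' ?d) (Write (V ''d''))) (3 * k + 3) s1
      (\<lambda>s'' out'. out1 @ out' = [if k < 2 then 0 else 2 ^ (k - 2)])"
    proof (rule wp_Seq)
      let ?I = "\<lambda>i (s' :: store) (out :: nat list). out = [] \<and> s' ''d'' 0 = 2 ^ i"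
      show "wp (For ''i'' ''n'' ?d) (3 * k + 2) s1 (?I (k - 2))"
        by (rule wp_For[where T = 1 and N = "k - 2" and Inv = ?I])
          (use s1 in \<open>auto intro!: wp_straight\<close>)
      fix s2 and out2 :: "nat list"
      assume "?I (k - 2) s2 out2"
      then show "wp (Write (V ''d'')) 1 s2 (\<lambda>s'' out'. out1 @ out2 @ out' = [if k < 2 then 0 else 2 ^ (k - 2)])"
        using s1 k2 by (intro wp_straight) auto
    qed simp
  qed simp
next
  let ?s = "init_store [n, k, m, a]"
  assume "aval (Minus (Cell ''in'' (Num 1)) (Num 1)) ?s = 0"
  then show "wp (Write (Num 0)) (3 * k + 5) ?s (\<lambda>s' out. out = [if k < 2 then 0 else 2 ^ (k - 2)])"
    by (intro wp_straight) (auto simp: init_store_def)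
qed simp

lemma poly_time_computable_quarter: "poly_time_computable (\<lambda>_ _. 1/4)"
  unfolding poly_time_computable_def Let_def
\<comment> \<open>No digits of \<gamma> are needed, so the precision polynomial is 0.\<close>
proof (rule exI[of _ quarter_program], rule exI[of _ 0], rule exI[of _ "[:6, 3:]"], intro ballI allI impI)
  fix \<gamma> :: real and n k a :: nat
  let ?d = "if k < 2 then 0 else 2 ^ (k - 2) :: nat"
  let ?m = "poly 0 (floorlog 2 n + k)"
  have "outputs_within quarter_program [n, k, ?m, a] [?d] (real (poly [:6, 3:] (floorlog 2 n + k)))"
    by (rule outputs_withinI[OF wp_quarter_program]) simp
  moreover have "\<bar>1 / 4 - real ?d / 2 ^ k\<bar> \<le> 1 / 2 ^ k"
  proof -
    consider "k = 0" | "k = 1" | j where "k = j + 2"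
      by (metis One_nat_def Suc_1 add_2_eq_Suc' not0_implies_Suc)
    then show ?thesis by cases (auto simp: power_add)
  qed
  ultimately show "\<exists>d. outputs_within quarter_program [n, k, ?m, a] [d] (real (poly [:6, 3:] (floorlog 2 n + k))) \<and>
    \<bar>1 / 4 - real d / 2 ^ k\<bar> \<le> 1 / 2 ^ k"
    by blast
qed

lemma strongly_QP_dispersible_P_free_class: "strongly_QP_dispersible (P_free_class t)"
  unfolding strongly_QP_dispersible_def
proof (intro conjI exI[of _ "exponent_poly t"] exI[of _ "\<lambda>_ _. 1/4"] ballI allI)
  show "hereditary (P_free_class t)" by (rule hereditary_P_free_class)
  show "poly_time_computable (\<lambda>_ _. 1/4)" by (rule poly_time_computable_quarter)
  fix \<gamma> :: real assume \<gamma>: "\<gamma> \<in> {0<..<1/2}"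
  show "antimono (\<lambda>n :: nat. 1/4 :: real)" by (simp add: antimono_def)
  show "(1/4 :: real) \<in> {0<..<1/2}" by simp
  show "inverse (1/4) \<le> poly2 (exponent_poly t) (log 2 (real n)) (inverse \<gamma>)" for n
    using poly2_exponent_poly_ge_6[OF log_nat_nonneg, of "inverse \<gamma>" t n] \<gamma> by simp
  \<comment> \<open>Rounding 2t/\<gamma> up gives tW/M \<le> \<gamma>W/2, and the extra 1 keeps
    \<open>M\<close> positive for \<open>t = 0\<close>. Both together explain the \<open>+ 2\<close>
    in \<open>exponent_poly\<close>.\<close>
  define M where "M = nat \<lceil>2 * real t * inverse \<gamma>\<rceil> + 1"
  have y: "inverse \<gamma> \<ge> 0" and \<gamma>0: "\<gamma> > 0" using \<gamma> by auto
  have M_le: "real M \<le> 2 * real t * inverse \<gamma> + 2"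
  proof -
    have "real (nat \<lceil>2 * real t * inverse \<gamma>\<rceil>) = of_int \<lceil>2 * real t * inverse \<gamma>\<rceil>"
      using y by simp
    then show ?thesis unfolding M_def by linarith
  qed
  have "2 * real t * inverse \<gamma> \<le> real M" unfolding M_def by linarith
  then have M: "M > 0" "2 * real t \<le> \<gamma> * real M"
    using \<gamma>0 by (auto simp: M_def field_simps)
  show "\<exists>P. \<forall>n G w. G \<in> P_free_class t \<and> verts G = {..<n} \<longrightarrow>
     (let B = 2 powr poly2 (exponent_poly t) (log 2 (real n)) (inverse \<gamma>) in
       \<exists>Xs. outputs_within P (weighted_graph_code G w) (blocks Xs) B \<and>
         strong_disperser \<gamma> (1/4) G w (set (map set Xs)) \<and> real (card (set (map set Xs))) \<le> B)"
  proof (rule exI[of _ "disperser_program t M"], intro allI impI, elim conjE)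
    fix n G and w :: "nat \<Rightarrow> nat"
    assume G: "G \<in> P_free_class t" and V: "verts G = {..<n}"
    define B where "B = 2 powr poly2 (exponent_poly t) (log 2 (real n)) (inverse \<gamma>)"
    define Xs where "Xs = (if n = 0 then [] else nbhd_family G n (t + M * floorlog 2 n))"
    have out: "outputs_within (disperser_program t M) (weighted_graph_code G w) (blocks Xs) B"
      unfolding weighted_graph_code_def Xs_def B_def
      by (rule outputs_withinI[OF wp_disperser_program[OF V] disperser_time_le_powr[OF y M_le]])
    have "strong_disperser \<gamma> (1/4) G w (set (map set Xs))"
    proof (cases "n = 0")
      case True
      then have "\<not> (independent G I \<and> weight w I > 0)" for I
        using V by (auto simp: independent_def weight_def)
      then show ?thesis using True by (simp add: strong_disperser_def Xs_def)
    next
      case False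
      then show ?thesis
        using strong_disperser_nbhd_family[OF G V _ \<gamma>0 M] by (simp add: Xs_def)
    qed
    moreover have "real (card (set (map set Xs))) \<le> B"
    proof -
      have "card (set (map set Xs)) \<le> length (blocks Xs)"
        using card_length[of "map set Xs"] length_le_length_blocks[of Xs] by simp
      then show ?thesis using length_out_if_outputs_within[OF out] by linarith
    qed
    ultimately show "let B = 2 powr poly2 (exponent_poly t) (log 2 (real n)) (inverse \<gamma>) in
       \<exists>Xs. outputs_within (disperser_program t M) (weighted_graph_code G w) (blocks Xs) B \<and>
         strong_disperser \<gamma> (1/4) G w (set (map set Xs)) \<and> real (card (set (map set Xs))) \<le> B"
      unfolding Let_def B_def[symmetric] using out by blast
  qed
qed

section \<open>Uniform dispersibility\<close>

text \<open>The enumeration cannot be left early. The flag \<open>f\<close> lets only the first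
  accepted tuple be written and turns the later rounds into no-ops.\<close>

definition separator_body :: com where
  "separator_body = Cond (V ''f'') Skip (Seq mark (Seq label_components (Seq check_balance
     (Cond (V ''o'')
       (Seq (Set ''f'' (Num 1))
         (Seq (emit (Cell ''x'' (V ''v''))) (Seq (emit (Num 1)) (For ''u'' ''n'' (emit in_class)))))
       Skip))))"

lemma writes_separator_body [simp]:
  "writes separator_body = {''f'', ''v'', ''i'', ''x'', ''l'', ''u'', ''w'', ''a'', ''b'', ''o''}"
  by (auto simp: separator_body_def)

definition separator_program :: "nat \<Rightarrow> com" where
  "separator_program t = Seq load_graph (Seq (Set ''L'' (Num t))
     (Cond (V ''n'') (enumerate separator_body) Skip))"

definition separates :: "nat graph \<Rightarrow> nat \<Rightarrow> nat set \<Rightarrow> (nat \<Rightarrow> nat) \<Rightarrow> bool" where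
  "separates G n X f \<longleftrightarrow> labelling G X n ({..<n} \<times> {..<n}) f \<and>
     (\<forall>u<n. 2 * card {v. v < n \<and> v \<notin> X \<and> f v = u} \<le> n)"

text \<open>This is the order of \<open>codes_disperser\<close>: the removed set, all vertices of
  the edgeless graph, then the class of each label; there are no blocks for edges or
  triangles.\<close>

definition separator_output :: "nat \<Rightarrow> nat set \<Rightarrow> (nat \<Rightarrow> nat) \<Rightarrow> nat list" where
  "separator_output n X f = blocks ([filter (\<lambda>v. v \<in> X) [0..<n], [0..<n]] @
     map (\<lambda>u. filter (\<lambda>v. v \<notin> X \<and> f v = u) [0..<n]) [0..<n])"

definition valid_output :: "nat graph \<Rightarrow> nat \<Rightarrow> nat \<Rightarrow> nat list \<Rightarrow> bool" where
  "valid_output G n t out \<longleftrightarrow> (\<exists>S f. S \<subseteq> {..<n} \<and> card S \<le> t \<and>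
     separates G n (nbhd G S) f \<and> out = separator_output n (nbhd G S) f)"

definition balanced :: "nat graph \<Rightarrow> nat \<Rightarrow> nat set \<Rightarrow> bool" where
  "balanced G n X \<longleftrightarrow> (\<forall>D. linked G D \<and> D \<subseteq> verts G - X \<longrightarrow> 2 * card D \<le> n)"

text \<open>Completeness of the test: the class of label \<open>u\<close> lies inside the component
  of \<open>u\<close>, which is a linked set. So a balanced tuple is always accepted.\<close>

lemma separates_if_balanced:
  assumes G: "sgraph G" and V: "verts G = {..<n}" and lab: "labelling G X n ({..<n} \<times> {..<n}) f"
    and bal: "balanced G n X"
  shows "separates G n X f"
  unfolding separates_def
proof (intro conjI lab allI impI)
  fix u assume "u < n"
  let ?K = "{v. v < n \<and> v \<notin> X \<and> f v = u}" and ?H = "del_verts G X"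
  have comp: "u \<in> component_of ?H v" if "v \<in> ?K" for v
    using lab that by (auto simp: labelling_def)
  show "2 * card ?K \<le> n"
  proof (cases "?K = {}")
    case False
    then obtain v where v: "v \<in> ?K" by blast
    have u: "u \<in> verts ?H" using comp[OF v] by (simp add: component_of_def)
    have "x \<in> component_of ?H u" if "x \<in> ?K" for x
      using component_of_sym[OF comp[OF that]] that V by (simp add: verts_del_verts)
    then have sub: "?K \<subseteq> component_of ?H u" by blast
    have C: "component_of ?H u \<in> components ?H" using u by (simp add: components_def)
    note C' = linked_component[OF G C]
    have "finite (component_of ?H u)" using C'(2) V by (auto intro: finite_subset[of _ "{..<n}"])
    then have "card ?K \<le> card (component_of ?H u)" using sub by (rule card_mono)
    moreover have "2 * card (component_of ?H u) \<le> n"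
      using bal C'(1,2) by (simp add: balanced_def)
    ultimately show ?thesis by simp
  qed (simp only: card.empty)
qed

lemma wp_emit_separator:
  assumes n: "s ''n'' 0 = n" and X: "\<And>v. v < n \<Longrightarrow> s ''x'' v = of_bool (v \<in> X)"
  shows "wp (Seq (emit (Cell ''x'' (V ''v''))) (Seq (emit (Num 1)) (For ''u'' ''n'' (emit in_class))))
    (n * (n * 4 + 13) + 8) s (\<lambda>s' out. out = separator_output n X (s ''l''))"
proof (rule wp_Seq)
  show "wp (emit (Cell ''x'' (V ''v''))) (n * 4 + 3) s (\<lambda>s' out. out = blocks [filter (\<lambda>v. v \<in> X) [0..<n]])"
  proof (rule wp_emit[of s n, OF n])
    fix v s' assume v: "v < n" "agree {''v''} s s'" "s' ''v'' 0 = v"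
    then show "aval (Cell ''x'' (V ''v'')) s' \<noteq> 0 \<longleftrightarrow> v \<in> X"
      using agreeD[OF v(2), of "''x''"] X by simp
  qed
  fix s1 out1
  assume out1: "out1 = blocks [filter (\<lambda>v. v \<in> X) [0..<n]]"
    and ag1: "agree (writes (emit (Cell ''x'' (V ''v'')))) s s1"
  show "wp (Seq (emit (Num 1)) (For ''u'' ''n'' (emit in_class))) (n * (n * 4 + 9) + 5) s1
    (\<lambda>s'' out'. out1 @ out' = separator_output n X (s ''l''))"
  proof (rule wp_Seq)
    have n1: "s1 ''n'' 0 = n" using agreeD[OF ag1, of "''n''"] n by simp
    show "wp (emit (Num 1)) (n * 4 + 3) s1 (\<lambda>s' out. out = blocks [filter (\<lambda>_. True) [0..<n]])"
      by (rule wp_emit[of s1 n, OF n1]) simp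
    fix s2 out2
    assume out2: "out2 = blocks [filter (\<lambda>_. True) [0..<n]]" and ag2: "agree (writes (emit (Num 1))) s1 s2"
    have ag02: "agree {''v''} s s2" using ag1 ag2 by (auto simp: agree_def)
    have n2: "s2 ''n'' 0 = n" using agreeD[OF ag02, of "''n''"] n by simp
    let ?f = "\<lambda>u. filter (\<lambda>v. v \<notin> X \<and> s ''l'' v = u) [0..<n]"
    let ?I = "\<lambda>i (s' :: store) out. out = blocks (map ?f [0..<i])"
    have "wp (For ''u'' ''n'' (emit in_class)) (n * (n * 4 + 5) + 2) s2 (?I n)"
    proof (rule wp_For[where T = "n * 4 + 3" and N = n and Inv = ?I])
      fix i s3 out3
      assume out3: "?I i s3 out3" and i: "i < n" "s3 ''u'' 0 = i"
        and ag3: "agree (insert ''u'' (writes (emit in_class))) s2 s3"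
      have ag03: "agree {''u'', ''v''} s s3" using ag02 ag3 by (auto simp: agree_def)
      have n3: "s3 ''n'' 0 = n" using agreeD[OF ag03, of "''n''"] n by simp
      have "wp (emit in_class) (n * 4 + 3) s3 (\<lambda>s' out. out = blocks [?f i])"
      proof (rule wp_emit[of s3 n, OF n3])
        fix v s' assume v: "v < n" "agree {''v''} s3 s'" "s' ''v'' 0 = v"
        have ag: "agree {''u'', ''v''} s s'" using ag03 v(2) by (auto simp: agree_def)
        have "s' ''x'' = s ''x''" "s' ''l'' = s ''l''" "s' ''u'' 0 = i"
          using agreeD[OF ag, of "''x''"] agreeD[OF ag, of "''l''"] agreeD[OF v(2), of "''u''"] i by auto
        then show "aval in_class s' \<noteq> 0 \<longleftrightarrow> v \<notin> X \<and> s ''l'' v = i"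
          unfolding aval_in_class using v X by simp
      qed
      then show "wp (emit in_class) (n * 4 + 3) s3 (\<lambda>s'' out'. ?I (Suc i) s'' (out3 @ out'))"
        using out3 by (auto elim!: wp_conseq simp: blocks_append)
    qed (use n2 in \<open>auto simp: blocks_def\<close>)
    then show "wp (For ''u'' ''n'' (emit in_class)) (n * (n * 4 + 5) + 2) s2
      (\<lambda>s'' out'. out1 @ out2 @ out' = separator_output n X (s ''l''))"
      using out1 out2 by (auto elim!: wp_conseq simp: separator_output_def simp flip: blocks_append)
  qed (simp add: algebra_simps)
qed (simp add: algebra_simps)

definition separator_time :: "nat \<Rightarrow> nat \<Rightarrow> nat" where
  "separator_time n t = (n * 3 + t * (n * 4 + 4) + 4) + (n * 3 + n * (n * (n * 4 + 7) + 4) + 4) +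
     (n * (n * 4 + 7) + 3) + (n * (n * 4 + 13) + 8) + 3"

text \<open>A rejected tuple is recorded as not balanced, although the program only inspects labels;
  over the whole enumeration this forces an acceptance.\<close>

lemma wp_separator_body:
  assumes G: "graph_env G n s" "sgraph G" and V: "verts G = {..<n}"
    and L: "s ''L'' 0 = t" and d: "\<And>i. i < t \<Longrightarrow> s ''d'' i < n"
  defines "S \<equiv> s ''d'' ` {..<t}"
  shows "wp separator_body (separator_time n t) s (\<lambda>s' out.
    if s ''f'' 0 \<noteq> 0 then s' ''f'' = s ''f'' \<and> out = []
    else if s' ''f'' 0 \<noteq> 0 then valid_output G n t out
    else out = [] \<and> \<not> balanced G n (nbhd G S))"
    (is "wp _ _ _ ?Q")
  unfolding separator_body_def
proof (rule wp_Cond)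
  assume "aval (V ''f'') s \<noteq> 0"
  then show "wp Skip (separator_time n t - 1) s ?Q"
    by (intro wp_straight) (auto simp: separator_time_def)
next
  assume f0: "aval (V ''f'') s = 0"
  let ?X = "nbhd G S"
  let ?emit = "Seq (emit (Cell ''x'' (V ''v''))) (Seq (emit (Num 1)) (For ''u'' ''n'' (emit in_class)))"
  let ?final = "Cond (V ''o'') (Seq (Set ''f'' (Num 1)) ?emit) Skip"
  let ?T1 = "n * 3 + t * (n * 4 + 4) + 4" and ?T2 = "n * 3 + n * (n * (n * 4 + 7) + 4) + 4"
    and ?T3 = "n * (n * 4 + 7) + 3" and ?T4 = "n * (n * 4 + 13) + 8"
  have n: "s ''n'' 0 = n" using G by (simp add: graph_env_def)
  have S: "S \<subseteq> {..<n}" "card S \<le> t"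
    using d card_image_le[of "{..<t}" "s ''d''"] by (auto simp: S_def)
  show "wp (Seq mark (Seq label_components (Seq check_balance ?final))) (separator_time n t - 1) s ?Q"
  proof (rule wp_Seq)
    show "wp mark ?T1 s (\<lambda>s' out. out = [] \<and> (\<forall>v<n. s' ''x'' v = of_bool (v \<in> ?X)))"
      unfolding S_def using d by (intro wp_mark[OF G(1) L])
    fix s1 and out1 :: "nat list"
    assume s1: "out1 = [] \<and> (\<forall>v<n. s1 ''x'' v = of_bool (v \<in> ?X))" and ag1: "agree (writes mark) s s1"
    have G1: "graph_env G n s1" by (rule graph_env_agree[OF G(1) ag1]) auto
    show "wp (Seq label_components (Seq check_balance ?final)) (?T2 + (?T3 + (?T4 + 2))) s1
      (\<lambda>s'' out'. ?Q s'' (out1 @ out'))"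
    proof (rule wp_Seq)
      show "wp label_components ?T2 s1 (\<lambda>s' out. out = [] \<and> labelling G ?X n ({..<n} \<times> {..<n}) (s' ''l''))"
        using s1 by (intro wp_label_components[OF G1 V]) blast
      fix s2 and out2 :: "nat list"
      assume s2: "out2 = [] \<and> labelling G ?X n ({..<n} \<times> {..<n}) (s2 ''l'')"
        and ag2: "agree (writes label_components) s1 s2"
      have G2: "graph_env G n s2" by (rule graph_env_agree[OF G1 ag2]) auto
      have n2: "s2 ''n'' 0 = n" using G2 by (simp add: graph_env_def)
      have x2: "s2 ''x'' v = of_bool (v \<in> ?X)" if "v < n" for v
        using agreeD[OF ag2, of "''x''"] s1 that by simp
      have K: "{v. v < n \<and> s2 ''x'' v = 0 \<and> s2 ''l'' v = u} = {v. v < n \<and> v \<notin> ?X \<and> s2 ''l'' v = u}" for u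
        using x2 by auto
      show "wp (Seq check_balance ?final) (?T3 + (?T4 + 2)) s2
        (\<lambda>s'' out'. ?Q s'' (out1 @ out2 @ out'))"
      proof (rule wp_Seq)
        show "wp check_balance ?T3 s2 (\<lambda>s' out. out = [] \<and>
          s' ''o'' 0 = of_bool (\<forall>u<n. 2 * card {v. v < n \<and> v \<notin> ?X \<and> s2 ''l'' v = u} \<le> n))"
          using wp_check_balance[of s2 n, OF n2] unfolding K .
        fix s3 and out3 :: "nat list"
        assume s3: "out3 = [] \<and>
          s3 ''o'' 0 = of_bool (\<forall>u<n. 2 * card {v. v < n \<and> v \<notin> ?X \<and> s2 ''l'' v = u} \<le> n)"
          and ag3: "agree (writes check_balance) s2 s3"
        have sep: "s3 ''o'' 0 \<noteq> 0 \<longleftrightarrow> separates G n ?X (s2 ''l'')"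
          using s2 s3 by (simp add: separates_def)
        have f3: "s3 ''f'' 0 = 0"
          using agreeD[OF ag1, of "''f''"] agreeD[OF ag2, of "''f''"] agreeD[OF ag3, of "''f''"] f0 by simp
        have l3: "s3 ''l'' = s2 ''l''" and x3: "s3 ''x'' = s2 ''x''" and n3: "s3 ''n'' 0 = n"
          using agreeD[OF ag3, of "''l''"] agreeD[OF ag3, of "''x''"] agreeD[OF ag3, of "''n''"] n2 by auto
        show "wp ?final (?T4 + 2) s3 (\<lambda>s'' out'. ?Q s'' (out1 @ out2 @ out3 @ out'))"
        proof (rule wp_Cond)
          assume "aval (V ''o'') s3 \<noteq> 0"
          then have sp: "separates G n ?X (s2 ''l'')" using sep by simp
          show "wp (Seq (Set ''f'' (Num 1)) ?emit) (?T4 + 1) s3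
            (\<lambda>s'' out'. ?Q s'' (out1 @ out2 @ out3 @ out'))"
          proof (rule wp_Seq)
            show "wp (Set ''f'' (Num 1)) 1 s3 (\<lambda>s' (out :: nat list). out = [] \<and> s' ''f'' 0 = 1)"
              by (rule wp_straight) auto
            fix s4 :: store and out4 :: "nat list"
            assume s4: "out4 = [] \<and> s4 ''f'' 0 = 1" and ag4: "agree (writes (Set ''f'' (Num 1))) s3 s4"
            have l4: "s4 ''l'' = s2 ''l''" and n4: "s4 ''n'' 0 = n"
              using agreeD[OF ag4, of "''l''"] agreeD[OF ag4, of "''n''"] l3 n3 by auto
            have x4: "s4 ''x'' v = of_bool (v \<in> ?X)" if "v < n" for v
              using agreeD[OF ag4, of "''x''"] x3 x2[OF that] by simp
            show "wp ?emit ?T4 s4 (\<lambda>s'' out'. ?Q s'' (out1 @ out2 @ out3 @ out4 @ out'))"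
            proof (rule wp_conseq[OF wp_emit_separator[of s4 n ?X, OF n4 x4]])
              fix s5 out5
              assume out5: "out5 = separator_output n ?X (s4 ''l'')" and ag5: "agree (writes ?emit) s4 s5"
              have "s5 ''f'' 0 = 1" using agreeD[OF ag5, of "''f''"] s4 by simp
              moreover have "valid_output G n t out5"
                unfolding valid_output_def using S sp out5 l4 by auto
              ultimately show "?Q s5 (out1 @ out2 @ out3 @ out4 @ out5)"
                using s1 s2 s3 s4 f0 by simp
            qed simp_all
          qed simp
        next
          assume "aval (V ''o'') s3 = 0"
          then have "\<not> separates G n ?X (s2 ''l'')" using sep by simp
          then have "\<not> balanced G n ?X" using separates_if_balanced[OF G(2) V] s2 by blast
          then show "wp Skip (?T4 + 1) s3 (\<lambda>s'' out'. ?Q s'' (out1 @ out2 @ out3 @ out'))"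
            using s1 s2 s3 f0 f3 by (intro wp_straight) auto
        qed simp
      qed simp
    qed simp
  qed (simp add: separator_time_def)
qed (simp add: separator_time_def)

lemma wp_separator_program:
  assumes G: "sgraph G" and V: "verts G = {..<n}" and n: "n > 0"
    and ex: "\<exists>xs. length xs = t \<and> set xs \<subseteq> {..<n} \<and> balanced G n (nbhd G (set xs))"
  shows "wp (separator_program t) (n ^ t * (separator_time n t + t * 6 + 4) + n * 3 + 7)
    (init_store (graph_code G)) (\<lambda>s' out. valid_output G n t out)"
  unfolding separator_program_def
proof (rule wp_Seq)
  let ?s = "init_store (graph_code G)"
  show "wp load_graph (n * 3 + 4) ?s (\<lambda>s' out. out = [] \<and> graph_env G n s')"
    by (rule wp_load_graph[OF V, of _ "[]"]) simp
  fix s1 and out1 :: "nat list"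
  assume s1: "out1 = [] \<and> graph_env G n s1" and ag1: "agree (writes load_graph) ?s s1"
  let ?U = "n ^ t * (separator_time n t + t * 6 + 4) + 1"
  show "wp (Seq (Set ''L'' (Num t)) (Cond (V ''n'') (enumerate separator_body) Skip)) (1 + Suc ?U) s1
    (\<lambda>s'' out'. valid_output G n t (out1 @ out'))"
  proof (rule wp_Seq)
    show "wp (Set ''L'' (Num t)) 1 s1 (\<lambda>s' (out :: nat list). out = [] \<and> s' ''L'' 0 = t)"
      by (rule wp_straight) auto
    fix s2 and out2 :: "nat list"
    assume s2: "out2 = [] \<and> s2 ''L'' 0 = t" and ag2: "agree (writes (Set ''L'' (Num t))) s1 s2"
    have G2: "graph_env G n s2" using s1 by (auto intro: graph_env_agree[OF _ ag2])
    have n2: "s2 ''n'' 0 = n" using G2 by (simp add: graph_env_def)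
    have zero: "s2 z = (\<lambda>_. 0)" if "z \<in> {''c'', ''d'', ''f''}" for z
      using agreeD[OF ag1, of z] agreeD[OF ag2, of z] that by (auto simp: init_store_def)
    let ?I = "\<lambda>k (s' :: store) out. if s' ''f'' 0 \<noteq> 0 then valid_output G n t out
      else out = [] \<and> (\<forall>j<k. \<not> balanced G n (nbhd G (tuple_set n t j)))"
    have "wp (enumerate separator_body) ?U s2 (?I (n ^ t))"
    proof (rule wp_enumerate[where Inv = ?I])
      fix k s3 out3
      assume I: "?I k s3 out3" and k: "k < n ^ t" and dig: "\<forall>i<t. s3 ''d'' i = k div n ^ i mod n"
        and ag3: "agree (writes separator_body \<union> {''c'', ''i'', ''d''}) s2 s3"
      have G3: "graph_env G n s3" by (rule graph_env_agree[OF G2 ag3]) auto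
      have L3: "s3 ''L'' 0 = t" using agreeD[OF ag3, of "''L''"] s2 by simp
      have d3: "s3 ''d'' i < n" if "i < t" for i using dig that n by simp
      have tuple: "s3 ''d'' ` {..<t} = tuple_set n t k" using dig by (auto simp: tuple_set_def)
      show "wp separator_body (separator_time n t) s3 (\<lambda>s'' out'. ?I (Suc k) s'' (out3 @ out'))"
      proof (rule wp_conseq[OF wp_separator_body[OF G3 G V L3 d3]])
        fix s4 out4
        assume "if s3 ''f'' 0 \<noteq> 0 then s4 ''f'' = s3 ''f'' \<and> out4 = []
          else if s4 ''f'' 0 \<noteq> 0 then valid_output G n t out4
          else out4 = [] \<and> \<not> balanced G n (nbhd G (s3 ''d'' ` {..<t}))"
        then show "?I (Suc k) s4 (out3 @ out4)"
          using I unfolding tuple by (auto simp: less_Suc_eq split: if_splits)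
      qed auto
    next
      fix k s' s'' out
      assume "?I k s' out" and ag: "agree {''c'', ''i'', ''d''} s' s''"
      then show "?I k s'' out" using agreeD[OF ag, of "''f''"] by simp
    qed (use n n2 s2 zero in auto)
    \<comment> \<open>Some tuple is balanced, so the search cannot end with the flag unset.\<close>
    moreover have "out = [] \<and> (\<forall>j<n ^ t. \<not> balanced G n (nbhd G (tuple_set n t j))) \<Longrightarrow> False"
      for out :: "nat list"
      using ex tuple_set_surj[of _ t n] by metis
    ultimately have "wp (enumerate separator_body) ?U s2 (\<lambda>s' out. valid_output G n t out)"
      by (auto elim!: wp_conseq split: if_splits)
    then show "wp (Cond (V ''n'') (enumerate separator_body) Skip) (Suc ?U) s2
      (\<lambda>s'' out'. valid_output G n t (out1 @ out2 @ out'))"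
      using s1 s2 n n2 by (intro wp_Cond) auto
  qed simp
qed simp

text \<open>The coefficients come from expanding \<open>separator_time n t + t * 6 + 4\<close> in
  powers of \<open>n\<close>.\<close>

definition separator_poly :: "nat \<Rightarrow> nat poly" where
  "separator_poly t = [:0, 1:] ^ t * [:10 * t + 26, 30 + 4 * t, 15, 4:] + [:7, 3:]"

lemma separator_time_le_poly:
  "n ^ t * (separator_time n t + t * 6 + 4) + n * 3 + 7 \<le> poly (separator_poly t) n"
proof -
  have "poly (separator_poly t) n = n ^ t * (10 * t + 26 + n * (30 + 4 * t + n * (15 + n * 4))) + (7 + n * 3)"
    by (simp add: separator_poly_def poly_power algebra_simps)
  moreover have "separator_time n t + t * 6 + 4 \<le> 10 * t + 26 + n * (30 + 4 * t + n * (15 + n * 4))"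
    by (simp add: separator_time_def algebra_simps)
  then have "n ^ t * (separator_time n t + t * 6 + 4) \<le>
    n ^ t * (10 * t + 26 + n * (30 + 4 * t + n * (15 + n * 4)))"
    by (rule mult_le_mono2)
  ultimately show ?thesis by linarith
qed

section \<open>The decomposition along an edgeless graph\<close>

definition discrete_graph :: "nat \<Rightarrow> nat graph" where
  "discrete_graph n = ({..<n}, {})"

text \<open>Without edges and triangles, the condition on edges of G - X says that none joins two
  parts, and the atoms are the parts themselves. A vertex that serves as no label gets an empty
  part.\<close>

definition class_parts :: "nat \<Rightarrow> nat set \<Rightarrow> (nat \<Rightarrow> nat) \<Rightarrow> nat part \<Rightarrow> nat set" where
  "class_parts n X f z = (case z of Vtx u \<Rightarrow> {v. v < n \<and> v \<notin> X \<and> f v = u} | _ \<Rightarrow> {})"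

lemma parts_discrete_graph: "parts (discrete_graph n) = Vtx ` {..<n}"
  by (auto simp: parts_def discrete_graph_def triangles_def)

lemma atoms_discrete_graph: "atoms (discrete_graph n) \<eta> \<epsilon> = (\<lambda>v. \<eta> (Vtx v)) ` {..<n}"
  by (auto simp: atoms_def discrete_graph_def triangles_def)

lemma codes_separator_output:
  assumes "X \<subseteq> {..<n}"
  shows "codes_disperser (separator_output n X f) X (discrete_graph n) (class_parts n X f) (\<lambda>_ _. {})"
  unfolding codes_disperser_def
  using assms
  by (intro exI[of _ "filter (\<lambda>v. v \<in> X) [0..<n]"] exI[of _ "[0..<n]"] exI[of _ "[]"]
      exI[of _ "\<lambda>u. filter (\<lambda>v. v \<notin> X \<and> f v = u) [0..<n]"] exI[of _ "\<lambda>_. []"] exI[of _ "\<lambda>_ _. []"])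
    (auto simp: separator_output_def discrete_graph_def triangles_def class_parts_def)

lemma esd_separator:
  assumes G: "sgraph G" and V: "verts G = {..<n}" and n: "n > 0" and sep: "separates G n X f"
  shows "esd (del_verts G X) (discrete_graph n) (class_parts n X f) (\<lambda>_ _. {})"
proof -
  have lab: "labelling G X n ({..<n} \<times> {..<n}) f" using sep by (simp add: separates_def)
  have lt: "f v < n" if "v < n" "v \<notin> X" for v
    using lab that V by (auto simp: labelling_def component_of_def verts_del_verts)
  have V': "verts (del_verts G X) = {v. v < n \<and> v \<notin> X}"
    using V by (auto simp: verts_del_verts)
  have "esd_edge (discrete_graph n) (class_parts n X f) (\<lambda>_ _. {}) x y"
    if xy: "{x, y} \<in> edges (del_verts G X)" for x y
  proof -
    have e: "x < n" "y < n" "x \<notin> X" "y \<notin> X" "{x, y} \<in> edges G"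
      using xy V by (auto simp: edges_del_verts)
    then have "f x = f y" using lab by (auto simp: labelling_def)
    then show ?thesis
      using e lt by (auto simp: esd_edge_def parts_discrete_graph class_parts_def)
  qed
  moreover have "(\<Union>z\<in>parts (discrete_graph n). class_parts n X f z) = verts (del_verts G X)"
    unfolding V' parts_discrete_graph using lt by (auto simp: class_parts_def)
  moreover have "disjoint_family_on (class_parts n X f) (parts (discrete_graph n))"
    by (auto simp: disjoint_family_on_def parts_discrete_graph class_parts_def)
  ultimately show ?thesis
    using n unfolding esd_def by (auto simp: discrete_graph_def sgraph_def)
qed

text \<open>At most \<surd>n / 2 vertices are removed and an atom \<open>A\<close> has at most n/2.
  So at least n/2 vertices lie outside \<open>A\<close>, and n^(-1/2) times their number is at least
  \<surd>n / 2.\<close>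

lemma uniform_disperser_separator:
  assumes G: "sgraph G" and V: "verts G = {..<n}" and n: "n \<ge> 4"
    and S: "S \<subseteq> {..<n}" "card S \<le> t" and sep: "separates G n (nbhd G S) f"
    and deg: "\<And>v. v < n \<Longrightarrow> real (card (closed_nbhd G v)) \<le> 1 / (2 * (real t + 1)) * real n powr (1/2)"
  shows "uniform_disperser (1/2) G (nbhd G S) (discrete_graph n) (class_parts n (nbhd G S) f) (\<lambda>_ _. {})"
proof -
  let ?X = "nbhd G S" and ?r = "sqrt (real n)"
  have r: "?r > 0" "?r * ?r = real n" using n by auto
  have r2: "?r \<ge> 2" using n real_le_rsqrt[of 2 "real n"] by simp
  have half: "real n powr (1/2) = ?r" by (simp add: powr_half_sqrt)
  have nhalf: "real n powr (- (1/2)) = 1 / ?r" using half by (simp add: powr_minus_divide)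
  have fin: "finite S" using S finite_subset by blast
  have "(\<Sum>v\<in>nbhd G {q}. 1) \<le> 1 / (2 * (real t + 1)) * ?r" if "q \<in> S" for q
  proof -
    have "closed_nbhd G q \<subseteq> {..<n}"
      using S that V sgraph_edgeD[OF G] by (auto simp: closed_nbhd_def)
    then have "finite (closed_nbhd G q)" by (rule finite_subset) simp
    moreover have "nbhd G {q} \<subseteq> closed_nbhd G q"
      by (auto simp: nbhd_def closed_nbhd_def insert_commute)
    ultimately have "card (nbhd G {q}) \<le> card (closed_nbhd G q)" by (rule card_mono)
    then show ?thesis using deg[of q] that S half by auto
  qed
  then have "(\<Sum>v\<in>nbhd G S. 1) \<le> real (card S) * (1 / (2 * (real t + 1)) * ?r)"
    by (intro sum_nbhd_le[OF G _ fin]) auto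
  \<comment> \<open>The denominator 2(t + 1) in place of 2t keeps the degree constant positive for
    \<open>t = 0\<close>.\<close>
  also have "\<dots> \<le> (real t + 1) * (1 / (2 * (real t + 1)) * ?r)"
    using S(2) r by (intro mult_right_mono) auto
  also have "\<dots> = ?r / 2"
    using add_pos_nonneg[of 1 "real t"] by (simp add: field_simps)
  finally have X: "real (card ?X) \<le> ?r / 2" by simp
  have A: "real (card ?X) \<le> 1 / ?r * real (card ({..<n} - A)) \<and> real (card A) \<le> real n - ?r"
    if A_in: "A \<in> atoms (discrete_graph n) (class_parts n ?X f) (\<lambda>_ _. {})" for A
  proof -
    obtain u where u: "u < n" "A = {v. v < n \<and> v \<notin> ?X \<and> f v = u}"
      using A_in by (auto simp: atoms_discrete_graph class_parts_def)
    then have cA: "2 * card A \<le> n" using sep by (simp add: separates_def)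
    have "A \<subseteq> {..<n}" using u by auto
    then have "real (card ({..<n} - A)) = real n - real (card A)"
      using cA by (subst card_Diff_subset) (auto intro: finite_subset)
    then have "real n / 2 \<le> real (card ({..<n} - A))" using cA by simp
    then have "1 / ?r * (real n / 2) \<le> 1 / ?r * real (card ({..<n} - A))"
      using r by (intro mult_left_mono) auto
    moreover have "1 / ?r * (real n / 2) = ?r / 2" using r by (simp add: field_simps)
    \<comment> \<open>From \<open>n \<ge> 4\<close>, that is, \<surd>n \<ge> 2, it follows that n/2
      \<le> n - \<surd>n.\<close>
    moreover have "?r \<le> real n / 2" using mult_right_mono[OF r2, of ?r] r by simp
    ultimately show ?thesis using X cA by linarith
  qed
  show ?thesis
    unfolding uniform_disperser_def Let_def
    using nbhd_subset[OF G] esd_separator[OF G V _ sep] n A half nhalf V by simp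
qed

lemma uniformly_dispersible_P_free_class: "uniformly_dispersible (1/2) (P_free_class t)"
  unfolding uniformly_dispersible_def
proof (intro conjI exI[of _ "4 :: nat"] exI[of _ "1 / (2 * (real t + 1))"]
    exI[of _ "separator_program t"] exI[of _ "separator_poly t"] allI impI)
  show "hereditary (P_free_class t)" by (rule hereditary_P_free_class)
  show "(4 :: nat) > 0" by simp
  show "1 / (2 * (real t + 1)) > 0" by simp
  fix n G
  assume asm: "4 \<le> n \<and> G \<in> P_free_class t \<and> verts G = {..<n} \<and> connected_graph G \<and>
    (\<forall>v\<in>verts G. real (card (closed_nbhd G v)) \<le> 1 / (2 * (real t + 1)) * real n powr (1/2))"
  then have V: "verts G = {..<n}" and n: "n \<ge> 4" and conn: "connected_graph G" by auto
  note G = P_free_classD[of G t]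
  have G1: "sgraph G" using G asm by blast
  obtain xs where "length xs = t" "set xs \<subseteq> verts G"
    "\<forall>D. linked G D \<and> D \<subseteq> verts G - nbhd G (set xs) \<longrightarrow> 2 * card D \<le> card (verts G)"
    using balanced_separator_list[OF G1 conn _ G(2,3)] asm by auto
  then have ex: "\<exists>xs. length xs = t \<and> set xs \<subseteq> {..<n} \<and> balanced G n (nbhd G (set xs))"
    using V by (auto simp: balanced_def)
  have "n > 0" using n by simp
  note wp = wp_separator_program[OF G1 V this ex]
  then obtain k s' out where e: "exec (separator_program t) (init_store (graph_code G)) k s' out"
    "k \<le> poly (separator_poly t) n" and valid: "valid_output G n t out"
    unfolding wp_def using separator_time_le_poly[of n t] order_trans by blast
  obtain S f where S: "S \<subseteq> {..<n}" "card S \<le> t" "separates G n (nbhd G S) f"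
    "out = separator_output n (nbhd G S) f"
    using valid unfolding valid_output_def by blast
  show "\<exists>out X H \<eta> \<epsilon>. outputs_within (separator_program t) (graph_code G) out (real (poly (separator_poly t) n)) \<and>
    codes_disperser out X (H :: nat graph) \<eta> \<epsilon> \<and> uniform_disperser (1/2) G X H \<eta> \<epsilon>"
  proof (intro exI conjI)
    show "outputs_within (separator_program t) (graph_code G) out (real (poly (separator_poly t) n))"
      unfolding outputs_within_def using e by auto
    show "codes_disperser out (nbhd G S) (discrete_graph n) (class_parts n (nbhd G S) f) (\<lambda>_ _. {})"
      unfolding S(4) using nbhd_subset[OF G1] V by (intro codes_separator_output) auto
    show "uniform_disperser (1/2) G (nbhd G S) (discrete_graph n) (class_parts n (nbhd G S) f) (\<lambda>_ _. {})"
      using uniform_disperser_separator[OF G1 V n S(1-3)] asm V by auto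
  qed
qed

theorem theorem5p1:
  fixes t :: nat
  shows "strongly_QP_dispersible (P_free_class t) \<and> uniformly_dispersible (1/2) (P_free_class t)"
  using strongly_QP_dispersible_P_free_class uniformly_dispersible_P_free_class by blast

end
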